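(* Under the hypotheses of the cluster expansion theorem (Assumptions 1 and 2, or Assumptions 1 and 2', together with $\int\mathrm{d}|\mu|(y)\,e^{a(y)+2b(y)}<\infty$), for almost all $x_1,x_2\in\mathbb{X}$, \[ \frac{Z(x_1)}{Z}=\hat Z(x_1),\qquad \frac{Z(x_1,x_2)}{Z}=\hat Z(x_1)\hat Z(x_2)+\hat Z(x_1,x_2). \]
   Context: Let $(\mathbb{X},\mathcal{X},\mu)$ be a measure space with $\mu$ a complex measure, and $|\mu|$ its total variation. Let $u,\zeta$ be complex measurable symmetric functions on $\mathbb{X}\times\mathbb{X}$ with $\zeta(x,y)=e^{-u(x,y)}-1$; $\mathrm{Re}\,u$ may equal $+\infty$, in which case $\zeta=-1$. Let $\overline u(x,y)=u(x,y)$ if $\mathrm{Re}\,u(x,y)\ne\infty$ and $\overline u(x,y)=1$ otherwise. Assumption 1: there is $b\ge0$ on $\mathbb{X}$ with $\prod_{1\le i<j\le n}|1+\zeta(x_i,x_j)|\le\prod_{i=1}^n e^{b(x_i)}$ for all $n$ and $\otimes^n\mu$-almost all $x_1,\dots,x_n$. Assumption 2: there is $a\ge0$ on $\mathbb{X}$ with $\int\mathrm{d}|\mu|(y)|\zeta(x,y)|e^{a(y)+2b(y)}\le a(x)$ for almost all $x$. Assumption 2': there is $a\ge0$ on $\mathbb{X}$ with $\int\mathrm{d}|\mu|(y)|\overline u(x,y)|e^{a(y)+b(y)}\le a(x)$ for almost all $x$. Definitions: $Z=\sum_{n\ge0}\frac1{n!}\int\mathrm{d}\mu(x_1)\cdots\int\mathrm{d}\mu(x_n)\prod_{1\le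 i<j\le n}(1+\zeta(x_i,x_j))$ ($n=0$ term $=1$); $Z(x_1)=\sum_{n\ge1}\frac1{(n-1)!}\int\mathrm{d}\mu(x_2)\cdots\int\mathrm{d}\mu(x_n)\prod_{1\le i<j\le n}(1+\zeta(x_i,x_j))$ ($n=1$ term $=1$); $Z(x_1,x_2)=\sum_{n\ge2}\frac1{(n-2)!}\int\mathrm{d}\mu(x_3)\cdots\int\mathrm{d}\mu(x_n)\prod_{1\le i<j\le n}(1+\zeta(x_i,x_j))$ ($n=2$ term $=1+\zeta(x_1,x_2)$). With $\mathcal{C}_n$ the set of connected graphs on $\{1,\dots,n\}$, let $\varphi(x_1)=1$ and $\varphi(x_1,\dots,x_n)=\frac1{n!}\sum_{G\in\mathcal{C}_n}\prod_{\{i,j\}\in G}\zeta(x_i,x_j)$ for $n\ge2$. Then $\hat Z(x_1)=\sum_{n\ge1}n\int\mathrm{d}\mu(x_2)\cdots\int\mathrm{d}\mu(x_n)\,\varphi(x_1,\dots,x_n)$ and $\hat Z(x_1,x_2)=\sum_{n\ge2}n(n-1)\int\mathrm{d}\mu(x_3)\cdots\int\mathrm{d}\mu(x_n)\,\varphi(x_1,\dots,x_n)$. *)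

theory Defs
  imports "HOL-Analysis.Analysis"
begin

text \<open>The complex measure mu is represented by its polar decomposition:
  d mu = h d|mu|, where M = |mu| is the total variation (a positive measure)
  and h is a measurable complex density with norm h = 1.\<close>

definition cplx_meas :: "'a measure \<Rightarrow> ('a \<Rightarrow> complex) \<Rightarrow> bool" where
  "cplx_meas M h \<longleftrightarrow> emeasure M (space M) < \<infinity> \<and> h \<in> borel_measurable M
     \<and> (\<forall>x\<in>space M. norm (h x) = 1)"

text \<open>Integral with respect to the complex measure h |mu|.\<close>
definition cint :: "'a measure \<Rightarrow> ('a \<Rightarrow> complex) \<Rightarrow> ('a \<Rightarrow> complex) \<Rightarrow> complex" where
  "cint M h f = (LINT y|M. h y * f y)"

text \<open>Iterated integral: iint M h n F = int dmu(y1) ... int dmu(yn) F [y1,...,yn],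
  with y1 the outermost variable.\<close>
fun iint :: "'a measure \<Rightarrow> ('a \<Rightarrow> complex) \<Rightarrow> nat \<Rightarrow> ('a list \<Rightarrow> complex) \<Rightarrow> complex" where
  "iint M h 0 F = F []"
| "iint M h (Suc n) F = cint M h (\<lambda>y. iint M h n (\<lambda>ys. F (y # ys)))"

text \<open>The interaction u is given by its real part ur (an extended real, possibly +infinity)
  and imaginary part ui.\<close>
definition zeta :: "('a \<Rightarrow> 'a \<Rightarrow> ereal) \<Rightarrow> ('a \<Rightarrow> 'a \<Rightarrow> real) \<Rightarrow> 'a \<Rightarrow> 'a \<Rightarrow> complex" where
  "zeta ur ui x y = (if ur x y = \<infinity> then -1
     else exp (- Complex (real_of_ereal (ur x y)) (ui x y)) - 1)"

definition ubar :: "('a \<Rightarrow> 'a \<Rightarrow> ereal) \<Rightarrow> ('a \<Rightarrow> 'a \<Rightarrow> real) \<Rightarrow> 'a \<Rightarrow> 'a \<Rightarrow> complex" where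
  "ubar ur ui x y = (if ur x y = \<infinity> then 1 else Complex (real_of_ereal (ur x y)) (ui x y))"

text \<open>Simple graphs on the vertex set {0..<n} (the paper's {1,...,n}).\<close>
definition edges_on :: "nat \<Rightarrow> nat set set" where
  "edges_on n = {e. \<exists>i j. i < j \<and> j < n \<and> e = {i, j}}"

definition graph_connected :: "nat \<Rightarrow> nat set set \<Rightarrow> bool" where
  "graph_connected n G \<longleftrightarrow> (\<forall>i<n. \<forall>j<n. (i, j) \<in> {(k, l). {k, l} \<in> G}\<^sup>*)"

definition connected_graphs :: "nat \<Rightarrow> nat set set set" where
  "connected_graphs n = {G. G \<subseteq> edges_on n \<and> graph_connected n G}"

text \<open>Product over pairs i<j of (1 + zeta(x_i,x_j)).\<close>
definition pairprod :: "('a \<Rightarrow> 'a \<Rightarrow> complex) \<Rightarrow> 'a list \<Rightarrow> complex" where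
  "pairprod z xs = (\<Prod>(i, j) \<in> {(i, j). i < j \<and> j < length xs}. 1 + z (xs ! i) (xs ! j))"

text \<open>Ursell function phi(x_1,...,x_n).\<close>
definition ursell :: "('a \<Rightarrow> 'a \<Rightarrow> complex) \<Rightarrow> 'a list \<Rightarrow> complex" where
  "ursell z xs = (if length xs = 1 then 1 else
     (1 / fact (length xs)) * (\<Sum>G \<in> connected_graphs (length xs).
        \<Prod>(i, j) \<in> {(i, j). i < j \<and> j < length xs \<and> {i, j} \<in> G}. z (xs ! i) (xs ! j)))"

definition partZ :: "'a measure \<Rightarrow> ('a \<Rightarrow> complex) \<Rightarrow> ('a \<Rightarrow> 'a \<Rightarrow> complex) \<Rightarrow> complex" where
  "partZ M h z = (\<Sum>n. (1 / fact n) * iint M h n (pairprod z))"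

definition partZ1 :: "'a measure \<Rightarrow> ('a \<Rightarrow> complex) \<Rightarrow> ('a \<Rightarrow> 'a \<Rightarrow> complex) \<Rightarrow> 'a \<Rightarrow> complex" where
  "partZ1 M h z x1 = (\<Sum>k. (1 / fact k) * iint M h k (\<lambda>ys. pairprod z (x1 # ys)))"

definition partZ2 :: "'a measure \<Rightarrow> ('a \<Rightarrow> complex) \<Rightarrow> ('a \<Rightarrow> 'a \<Rightarrow> complex) \<Rightarrow> 'a \<Rightarrow> 'a \<Rightarrow> complex" where
  "partZ2 M h z x1 x2 = (\<Sum>k. (1 / fact k) * iint M h k (\<lambda>ys. pairprod z (x1 # x2 # ys)))"

definition hatZ1 :: "'a measure \<Rightarrow> ('a \<Rightarrow> complex) \<Rightarrow> ('a \<Rightarrow> 'a \<Rightarrow> complex) \<Rightarrow> 'a \<Rightarrow> complex" where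
  "hatZ1 M h z x1 = (\<Sum>k. of_nat (k + 1) * iint M h k (\<lambda>ys. ursell z (x1 # ys)))"

definition hatZ2 :: "'a measure \<Rightarrow> ('a \<Rightarrow> complex) \<Rightarrow> ('a \<Rightarrow> 'a \<Rightarrow> complex) \<Rightarrow> 'a \<Rightarrow> 'a \<Rightarrow> complex" where
  "hatZ2 M h z x1 x2 = (\<Sum>k. of_nat ((k + 2) * (k + 1)) * iint M h k (\<lambda>ys. ursell z (x1 # x2 # ys)))"

end

theory Submission
  imports Defs "HOL-Complex_Analysis.Cauchy_Integral_Formula"
begin

text \<open>
  Let \<open>Z(t)\<close>, \<open>Z(t; x)\<close>, \<open>Z(t; x, y)\<close> be the partition functions of the measure \<open>t \<mu>\<close>, and denote by hats
  the corresponding series of Ursell functions. Sorting graphs by the connected component of a root gives, as identities of formal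
  power series in \<open>t\<close>, \<open>Z(t; x) = hatZ(t; x) Z(t)\<close>,
  \<open>Z(t; x, y) = hatZ(t; x, y) Z(t) + hatZ(t; x) Z(t; y)\<close> and \<open>Z' = g Z\<close>, where \<open>g\<close> is the integral of
  \<open>hatZ(t; x)\<close> over \<open>x\<close>.

  A tree-graph bound in the spirit of Procacci and Yuhjtman, using stability only once per point, shows
  that the coefficients of \<open>g\<close> are absolutely summable; the edge weight of the trees is
  \<open>|\<zeta>| / max 1 |1 + \<zeta>|\<close>, which is at most \<open>|\<zeta>|\<close> and at most \<open>|ubar|\<close>, so that both
  alternatives of the convergence assumption are covered. Hence the entire function \<open>Z\<close> has no zeros in the closed unit
  disc, nor in a slightly larger one. The quotients \<open>Z(t; x) / Z(t)\<close> and \<open>Z(t; x, y) / Z(t)\<close> are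
  therefore analytic across \<open>t = 1\<close>, and their Taylor series may be evaluated there. In particular no
  absolute convergence of the two-point series of integrals is needed, which the tree bound would not give
  in the critical case.
\<close>

section \<open>Sums over connected graphs\<close>

text \<open>The critical case shapes the proof. For constant weights with \<open>a = 1\<close> and
  equality in the convergence condition, the generating function of rooted trees sits at its
  square-root singularity: it still converges, but the series for trees with two roots, integrated
  over the second one, is a derivative of it and diverges. The convergence hypotheses are therefore
  spent on a single estimate, the summability of the coefficients of \<open>g\<close>; with
  \<open>K\<close> their absolute sum, \<open>|Z(t)| = exp (Re G(t)) \<ge> exp (- K)\<close> in the
  open disc, where \<open>G\<close> is the primitive of \<open>g\<close>, and the rest is read off
  from the zeros of an entire function.

  The second obstacle is null sets. Stability holds for almost all configurations, whereas the
  correlation functions fix one or two points. The fixed points are therefore restricted to those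
  for which almost every completion is stable.

  The third is integrability: the identities between power series need every cluster integral to
  exist before any sharp estimate is at hand. A crude bound with a constant depending on the number
  of points provides this.\<close>

definition pair_edges :: "'v set \<Rightarrow> 'v set set" where
  "pair_edges V = {e. \<exists>i\<in>V. \<exists>j\<in>V. i \<noteq> j \<and> e = {i, j}}"

abbreviation adj :: "'v set set \<Rightarrow> ('v \<times> 'v) set" where
  "adj G \<equiv> {(k, l). {k, l} \<in> G}"

definition conn_on :: "'v set \<Rightarrow> 'v set set \<Rightarrow> bool" where
  "conn_on V G \<longleftrightarrow> (\<forall>i\<in>V. \<forall>j\<in>V. (i, j) \<in> (adj G)\<^sup>*)"

text \<open>The set \<open>E\<close> of available edges is what the edge-by-edge inductions run
  over; \<open>n!\<close> times the Ursell function is the case \<open>E = UNIV\<close>.\<close>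

definition conn_sum :: "('v set \<Rightarrow> complex) \<Rightarrow> 'v set set \<Rightarrow> 'v set \<Rightarrow> complex" where
  "conn_sum \<omega> E V = (\<Sum>G | G \<subseteq> E \<inter> pair_edges V \<and> conn_on V G. \<Prod>e\<in>G. \<omega> e)"

definition graph_prod :: "('v set \<Rightarrow> complex) \<Rightarrow> 'v set set \<Rightarrow> 'v set \<Rightarrow> complex" where
  "graph_prod \<omega> E V = (\<Prod>e\<in>E \<inter> pair_edges V. 1 + \<omega> e)"

lemma doubleton_in_pair_edges [simp]: "{i, j} \<in> pair_edges V \<longleftrightarrow> i \<in> V \<and> j \<in> V \<and> i \<noteq> j"
  by (auto simp: pair_edges_def doubleton_eq_iff)

lemma pair_edges_subset_Pow: "pair_edges V \<subseteq> Pow V"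
  by (auto simp: pair_edges_def)

lemma finite_pair_edges [simp]: "finite V \<Longrightarrow> finite (pair_edges V)"
  by (rule finite_subset[OF pair_edges_subset_Pow]) simp

lemma pair_edges_mono: "S \<subseteq> V \<Longrightarrow> pair_edges S \<subseteq> pair_edges V"
  by (auto simp: pair_edges_def)

lemma pair_edges_disjoint: "S \<inter> S' = {} \<Longrightarrow> pair_edges S \<inter> pair_edges S' = {}"
  by (force simp: pair_edges_def doubleton_eq_iff)

lemma pair_edges_singleton [simp]: "pair_edges {v} = {}"
  by (auto simp: pair_edges_def)

lemma pair_edges_empty [simp]: "pair_edges {} = {}"
  by (auto simp: pair_edges_def)

lemma sym_adj: "sym (adj G)"
  by (auto simp: sym_def insert_commute)

lemma adj_rtrancl_sym: "(i, j) \<in> (adj G)\<^sup>* \<Longrightarrow> (j, i) \<in> (adj G)\<^sup>*"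
  by (erule symD[OF sym_rtrancl[OF sym_adj]])

lemma adj_rtrancl_mono: "(i, j) \<in> (adj G)\<^sup>* \<Longrightarrow> G \<subseteq> H \<Longrightarrow> (i, j) \<in> (adj H)\<^sup>*"
  by (erule rtrancl_mono[THEN subsetD, rotated]) auto

lemma conn_onI_root:
  assumes "\<And>v. v \<in> V \<Longrightarrow> (r, v) \<in> (adj G)\<^sup>*"
  shows "conn_on V G"
  unfolding conn_on_def
proof (intro ballI)
  fix i j assume "i \<in> V" "j \<in> V"
  from adj_rtrancl_sym[OF assms[OF this(1)]] assms[OF this(2)]
  show "(i, j) \<in> (adj G)\<^sup>*" by (rule rtrancl_trans)
qed

text \<open>An edge of \<open>G\<close> at a vertex of \<open>S\<close> cannot lie in
  \<open>pair_edges S'\<close>, so a path starting in \<open>S\<close> never leaves it.\<close>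

lemma reach_within:
  assumes "G \<subseteq> pair_edges S \<union> pair_edges S'" "S \<inter> S' = {}" "r \<in> S" "(r, v) \<in> (adj G)\<^sup>*"
  shows "v \<in> S \<and> (r, v) \<in> (adj (G \<inter> pair_edges S))\<^sup>*"
  using assms(4)
proof (induction rule: rtrancl_induct)
  case base
  then show ?case using assms by auto
next
  case (step y z)
  have "{y, z} \<in> G" using step by auto
  moreover have "{y, z} \<notin> pair_edges S'" using step assms(2) by auto
  ultimately have "{y, z} \<in> G \<inter> pair_edges S" using assms(1) by blast
  moreover from this have "(y, z) \<in> adj (G \<inter> pair_edges S)" "z \<in> S" by auto
  ultimately show ?case using step by (meson rtrancl.rtrancl_into_rtrancl)
qed

text \<open>The component of \<open>r\<close> recovers \<open>S\<close> from the union of the two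
  graphs; this makes decompositions along \<open>S\<close> injective.\<close>

lemma component_eq:
  assumes "conn_on S G1" "G1 \<subseteq> pair_edges S" "G2 \<subseteq> pair_edges S'" "S \<inter> S' = {}" "r \<in> S"
  shows "{v. (r, v) \<in> (adj (G1 \<union> G2))\<^sup>*} = S"
proof -
  have "v \<in> S" if "(r, v) \<in> (adj (G1 \<union> G2))\<^sup>*" for v
    using reach_within[OF _ assms(4,5) that] assms by auto
  moreover have "(r, v) \<in> (adj (G1 \<union> G2))\<^sup>*" if "v \<in> S" for v
    by (rule adj_rtrancl_mono[of _ _ G1]) (use assms that in \<open>auto simp: conn_on_def\<close>)
  ultimately show ?thesis by auto
qed

lemma finite_conn_graphs [simp]:
  "finite V \<Longrightarrow> finite {G. G \<subseteq> E \<inter> pair_edges V \<and> conn_on V G}"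
  by (rule finite_subset[of _ "Pow (pair_edges V)"]) auto

text \<open>Every graph is sorted according to the connected component \<open>S\<close> of the root.\<close>

lemma graph_prod_root:
  assumes fin: "finite V" and r: "r \<in> V"
  shows "graph_prod \<omega> E V = (\<Sum>S | S \<subseteq> V \<and> r \<in> S. conn_sum \<omega> E S * graph_prod \<omega> E (V - S))"
proof -
  define cg where "cg S = {G. G \<subseteq> E \<inter> pair_edges S \<and> conn_on S G}" for S
  define ag where "ag S = Pow (E \<inter> pair_edges S)" for S
  define comp where "comp G = {v. (r, v) \<in> (adj G)\<^sup>*}" for G
  let ?Ss = "{S. S \<subseteq> V \<and> r \<in> S}"
  have finS: "finite ?Ss" using fin by auto
  have fincg: "finite (cg S)" "finite (ag S)" if "S \<subseteq> V" for S
    using finite_subset[OF that fin] unfolding cg_def ag_def by simp_all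
  have part_wt: "graph_prod \<omega> E S = (\<Sum>G\<in>ag S. \<Prod>e\<in>G. \<omega> e)" if "S \<subseteq> V" for S
  proof -
    have "finite (E \<inter> pair_edges S)" using finite_subset[OF that fin] by simp
    from prod_add[OF this, of \<omega> "\<lambda>_. 1"] show ?thesis
      unfolding graph_prod_def ag_def by (simp add: add.commute)
  qed
  have "(\<Sum>S\<in>?Ss. conn_sum \<omega> E S * graph_prod \<omega> E (V - S))
      = (\<Sum>S\<in>?Ss. \<Sum>(G1, G2)\<in>cg S \<times> ag (V - S). (\<Prod>e\<in>G1. \<omega> e) * (\<Prod>e\<in>G2. \<omega> e))"
    unfolding conn_sum_def cg_def[symmetric]
    by (intro sum.cong refl) (simp add: part_wt sum_product sum.cartesian_product)
  also have "\<dots> = (\<Sum>(S, G1, G2)\<in>Sigma ?Ss (\<lambda>S. cg S \<times> ag (V - S)). (\<Prod>e\<in>G1. \<omega> e) * (\<Prod>e\<in>G2. \<omega> e))"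
    using fincg by (subst sum.Sigma[OF finS]) (auto simp: split_def)
  also have "\<dots> = (\<Sum>G\<in>ag V. \<Prod>e\<in>G. \<omega> e)"
  proof (rule sum.reindex_bij_witness[of _
        "\<lambda>G. (comp G, G \<inter> pair_edges (comp G), G \<inter> pair_edges (V - comp G))" "\<lambda>(S, G1, G2). G1 \<union> G2"])
    fix p assume "p \<in> Sigma ?Ss (\<lambda>S. cg S \<times> ag (V - S))"
    then obtain S G1 G2 where p: "p = (S, G1, G2)" and S: "S \<subseteq> V" "r \<in> S"
      and G1: "G1 \<subseteq> E" "G1 \<subseteq> pair_edges S" "conn_on S G1"
      and G2: "G2 \<subseteq> E" "G2 \<subseteq> pair_edges (V - S)"
      by (auto simp: cg_def ag_def)
    have c: "comp (G1 \<union> G2) = S"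
      unfolding comp_def by (rule component_eq[OF G1(3,2) G2(2)]) (use S in auto)
    have dis: "pair_edges S \<inter> pair_edges (V - S) = {}" by (rule pair_edges_disjoint) auto
    show "(\<lambda>G. (comp G, G \<inter> pair_edges (comp G), G \<inter> pair_edges (V - comp G))) ((\<lambda>(S, G1, G2). G1 \<union> G2) p) = p"
    proof -
      have "(G1 \<union> G2) \<inter> pair_edges S = G1" "(G1 \<union> G2) \<inter> pair_edges (V - S) = G2"
        using dis G1 G2 by blast+
      thus ?thesis by (simp add: p c)
    qed
    show "(\<lambda>(S, G1, G2). G1 \<union> G2) p \<in> ag V"
      using G1 G2 S pair_edges_mono[of S V] pair_edges_mono[of "V - S" V] by (auto simp: p ag_def)
    have fin12: "finite G1" "finite G2"
      using fin S G1 G2 by (meson finite_Diff finite_pair_edges finite_subset)+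
    show "prod \<omega> ((\<lambda>(S, G1, G2). G1 \<union> G2) p) = (case p of (S, G1, G2) \<Rightarrow> prod \<omega> G1 * prod \<omega> G2)"
    proof -
      have "G1 \<inter> G2 = {}" using dis G1 G2 by blast
      thus ?thesis using fin12 by (simp add: p prod.union_disjoint)
    qed
  next
    fix G assume "G \<in> ag V"
    hence G: "G \<subseteq> E" "G \<subseteq> pair_edges V" by (auto simp: ag_def)
    have cV: "comp G \<subseteq> V"
    proof
      fix v assume "v \<in> comp G"
      hence "(r, v) \<in> (adj G)\<^sup>*" by (simp add: comp_def)
      from reach_within[OF _ _ r this, of "{}"] G show "v \<in> V" by simp
    qed
    have rc: "r \<in> comp G" by (simp add: comp_def)
    have split: "G \<subseteq> pair_edges (comp G) \<union> pair_edges (V - comp G)"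
    proof
      fix e assume e: "e \<in> G"
      then obtain i j where ij: "i \<in> V" "j \<in> V" "i \<noteq> j" "e = {i, j}"
        using G by (auto simp: pair_edges_def)
      have adj: "(i, j) \<in> adj G" "(j, i) \<in> adj G" using e ij by (auto simp: insert_commute)
      have "i \<in> comp G \<longleftrightarrow> j \<in> comp G"
        unfolding comp_def mem_Collect_eq
        by (rule iffI) (erule rtrancl_into_rtrancl, rule adj)+
      thus "e \<in> pair_edges (comp G) \<union> pair_edges (V - comp G)" using ij by auto
    qed
    then show "(\<lambda>(S, G1, G2). G1 \<union> G2) (comp G, G \<inter> pair_edges (comp G), G \<inter> pair_edges (V - comp G)) = G"
      by auto
    have "conn_on (comp G) (G \<inter> pair_edges (comp G))"
    proof (rule conn_onI_root[of _ r])
      fix v assume "v \<in> comp G"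
      hence "(r, v) \<in> (adj G)\<^sup>*" by (simp add: comp_def)
      from reach_within[OF split _ rc this] show "(r, v) \<in> (adj (G \<inter> pair_edges (comp G)))\<^sup>*" by blast
    qed
    then show "(comp G, G \<inter> pair_edges (comp G), G \<inter> pair_edges (V - comp G)) \<in> Sigma ?Ss (\<lambda>S. cg S \<times> ag (V - S))"
      using cV rc G by (auto simp: cg_def ag_def)
  qed
  finally show ?thesis by (simp add: part_wt)
qed

lemma conn_sum_cong:
  assumes "\<And>e. e \<in> pair_edges V \<Longrightarrow> \<omega> e = \<omega>' e"
  shows "conn_sum \<omega> E V = conn_sum \<omega>' E V"
  unfolding conn_sum_def by (intro sum.cong prod.cong) (use assms in auto)

lemma graph_prod_cong:
  assumes "\<And>e. e \<in> pair_edges V \<Longrightarrow> \<omega> e = \<omega>' e"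
  shows "graph_prod \<omega> E V = graph_prod \<omega>' E V"
  unfolding graph_prod_def by (intro prod.cong) (use assms in auto)

lemma conn_sum_empty_edges:
  assumes "finite V" "V \<noteq> {}"
  shows "conn_sum \<omega> {} V = (if \<exists>v. V = {v} then 1 else 0)"
proof -
  have "conn_on V {} \<longleftrightarrow> (\<exists>v. V = {v})"
    using assms by (auto simp: conn_on_def)
  moreover have "{G::'a set set. G \<subseteq> {} \<inter> pair_edges V \<and> conn_on V G} = (if conn_on V {} then {{}} else {})"
    by auto
  ultimately show ?thesis by (simp add: conn_sum_def)
qed

lemma conn_sum_insert_edge_outside:
  assumes "e \<notin> pair_edges V"
  shows "conn_sum \<omega> (insert e E) V = conn_sum \<omega> E V"
  using assms by (simp add: conn_sum_def)

text \<open>Deleting the edge \<open>{i, j}\<close> from a connected graph leaves it connected or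
  splits it into the components of \<open>i\<close> and of \<open>j\<close>. Instead of building
  this correspondence, the proof checks that the claimed values satisfy the same root decomposition
  as the sums, which determines the value on \<open>V\<close> from those on smaller sets.\<close>

lemma conn_sum_insert_edge:
  assumes fin: "finite V" and ij: "i \<in> V" "j \<in> V" "i \<noteq> j" and e: "{i, j} \<notin> E"
  shows "conn_sum \<omega> (insert {i, j} E) V = (1 + \<omega> {i, j}) * conn_sum \<omega> E V
    + \<omega> {i, j} * (\<Sum>S | S \<subseteq> V \<and> i \<in> S \<and> j \<notin> S. conn_sum \<omega> E S * conn_sum \<omega> E (V - S))"
  using fin ij
proof (induction "card V" arbitrary: V rule: less_induct)
  case less
  let ?e = "{i, j}" and ?E = "insert {i, j} E"
  let ?C = "conn_sum \<omega> E" and ?Q = "graph_prod \<omega> E"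
  define D where "D S = (\<Sum>A | A \<subseteq> S \<and> i \<in> A \<and> j \<notin> A. ?C A * ?C (S - A))" for S
  define X where "X S = ?C S + (if j \<in> S then \<omega> ?e * (?C S + D S) else 0)" for S
  have IH: "conn_sum \<omega> ?E S = X S" if "S \<subset> V" "i \<in> S" for S
  proof (cases "j \<in> S")
    case True
    have "finite S" "card S < card V"
      using that less.prems by (auto intro: finite_subset psubset_card_mono)
    from less.hyps[OF this(2,1) that(2) True less.prems(4)] True show ?thesis
      by (simp add: X_def D_def algebra_simps)
  next
    case False
    then show ?thesis using conn_sum_insert_edge_outside[of ?e S \<omega> E] by (auto simp: X_def)
  qed
  let ?Si = "{S. S \<subseteq> V \<and> i \<in> S}" and ?Sij = "{S. S \<subseteq> V \<and> i \<in> S \<and> j \<in> S}"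
    and ?Sj = "{S. S \<subseteq> V \<and> i \<in> S \<and> j \<notin> S}"
  have fS: "finite ?Si" "finite ?Sij" "finite ?Sj" using less.prems by auto
  have un: "?Si = ?Sij \<union> ?Sj" "?Sij \<inter> ?Sj = {}" by auto
  have Q: "?Q V = (\<Sum>S\<in>?Si. ?C S * ?Q (V - S))"
    by (rule graph_prod_root) (use less.prems in auto)
  \<comment> \<open>With \<open>S = A \<union> B\<close>, the sum over \<open>B\<close> runs over
    the possible components of \<open>j\<close> in \<open>V - A\<close>; the root decomposition at
    \<open>j\<close> collapses it to the graph sum on \<open>V - A\<close>.\<close>
  have DD: "(\<Sum>S\<in>?Sij. D S * ?Q (V - S)) = (\<Sum>A\<in>?Sj. ?C A * ?Q (V - A))"
  proof -
    have "(\<Sum>S\<in>?Sij. D S * ?Q (V - S))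
        = (\<Sum>(S, A)\<in>Sigma ?Sij (\<lambda>S. {A. A \<subseteq> S \<and> i \<in> A \<and> j \<notin> A}). ?C A * ?C (S - A) * ?Q (V - S))"
      unfolding D_def sum_distrib_right
      by (rule sum.Sigma[OF fS(2)]) (auto dest: finite_subset[OF _ less.prems(1)])
    also have "\<dots> = (\<Sum>(A, B)\<in>Sigma ?Sj (\<lambda>A. {B. B \<subseteq> V - A \<and> j \<in> B}). ?C A * (?C B * ?Q (V - A - B)))"
    proof (rule sum.reindex_bij_witness[of _ "\<lambda>(A, B). (A \<union> B, A)" "\<lambda>(S, A). (A, S - A)"], goal_cases)
      case (5 p)
      then obtain S A where p: "p = (S, A)" "A \<subseteq> S" "S \<subseteq> V" by auto
      have "V - A - (S - A) = V - S" using p by auto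
      then show ?case by (simp add: p(1))
    qed auto
    also have "\<dots> = (\<Sum>A\<in>?Sj. \<Sum>B | B \<subseteq> V - A \<and> j \<in> B. ?C A * (?C B * ?Q (V - A - B)))"
      by (rule sum.Sigma[symmetric, OF fS(3)]) (use less.prems in auto)
    also have "\<dots> = (\<Sum>A\<in>?Sj. ?C A * ?Q (V - A))"
      by (intro sum.cong refl, subst graph_prod_root[where r=j])
         (use less.prems in \<open>auto simp: sum_distrib_left\<close>)
    finally show ?thesis .
  qed
  \<comment> \<open>The claimed values pass the test: switching on the edge multiplies the sum over
    all graphs by \<open>1 + \<omega> {i, j}\<close>.\<close>
  have X: "(\<Sum>S\<in>?Si. X S * ?Q (V - S)) = (1 + \<omega> ?e) * ?Q V"
  proof -
    have "(\<Sum>S\<in>?Si. X S * ?Q (V - S))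
       = ?Q V + (\<Sum>S\<in>?Si. (if j \<in> S then \<omega> ?e * (?C S + D S) else 0) * ?Q (V - S))"
      unfolding Q X_def by (simp add: sum.distrib distrib_right)
    also have "(\<Sum>S\<in>?Si. (if j \<in> S then \<omega> ?e * (?C S + D S) else 0) * ?Q (V - S))
       = (\<Sum>S\<in>?Sij. \<omega> ?e * (?C S + D S) * ?Q (V - S))"
      by (rule sum.mono_neutral_cong_right) (use fS in auto)
    also have "\<dots> = \<omega> ?e * ((\<Sum>S\<in>?Sij. ?C S * ?Q (V - S)) + (\<Sum>S\<in>?Sij. D S * ?Q (V - S)))"
      by (simp add: sum_distrib_left algebra_simps sum.distrib)
    also have "\<dots> = \<omega> ?e * ?Q V"
      unfolding DD Q un(1) by (subst sum.union_disjoint) (use fS un in auto)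
    finally show ?thesis by (simp add: algebra_simps)
  qed
  have "(1 + \<omega> ?e) * ?Q V = graph_prod \<omega> ?E V"
  proof -
    have "?E \<inter> pair_edges V = insert ?e (E \<inter> pair_edges V)" using less.prems by auto
    thus ?thesis using less.prems e by (simp add: graph_prod_def)
  qed
  also have "\<dots> = (\<Sum>S\<in>?Si. conn_sum \<omega> ?E S * graph_prod \<omega> ?E (V - S))"
    by (rule graph_prod_root) (use less.prems in auto)
  also have "\<dots> = (\<Sum>S\<in>?Si. conn_sum \<omega> ?E S * ?Q (V - S))"
    by (intro sum.cong refl) (auto simp: graph_prod_def)
  finally have "(\<Sum>S\<in>?Si. conn_sum \<omega> ?E S * ?Q (V - S)) = (\<Sum>S\<in>?Si. X S * ?Q (V - S))"
    using X by simp
  \<comment> \<open>The proper subsets agree by induction and cancel; the term \<open>S = V\<close>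
    remains, with graph sum \<open>1\<close> on the empty set.\<close>
  hence "conn_sum \<omega> ?E V * ?Q (V - V) + (\<Sum>S\<in>?Si - {V}. conn_sum \<omega> ?E S * ?Q (V - S))
      = X V * ?Q (V - V) + (\<Sum>S\<in>?Si - {V}. X S * ?Q (V - S))"
    using less.prems by (subst (asm) (1 2) sum.remove[OF fS(1), of V]) simp_all
  moreover have "(\<Sum>S\<in>?Si - {V}. conn_sum \<omega> ?E S * ?Q (V - S)) = (\<Sum>S\<in>?Si - {V}. X S * ?Q (V - S))"
    by (intro sum.cong refl) (use IH in auto)
  ultimately have "conn_sum \<omega> ?E V = X V" by (simp add: graph_prod_def)
  thus ?case using less.prems by (simp add: X_def D_def algebra_simps)
qed

section \<open>Trees\<close>

text \<open>Joining two disjoint trees by an edge mirrors the second term of the recursion for a new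
  edge. An edge set may have many derivations; \<open>tree_sum\<close> runs over edge sets, so each
  tree counts once.\<close>

inductive is_tree :: "'v set \<Rightarrow> 'v set set \<Rightarrow> bool" where
  single: "is_tree {v} {}"
| join: "is_tree V1 T1 \<Longrightarrow> is_tree V2 T2 \<Longrightarrow> V1 \<inter> V2 = {} \<Longrightarrow> i \<in> V1 \<Longrightarrow> j \<in> V2
    \<Longrightarrow> is_tree (V1 \<union> V2) (insert {i, j} (T1 \<union> T2))"

definition tree_sum :: "('v set \<Rightarrow> real) \<Rightarrow> 'v set set \<Rightarrow> 'v set \<Rightarrow> real" where
  "tree_sum w E V = (\<Sum>T | T \<subseteq> E \<and> is_tree V T. \<Prod>e\<in>T. w e)"

lemma is_tree_edges: "is_tree V T \<Longrightarrow> T \<subseteq> pair_edges V"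
proof (induction rule: is_tree.induct)
  case (join V1 T1 V2 T2 i j)
  then show ?case using pair_edges_mono[of V1 "V1 \<union> V2"] pair_edges_mono[of V2 "V1 \<union> V2"] by auto
qed auto

lemma is_tree_conn_on: "is_tree V T \<Longrightarrow> conn_on V T"
proof (induction rule: is_tree.induct)
  case (single v)
  then show ?case by (simp add: conn_on_def)
next
  case (join V1 T1 V2 T2 i j)
  let ?T = "insert {i, j} (T1 \<union> T2)"
  have 1: "(i, v) \<in> (adj ?T)\<^sup>*" if "v \<in> V1" for v
    by (rule adj_rtrancl_mono[of _ _ T1]) (use join that in \<open>auto simp: conn_on_def\<close>)
  have 2: "(j, v) \<in> (adj ?T)\<^sup>*" if "v \<in> V2" for v
    by (rule adj_rtrancl_mono[of _ _ T2]) (use join that in \<open>auto simp: conn_on_def\<close>)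
  have "(i, j) \<in> (adj ?T)\<^sup>*" by (rule r_into_rtrancl) auto
  then show ?case using 1 2 by (intro conn_onI_root[of _ i]) (auto intro: rtrancl_trans)
qed

lemma finite_trees [simp]: "finite V \<Longrightarrow> finite {T. T \<subseteq> E \<and> is_tree V T}"
  by (rule finite_subset[of _ "Pow (pair_edges V)"]) (auto dest: is_tree_edges)

lemma tree_sum_cong:
  assumes "\<And>e. e \<in> pair_edges V \<Longrightarrow> w e = w' e"
  shows "tree_sum w E V = tree_sum w' E V"
  unfolding tree_sum_def by (intro sum.cong prod.cong) (use assms is_tree_edges in auto)

lemma tree_sum_nonneg: "(\<And>e. 0 \<le> w e) \<Longrightarrow> 0 \<le> tree_sum w E V"
  unfolding tree_sum_def by (intro sum_nonneg prod_nonneg) auto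

lemma tree_sum_mono_edges:
  assumes "finite V" "\<And>e. 0 \<le> w e" "E \<subseteq> E'"
  shows "tree_sum w E V \<le> tree_sum w E' V"
  unfolding tree_sum_def
  by (rule sum_mono2) (use assms in \<open>auto intro: prod_nonneg\<close>)

lemma tree_sum_singleton [simp]: "tree_sum w E {v} = 1"
proof -
  have "{T. T \<subseteq> E \<and> is_tree {v} T} = {{}}"
    using is_tree_edges[of "{v}"] by (auto intro: single)
  thus ?thesis by (simp add: tree_sum_def)
qed

text \<open>Trees without the new edge account for the first term. A tree with it arises by joining
  a tree on \<open>S\<close> to one on \<open>V - S\<close>, and injectively so: after deletion of
  the edge, \<open>S\<close> is the component of \<open>i\<close>.\<close>

lemma tree_sum_insert_edge:
  assumes fin: "finite V" and ij: "i \<in> V" "j \<in> V" and e: "{i, j} \<notin> E" and w: "\<And>e. 0 \<le> w e"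
  shows "tree_sum w E V + w {i, j} * (\<Sum>S | S \<subseteq> V \<and> i \<in> S \<and> j \<notin> S. tree_sum w E S * tree_sum w E (V - S))
    \<le> tree_sum w (insert {i, j} E) V"
proof -
  define tg where "tg S = {T. T \<subseteq> E \<and> is_tree S T}" for S
  let ?e = "{i, j}"
  let ?Sj = "{S. S \<subseteq> V \<and> i \<in> S \<and> j \<notin> S}"
  let ?B = "Sigma ?Sj (\<lambda>S. tg S \<times> tg (V - S))"
  let ?g = "\<lambda>(S, T1, T2). insert ?e (T1 \<union> T2)"
  have fin_tg: "finite (tg S)" if "S \<subseteq> V" for S
    using finite_subset[OF that fin] by (simp add: tg_def)
  have fSj: "finite ?Sj" using fin by auto
  have B: "S \<subseteq> V \<and> i \<in> S \<and> j \<notin> S \<and> T1 \<subseteq> E \<and> T2 \<subseteq> E \<and> is_tree S T1 \<and> is_tree (V - S) T2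
      \<and> T1 \<subseteq> pair_edges S \<and> T2 \<subseteq> pair_edges (V - S) \<and> finite T1 \<and> finite T2
      \<and> {v. (i, v) \<in> (adj (T1 \<union> T2))\<^sup>*} = S" if "(S, T1, T2) \<in> ?B" for S T1 T2
  proof -
    have *: "S \<subseteq> V" "i \<in> S" "j \<notin> S" "T1 \<subseteq> E" "T2 \<subseteq> E" "is_tree S T1" "is_tree (V - S) T2"
      using that by (auto simp: tg_def)
    have **: "T1 \<subseteq> pair_edges S" "T2 \<subseteq> pair_edges (V - S)" using * is_tree_edges by blast+
    have "finite T1" "finite T2"
      using ** *(1) fin by (meson finite_Diff finite_pair_edges finite_subset)+
    moreover have "{v. (i, v) \<in> (adj (T1 \<union> T2))\<^sup>*} = S"
      by (rule component_eq[OF is_tree_conn_on[OF *(6)] **]) (use * in auto)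
    ultimately show ?thesis using * ** by auto
  qed
  have dis: "pair_edges S \<inter> pair_edges (V - S) = {}" for S :: "'a set"
    by (rule pair_edges_disjoint) auto
  have inj: "inj_on ?g ?B"
  proof (rule inj_onI)
    fix p p' assume pB: "p \<in> ?B" "p' \<in> ?B" and peq: "?g p = ?g p'"
    obtain S T1 T2 S' T1' T2' where p: "p = (S, T1, T2)" "p' = (S', T1', T2')"
      by (metis prod.exhaust)
    have a: "(S, T1, T2) \<in> ?B" "(S', T1', T2') \<in> ?B" and eq: "insert ?e (T1 \<union> T2) = insert ?e (T1' \<union> T2')"
      using pB peq unfolding p by simp_all
    have b: "T1 \<subseteq> E" "T2 \<subseteq> E" "T1 \<subseteq> pair_edges S" "T2 \<subseteq> pair_edges (V - S)"
        "{v. (i, v) \<in> (adj (T1 \<union> T2))\<^sup>*} = S"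
      and b': "T1' \<subseteq> E" "T2' \<subseteq> E" "T1' \<subseteq> pair_edges S'" "T2' \<subseteq> pair_edges (V - S')"
        "{v. (i, v) \<in> (adj (T1' \<union> T2'))\<^sup>*} = S'"
      using B[OF a(1)] B[OF a(2)] by simp_all
    have "?e \<notin> T1 \<union> T2" "?e \<notin> T1' \<union> T2'" using b(1,2) b'(1,2) e by blast+
    hence u: "T1 \<union> T2 = T1' \<union> T2'" using eq by (simp add: insert_ident)
    hence S: "S = S'" using b(5) b'(5) by simp
    have "T1 = (T1 \<union> T2) \<inter> pair_edges S" "T2 = (T1 \<union> T2) \<inter> pair_edges (V - S)"
      using b(3,4) dis[of S] by blast+
    moreover have "T1' = (T1' \<union> T2') \<inter> pair_edges S'" "T2' = (T1' \<union> T2') \<inter> pair_edges (V - S')"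
      using b'(3,4) dis[of S'] by blast+
    ultimately show "p = p'" unfolding p using u S by simp
  qed
  have img: "?g ` ?B \<subseteq> {T. T \<subseteq> insert ?e E \<and> is_tree V T}"
  proof (clarify, rule conjI)
    fix S T1 T2 assume "S \<subseteq> V" "i \<in> S" "j \<notin> S" "T1 \<in> tg S" "T2 \<in> tg (V - S)"
    hence *: "S \<subseteq> V" "i \<in> S" "j \<notin> S" "T1 \<subseteq> E" "T2 \<subseteq> E" "is_tree S T1" "is_tree (V - S) T2"
      by (auto simp: tg_def)
    show "insert ?e (T1 \<union> T2) \<subseteq> insert ?e E" using * by auto
    have "is_tree (S \<union> (V - S)) (insert ?e (T1 \<union> T2))"
      by (rule join) (use * ij in auto)
    moreover have "S \<union> (V - S) = V" using * by auto
    ultimately show "is_tree V (insert ?e (T1 \<union> T2))" by simp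
  qed
  have "w ?e * (\<Sum>S\<in>?Sj. tree_sum w E S * tree_sum w E (V - S))
      = (\<Sum>S\<in>?Sj. \<Sum>(T1, T2)\<in>tg S \<times> tg (V - S). w ?e * (prod w T1 * prod w T2))"
    unfolding tree_sum_def tg_def[symmetric] sum_product sum.cartesian_product
    by (simp add: sum_distrib_left split_def)
  also have "\<dots> = (\<Sum>(S, T1, T2)\<in>?B. w ?e * (prod w T1 * prod w T2))"
    using fin_tg by (subst sum.Sigma[OF fSj]) (auto simp: split_def)
  also have "\<dots> = (\<Sum>b\<in>?B. prod w (?g b))"
  proof (intro sum.cong refl, clarify)
    fix S T1 T2 assume "S \<subseteq> V" "i \<in> S" "j \<notin> S" "T1 \<in> tg S" "T2 \<in> tg (V - S)"
    hence b: "(S, T1, T2) \<in> ?B" by auto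
    note * = B[OF b]
    have "?e \<notin> T1 \<union> T2" using * e by blast
    moreover have "T1 \<inter> T2 = {}" using * dis[of S] by blast
    ultimately show "w ?e * (prod w T1 * prod w T2) = prod w (insert ?e (T1 \<union> T2))"
      using * by (simp add: prod.union_disjoint)
  qed
  also have "\<dots> = (\<Sum>T\<in>?g ` ?B. prod w T)"
    by (simp add: sum.reindex[OF inj])
  finally have 1: "w ?e * (\<Sum>S\<in>?Sj. tree_sum w E S * tree_sum w E (V - S)) = (\<Sum>T\<in>?g ` ?B. prod w T)" .
  have finB: "finite ?B" using fSj fin_tg by (intro finite_SigmaI finite_cartesian_product) auto
  have "tree_sum w E V + (\<Sum>T\<in>?g ` ?B. prod w T) = (\<Sum>T\<in>tg V \<union> ?g ` ?B. prod w T)"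
    unfolding tree_sum_def tg_def[symmetric]
    by (rule sum.union_disjoint[symmetric]) (use fin_tg[of V] finB e in \<open>auto simp: tg_def\<close>)
  also have "\<dots> \<le> tree_sum w (insert ?e E) V"
    unfolding tree_sum_def
    by (rule sum_mono2) (use fin img w in \<open>auto simp: tg_def intro: prod_nonneg\<close>)
  finally show ?thesis using 1 by simp
qed

text \<open>The edge \<open>{r, j}\<close> is the first one on the path from \<open>r\<close> to
  \<open>v\<close>; cutting it separates the branch \<open>S\<close> containing
  \<open>v\<close>.\<close>

lemma is_tree_root_edge:
  assumes "is_tree V T" "r \<in> V" "v \<in> V" "r \<noteq> v"
  shows "\<exists>S j T1 T2. S \<subseteq> V \<and> r \<notin> S \<and> v \<in> S \<and> j \<in> S \<and> is_tree S T1 \<and> is_tree (V - S) T2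
    \<and> T = insert {r, j} (T1 \<union> T2)"
  using assms
proof (induction arbitrary: v rule: is_tree.induct)
  case (single v)
  then show ?case by auto
next
  case (join V1 T1 V2 T2 i j)
  \<comment> \<open>Here \<open>A\<close> is the half containing the root. The half \<open>B\<close>
    follows its attachment point \<open>p\<close>, into the branch or into the remainder. If
    \<open>v\<close> lies in \<open>B\<close>, the branch sought is the one through
    \<open>p\<close>, or \<open>B\<close> itself when \<open>p = r\<close>.\<close>
  have step: "\<exists>S k U1 U2. S \<subseteq> A \<union> B \<and> r \<notin> S \<and> v \<in> S \<and> k \<in> S \<and> is_tree S U1 \<and> is_tree ((A \<union> B) - S) U2
      \<and> insert {p, q} (TA \<union> TB) = insert {r, k} (U1 \<union> U2)"
    if IH: "\<And>v. v \<in> A \<Longrightarrow> r \<noteq> v \<Longrightarrow> \<exists>S j T1 T2. S \<subseteq> A \<and> r \<notin> S \<and> v \<in> S \<and> j \<in> S \<and> is_tree S T1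
        \<and> is_tree (A - S) T2 \<and> TA = insert {r, j} (T1 \<union> T2)"
      and tA: "is_tree A TA" and tB: "is_tree B TB" and dis: "A \<inter> B = {}" and p: "p \<in> A" and q: "q \<in> B"
      and r: "r \<in> A" and v: "v \<in> A \<union> B" "r \<noteq> v" for A B TA TB p q
  proof -
    have glue: ?thesis if "u \<in> A" "r \<noteq> u" "\<And>S. u \<in> S \<Longrightarrow> p \<notin> S \<Longrightarrow> v \<in> S"
      "\<And>S. u \<in> S \<Longrightarrow> p \<in> S \<Longrightarrow> v \<in> S \<union> B" for u
    proof -
      note u = that
      obtain S k U1 U2 where S: "S \<subseteq> A" "r \<notin> S" "u \<in> S" "k \<in> S" "is_tree S U1" "is_tree (A - S) U2"
        "TA = insert {r, k} (U1 \<union> U2)"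
        using IH[OF u(1,2)] by blast
      show ?thesis
      proof (cases "p \<in> S")
        case True
        have "is_tree (S \<union> B) (insert {p, q} (U1 \<union> TB))"
          by (rule is_tree.join) (use S tB True q dis in auto)
        moreover have "(A \<union> B) - (S \<union> B) = A - S" using dis S by auto
        moreover have "v \<in> S \<union> B" using u(4) S(3) True by blast
        moreover have "insert {p, q} (TA \<union> TB) = insert {r, k} (insert {p, q} (U1 \<union> TB) \<union> U2)"
          unfolding S(7) by blast
        moreover have "S \<union> B \<subseteq> A \<union> B" "r \<notin> S \<union> B" "k \<in> S \<union> B" using S dis r by auto
        ultimately show ?thesis using S(6) by metis
      next
        case False
        have "is_tree ((A - S) \<union> B) (insert {p, q} (U2 \<union> TB))"
          by (rule is_tree.join) (use S tB False p q dis in auto)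
        moreover have "(A \<union> B) - S = (A - S) \<union> B" using dis S by auto
        moreover have "v \<in> S" using u(3) S(3) False by blast
        moreover have "insert {p, q} (TA \<union> TB) = insert {r, k} (U1 \<union> insert {p, q} (U2 \<union> TB))"
          unfolding S(7) by blast
        moreover have "S \<subseteq> A \<union> B" using S by auto
        ultimately show ?thesis using S by metis
      qed
    qed
    show ?thesis
    proof (cases "v \<in> A")
      case True
      then show ?thesis by (intro glue[of v]) (use v in auto)
    next
      case False
      hence vB: "v \<in> B" using v by auto
      show ?thesis
      proof (cases "p = r")
        case True
        have "(A \<union> B) - B = A" using dis by auto
        moreover have "insert {p, q} (TA \<union> TB) = insert {r, q} (TB \<union> TA)" using True by blast
        moreover have "B \<subseteq> A \<union> B" "r \<notin> B" using r dis by auto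
        ultimately show ?thesis using tA tB q vB by metis
      next
        case False
        then show ?thesis by (intro glue[of p]) (use p vB in auto)
      qed
    qed
  qed
  show ?case
  proof (cases "r \<in> V1")
    case True
    show ?thesis
      by (rule step[OF join.IH(1)]) (use True join in auto)
  next
    case False
    have "\<exists>S k U1 U2. S \<subseteq> V2 \<union> V1 \<and> r \<notin> S \<and> v \<in> S \<and> k \<in> S \<and> is_tree S U1 \<and> is_tree ((V2 \<union> V1) - S) U2
      \<and> insert {j, i} (T2 \<union> T1) = insert {r, k} (U1 \<union> U2)"
      by (rule step[OF join.IH(2)]) (use False join in auto)
    thus ?thesis by (simp add: Un_commute insert_commute)
  qed
qed

text \<open>Marking the vertex \<open>v\<close> singles out one branch at the root. This is the
  combinatorial form of differentiating an exponential, and it is the source of the recursion for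
  \<open>tree_coeff\<close>.\<close>

lemma tree_sum_root_le:
  assumes fin: "finite V" and r: "r \<notin> V" and v: "v \<in> V" and w: "\<And>e. 0 \<le> w e"
  shows "tree_sum w UNIV (insert r V) \<le> (\<Sum>S | S \<subseteq> V \<and> v \<in> S. \<Sum>j\<in>S.
    w {r, j} * tree_sum w UNIV S * tree_sum w UNIV (insert r (V - S)))"
proof -
  define tg where "tg S = {T. is_tree S T}" for S :: "'a set"
  let ?Sv = "{S. S \<subseteq> V \<and> v \<in> S}"
  let ?B = "Sigma ?Sv (\<lambda>S. S \<times> (tg S \<times> tg (insert r (V - S))))"
  let ?g = "\<lambda>(S, j, T1, T2). insert {r, j} (T1 \<union> T2)"
  have fin_tg: "finite (tg S)" if "S \<subseteq> insert r V" for S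
    using finite_subset[OF that] fin finite_trees[of S UNIV] by (simp add: tg_def)
  have fSv: "finite ?Sv" using fin by auto
  have finB: "finite ?B"
    using fSv by (intro finite_SigmaI finite_cartesian_product fin_tg) (auto dest: finite_subset[OF _ fin])
  have sub: "tg (insert r V) \<subseteq> ?g ` ?B"
  proof
    fix T assume "T \<in> tg (insert r V)"
    then obtain S j T1 T2 where S: "S \<subseteq> insert r V" "r \<notin> S" "v \<in> S" "j \<in> S" "is_tree S T1" "is_tree (insert r V - S) T2"
      "T = insert {r, j} (T1 \<union> T2)"
      using is_tree_root_edge[of "insert r V" T r v] v r by (auto simp: tg_def)
    have "insert r V - S = insert r (V - S)" using S by auto
    thus "T \<in> ?g ` ?B" using S
      by (intro image_eqI[of _ _ "(S, j, T1, T2)"]) (auto simp: tg_def)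
  qed
  have "tree_sum w UNIV (insert r V) \<le> (\<Sum>T\<in>?g ` ?B. prod w T)"
    unfolding tree_sum_def using sub finB w by (intro sum_mono2) (auto simp: tg_def intro: prod_nonneg)
  also have "\<dots> \<le> (\<Sum>b\<in>?B. prod w (?g b))"
    using sum_image_le[OF finB, of "prod w" ?g] w by (simp add: prod_nonneg o_def)
  also have "\<dots> = (\<Sum>(S, j, T1, T2)\<in>?B. w {r, j} * prod w T1 * prod w T2)"
  proof (intro sum.cong refl, clarify)
    fix S j T1 T2 assume *: "S \<subseteq> V" "v \<in> S" "j \<in> S" "T1 \<in> tg S" "T2 \<in> tg (insert r (V - S))"
    have e: "T1 \<subseteq> pair_edges S" "T2 \<subseteq> pair_edges (insert r (V - S))"
      using * is_tree_edges by (auto simp: tg_def)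
    have "pair_edges S \<inter> pair_edges (insert r (V - S)) = {}"
      by (rule pair_edges_disjoint) (use * r in auto)
    moreover have "{r, j} \<notin> pair_edges S" "{r, j} \<notin> pair_edges (insert r (V - S))" using * r by auto
    moreover have "finite T1" "finite T2"
      using e *(1) fin by (meson finite_Diff finite_insert finite_pair_edges finite_subset)+
    moreover have "T1 \<inter> T2 = {}" "{r, j} \<notin> T1 \<union> T2" using calculation e by blast+
    ultimately show "prod w (insert {r, j} (T1 \<union> T2)) = w {r, j} * prod w T1 * prod w T2"
      by (simp add: prod.union_disjoint)
  qed
  also have "\<dots> = (\<Sum>S\<in>?Sv. \<Sum>(j, T1, T2)\<in>S \<times> (tg S \<times> tg (insert r (V - S))). w {r, j} * prod w T1 * prod w T2)"
  proof -
    have "finite (S \<times> (tg S \<times> tg (insert r (V - S))))" if "S \<in> ?Sv" for S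
      using that by (intro finite_cartesian_product fin_tg) (auto dest: finite_subset[OF _ fin])
    thus ?thesis by (subst sum.Sigma[OF fSv]) (simp_all add: split_def)
  qed
  also have "\<dots> = (\<Sum>S\<in>?Sv. \<Sum>j\<in>S. w {r, j} * tree_sum w UNIV S * tree_sum w UNIV (insert r (V - S)))"
  proof (intro sum.cong refl)
    fix S
    have ts: "tree_sum w UNIV A = (\<Sum>T\<in>tg A. prod w T)" for A by (simp add: tree_sum_def tg_def)
    have "(\<Sum>(j, T1, T2)\<in>S \<times> (tg S \<times> tg (insert r (V - S))). w {r, j} * prod w T1 * prod w T2)
       = (\<Sum>j\<in>S. \<Sum>T1\<in>tg S. \<Sum>T2\<in>tg (insert r (V - S)). w {r, j} * (prod w T1 * prod w T2))"
      by (simp only: sum.cartesian_product split_def mult.assoc)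
    also have "\<dots> = (\<Sum>j\<in>S. w {r, j} * tree_sum w UNIV S * tree_sum w UNIV (insert r (V - S)))"
      by (simp only: ts mult.assoc sum_product) (simp only: sum_distrib_left)
    finally show "(\<Sum>(j, T1, T2)\<in>S \<times> (tg S \<times> tg (insert r (V - S))). w {r, j} * prod w T1 * prod w T2)
       = (\<Sum>j\<in>S. w {r, j} * tree_sum w UNIV S * tree_sum w UNIV (insert r (V - S)))" .
  qed
  finally show ?thesis .
qed

section \<open>The tree-graph bound\<close>

text \<open>The recursion for a new edge has the coefficients \<open>1 + \<omega> e\<close> and
  \<open>\<omega> e\<close>; pulling out \<open>max 1 |1 + \<omega> e|\<close> leaves this weight on
  the tree edge.\<close>

definition red_weight :: "('v set \<Rightarrow> complex) \<Rightarrow> 'v set \<Rightarrow> real" where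
  "red_weight \<omega> e = norm (\<omega> e) / max 1 (norm (1 + \<omega> e))"

lemma red_weight_nonneg [simp]: "0 \<le> red_weight \<omega> e"
  by (simp add: red_weight_def)

lemma norm_conn_sum_insert_edge_le:
  assumes "finite V" "i \<in> V" "j \<in> V" "i \<noteq> j" "{i, j} \<notin> E"
  shows "norm (conn_sum \<omega> (insert {i, j} E) V) \<le> norm (1 + \<omega> {i, j}) * norm (conn_sum \<omega> E V)
    + norm (\<omega> {i, j}) * (\<Sum>S | S \<subseteq> V \<and> i \<in> S \<and> j \<notin> S. norm (conn_sum \<omega> E S) * norm (conn_sum \<omega> E (V - S)))"
  unfolding conn_sum_insert_edge[OF assms]
  by (intro order_trans[OF norm_triangle_ineq] add_mono)
     (auto simp: norm_mult intro!: mult_left_mono sum_norm_le)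

lemma pair_edges_Un_Diff_subset:
  "S \<subseteq> V \<Longrightarrow> pair_edges S \<union> pair_edges (V - S) \<subseteq> pair_edges V"
  by (auto simp: pair_edges_def)

text \<open>Since \<open>|\<omega> e| = red_weight \<omega> e * |1 + \<omega> e|\<close> for such
  edges, both terms of the recursion carry the factor \<open>|1 + \<omega> e|\<close>. In the second
  term the factors of edges between the two parts are missing; they are at least \<open>1\<close>
  and may be inserted.\<close>

lemma norm_conn_sum_expanding_edges:
  assumes "finite E" "E \<subseteq> pair_edges UNIV" "\<And>e. e \<in> E \<Longrightarrow> 1 \<le> norm (1 + \<omega> e)"
    and "finite V" "V \<noteq> {}"
  shows "norm (conn_sum \<omega> E V) \<le> (\<Prod>e\<in>E \<inter> pair_edges V. norm (1 + \<omega> e)) * tree_sum (red_weight \<omega>) E V"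
  using assms
proof (induction E arbitrary: V rule: finite_induct)
  case empty
  then show ?case by (auto simp: conn_sum_empty_edges tree_sum_nonneg)
next
  case (insert e E)
  let ?\<tau> = "tree_sum (red_weight \<omega>)" and ?f = "\<lambda>e. norm (1 + \<omega> e)"
  note IH = insert.IH[OF _ insert.prems(2)]
  obtain i j where e: "e = {i, j}" "i \<noteq> j" using insert.prems by (auto simp: pair_edges_def)
  show ?case
  proof (cases "e \<in> pair_edges V")
    case False
    have "norm (conn_sum \<omega> (insert e E) V) \<le> (\<Prod>e\<in>E \<inter> pair_edges V. ?f e) * ?\<tau> E V"
      using IH[of V] insert.prems by (simp add: conn_sum_insert_edge_outside[OF False])
    also have "\<dots> \<le> (\<Prod>e\<in>E \<inter> pair_edges V. ?f e) * ?\<tau> (insert e E) V"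
      by (intro mult_left_mono tree_sum_mono_edges prod_nonneg) (use insert.prems in auto)
    finally show ?thesis using False by simp
  next
    case True
    hence ij: "i \<in> V" "j \<in> V" by (auto simp: e)
    let ?Sj = "{S. S \<subseteq> V \<and> i \<in> S \<and> j \<notin> S}"
    let ?P = "\<Prod>e\<in>E \<inter> pair_edges V. ?f e"
    have P0: "0 \<le> ?P" by (intro prod_nonneg) auto
    have w: "norm (\<omega> e) = red_weight \<omega> e * ?f e"
      using insert.prems(2)[of e] by (cases "1 + \<omega> e = 0") (simp_all add: red_weight_def max_def)
    have S: "norm (conn_sum \<omega> E S) * norm (conn_sum \<omega> E (V - S)) \<le> ?P * (?\<tau> E S * ?\<tau> E (V - S))"
      if "S \<in> ?Sj" for S
    proof -
      have fin: "finite S" using that finite_subset[OF _ insert.prems(3)] by simp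
      have "norm (conn_sum \<omega> E S) * norm (conn_sum \<omega> E (V - S)) \<le>
          ((\<Prod>e\<in>E \<inter> pair_edges S. ?f e) * ?\<tau> E S) * ((\<Prod>e\<in>E \<inter> pair_edges (V - S). ?f e) * ?\<tau> E (V - S))"
        by (intro mult_mono IH mult_nonneg_nonneg prod_nonneg tree_sum_nonneg)
           (use insert.prems that ij fin in auto)
      also have "\<dots> = (\<Prod>e\<in>E \<inter> (pair_edges S \<union> pair_edges (V - S)). ?f e) * (?\<tau> E S * ?\<tau> E (V - S))"
        unfolding Int_Un_distrib
        using pair_edges_disjoint[of S "V - S"] insert.hyps
        by (subst prod.union_disjoint) auto
      also have "\<dots> \<le> ?P * (?\<tau> E S * ?\<tau> E (V - S))"
        using pair_edges_Un_Diff_subset[of S V] that insert.hyps insert.prems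
        by (intro mult_right_mono prod_mono2 mult_nonneg_nonneg tree_sum_nonneg) auto
      finally show ?thesis .
    qed
    have "norm (conn_sum \<omega> (insert e E) V) \<le> ?f e * norm (conn_sum \<omega> E V)
        + norm (\<omega> e) * (\<Sum>S\<in>?Sj. norm (conn_sum \<omega> E S) * norm (conn_sum \<omega> E (V - S)))"
      unfolding e(1) by (rule norm_conn_sum_insert_edge_le) (use ij e insert in auto)
    also have "\<dots> \<le> ?f e * (?P * ?\<tau> E V) + norm (\<omega> e) * (\<Sum>S\<in>?Sj. ?P * (?\<tau> E S * ?\<tau> E (V - S)))"
      by (intro add_mono mult_left_mono sum_mono S IH) (use insert.prems in auto)
    also have "\<dots> = ?f e * ?P * (?\<tau> E V + red_weight \<omega> e * (\<Sum>S\<in>?Sj. ?\<tau> E S * ?\<tau> E (V - S)))"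
      unfolding w by (simp add: algebra_simps sum_distrib_left)
    also have "\<dots> \<le> ?f e * ?P * ?\<tau> (insert e E) V"
      using tree_sum_insert_edge[OF insert.prems(3) ij, of E "red_weight \<omega>"] e insert.hyps P0
      by (intro mult_left_mono) auto
    also have "?f e * ?P = (\<Prod>e\<in>insert e E \<inter> pair_edges V. ?f e)"
      using True insert.hyps by simp
    finally show ?thesis .
  qed
qed

lemma prod_antimono_le_1:
  fixes f :: "'b \<Rightarrow> real"
  assumes "finite B" "A \<subseteq> B" "\<And>x. x \<in> B \<Longrightarrow> 0 \<le> f x" "\<And>x. x \<in> B - A \<Longrightarrow> f x \<le> 1"
  shows "prod f B \<le> prod f A"
proof -
  have "prod f B = prod f (B - A) * prod f A" by (rule prod.subset_diff) (use assms in auto)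
  also have "\<dots> \<le> 1 * prod f A"
    by (intro mult_right_mono prod_le_1 prod_nonneg) (use assms in auto)
  finally show ?thesis by simp
qed

text \<open>Edges are switched on one after the other, those with \<open>|1 + \<omega> e| > 1\<close> first. The factors
  \<open>1 + \<omega> e\<close> of edges not yet switched on are kept, so that stability can be used on
  each component present when the first phase ends; in the second phase factors between components
  are dropped, being at most \<open>1\<close>.\<close>

lemma norm_conn_sum_le_tree_sum:
  fixes \<beta> :: "'v \<Rightarrow> real"
  assumes fin: "finite V0" and V0: "V0 \<noteq> {}" and \<beta>: "\<And>v. 0 \<le> \<beta> v"
    and stab: "\<And>S. S \<subseteq> V0 \<Longrightarrow> (\<Prod>e\<in>pair_edges S. norm (1 + \<omega> e)) \<le> (\<Prod>v\<in>S. \<beta> v)"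
  shows "norm (conn_sum \<omega> UNIV V0) \<le> (\<Prod>v\<in>V0. \<beta> v) * tree_sum (red_weight \<omega>) UNIV V0"
proof -
  let ?\<tau> = "tree_sum (red_weight \<omega>)" and ?f = "\<lambda>e. norm (1 + \<omega> e)"
  define N where "N = {e \<in> pair_edges V0. 1 < ?f e}"
  have finN: "finite N" using fin by (simp add: N_def)
  have "norm (conn_sum \<omega> (N \<union> F) V) * (\<Prod>e\<in>pair_edges V - (N \<union> F). ?f e) \<le> (\<Prod>v\<in>V. \<beta> v) * ?\<tau> (N \<union> F) V"
    if "finite F" "F \<subseteq> pair_edges V0 - N" "V \<subseteq> V0" "V \<noteq> {}" for F V
    using that
  proof (induction F arbitrary: V rule: finite_induct)
    case empty
    have finV: "finite V" using finite_subset[OF empty(2) fin] .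
    have "norm (conn_sum \<omega> N V) * (\<Prod>e\<in>pair_edges V - N. ?f e)
        \<le> (\<Prod>e\<in>N \<inter> pair_edges V. ?f e) * ?\<tau> N V * (\<Prod>e\<in>pair_edges V - N. ?f e)"
      by (intro mult_right_mono norm_conn_sum_expanding_edges prod_nonneg)
         (use finN finV empty pair_edges_mono[of V0 UNIV] in \<open>auto simp: N_def\<close>)
    \<comment> \<open>The factors already produced and those kept for later make up the product over
      all pairs of \<open>V\<close>, to which stability applies.\<close>
    also have "\<dots> = (\<Prod>e\<in>pair_edges V. ?f e) * ?\<tau> N V"
      using prod.Int_Diff[of "pair_edges V" ?f N] finV by (simp add: Int_commute mult_ac)
    also have "\<dots> \<le> (\<Prod>v\<in>V. \<beta> v) * ?\<tau> N V"
      by (intro mult_right_mono stab tree_sum_nonneg) (use empty in auto)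
    finally show ?case by simp
  next
    case (insert e F)
    note IH = insert.IH
    have F: "F \<subseteq> pair_edges V0 - N" and eN: "e \<in> pair_edges V0" "e \<notin> N" using insert.prems by auto
    obtain i j where e: "e = {i, j}" "i \<noteq> j" using eN by (auto simp: pair_edges_def)
    have finV: "finite V" using finite_subset[OF insert.prems(2) fin] .
    let ?E = "N \<union> F"
    have eE: "e \<notin> ?E" using insert eN by auto
    have fe: "?f e' \<le> 1" if "e' \<in> pair_edges V - ?E" for e'
      using that pair_edges_mono[OF insert.prems(2)] by (auto simp: N_def not_less)
    define R where "R S = (\<Prod>e\<in>pair_edges S - ?E. ?f e)" for S
    have R0: "0 \<le> R S" for S unfolding R_def by (intro prod_nonneg) auto
    have ins: "N \<union> insert e F = insert e ?E" by auto
    show ?case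
    proof (cases "e \<in> pair_edges V")
      case False
      have "norm (conn_sum \<omega> (insert e ?E) V) * (\<Prod>e\<in>pair_edges V - insert e ?E. ?f e) \<le> (\<Prod>v\<in>V. \<beta> v) * ?\<tau> ?E V"
        using IH[OF F insert.prems(2,3)] False by (simp add: conn_sum_insert_edge_outside)
      also have "\<dots> \<le> (\<Prod>v\<in>V. \<beta> v) * ?\<tau> (insert e ?E) V"
        by (intro mult_left_mono tree_sum_mono_edges prod_nonneg) (use finV \<beta> in auto)
      finally show ?thesis unfolding ins .
    next
      case True
      hence ij: "i \<in> V" "j \<in> V" by (auto simp: e)
      let ?Sj = "{S. S \<subseteq> V \<and> i \<in> S \<and> j \<notin> S}"
      let ?B = "\<Prod>v\<in>V. \<beta> v"
      have B0: "0 \<le> ?B" by (intro prod_nonneg) (use \<beta> in auto)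
      let ?R = "\<Prod>e\<in>pair_edges V - insert e ?E. ?f e"
      have R': "0 \<le> ?R" by (intro prod_nonneg) auto
      \<comment> \<open>The coefficient \<open>1 + \<omega> e\<close> puts \<open>e\<close> back
        among the edges still switched off, which is the form in which the induction hypothesis
        applies to \<open>V\<close>.\<close>
      have RV: "?f e * ?R = R V"
      proof -
        have "pair_edges V - ?E = insert e (pair_edges V - insert e ?E)" using True eE by auto
        hence "R V = prod ?f (insert e (pair_edges V - insert e ?E))" by (simp only: R_def)
        also have "\<dots> = ?f e * ?R" by (rule prod.insert) (use finV in auto)
        finally show ?thesis by simp
      qed
      have w: "norm (\<omega> e) = red_weight \<omega> e"
        using eN by (simp add: red_weight_def max_def N_def)
      have S: "norm (conn_sum \<omega> ?E S) * norm (conn_sum \<omega> ?E (V - S)) * ?R \<le> ?B * (?\<tau> ?E S * ?\<tau> ?E (V - S))"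
        if "S \<in> ?Sj" for S
      proof -
        have finS: "finite S" "finite (V - S)" using that finite_subset[OF _ finV] by simp_all
        \<comment> \<open>Factors of waiting edges between \<open>S\<close> and \<open>V - S\<close>
          are dropped; edges outside \<open>N\<close> have factors at most \<open>1\<close>, so the
          product does not decrease.\<close>
        have "?R \<le> (\<Prod>e\<in>(pair_edges S - ?E) \<union> (pair_edges (V - S) - ?E). ?f e)"
          by (rule prod_antimono_le_1)
             (use finV fe that pair_edges_Un_Diff_subset[of S V] in \<open>auto simp: e\<close>)
        also have "\<dots> = R S * R (V - S)"
          unfolding R_def using finS pair_edges_disjoint[of S "V - S"]
          by (subst prod.union_disjoint) auto
        finally have "norm (conn_sum \<omega> ?E S) * norm (conn_sum \<omega> ?E (V - S)) * ?R
            \<le> norm (conn_sum \<omega> ?E S) * norm (conn_sum \<omega> ?E (V - S)) * (R S * R (V - S))"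
          by (intro mult_left_mono) auto
        also have "\<dots> = (norm (conn_sum \<omega> ?E S) * R S) * (norm (conn_sum \<omega> ?E (V - S)) * R (V - S))"
          by (simp add: mult_ac)
        also have "\<dots> \<le> ((\<Prod>v\<in>S. \<beta> v) * ?\<tau> ?E S) * ((\<Prod>v\<in>V - S. \<beta> v) * ?\<tau> ?E (V - S))"
          unfolding R_def
          by (intro mult_mono IH F mult_nonneg_nonneg prod_nonneg tree_sum_nonneg)
             (use insert.prems that ij \<beta> in auto)
        also have "\<dots> = ?B * (?\<tau> ?E S * ?\<tau> ?E (V - S))"
          using prod.subset_diff[of S V \<beta>] that finV by (simp add: mult_ac)
        finally show ?thesis .
      qed
      have "norm (conn_sum \<omega> (insert e ?E) V) * ?R \<le> (?f e * norm (conn_sum \<omega> ?E V)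
          + norm (\<omega> e) * (\<Sum>S\<in>?Sj. norm (conn_sum \<omega> ?E S) * norm (conn_sum \<omega> ?E (V - S)))) * ?R"
        unfolding e(1) by (intro mult_right_mono norm_conn_sum_insert_edge_le prod_nonneg) (use ij e eE finV in auto)
      also have "\<dots> = norm (conn_sum \<omega> ?E V) * R V
          + norm (\<omega> e) * (\<Sum>S\<in>?Sj. norm (conn_sum \<omega> ?E S) * norm (conn_sum \<omega> ?E (V - S)) * ?R)"
        unfolding RV[symmetric] sum_distrib_right[symmetric] by algebra
      also have "\<dots> \<le> ?B * ?\<tau> ?E V + norm (\<omega> e) * (\<Sum>S\<in>?Sj. ?B * (?\<tau> ?E S * ?\<tau> ?E (V - S)))"
        using IH[OF F insert.prems(2,3)]
        by (intro add_mono mult_left_mono sum_mono S) (auto simp: R_def)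
      also have "\<dots> = ?B * (?\<tau> ?E V + red_weight \<omega> e * (\<Sum>S\<in>?Sj. ?\<tau> ?E S * ?\<tau> ?E (V - S)))"
        unfolding w by (simp add: algebra_simps sum_distrib_left)
      also have "\<dots> \<le> ?B * ?\<tau> (insert e ?E) V"
        using tree_sum_insert_edge[OF finV ij, of ?E "red_weight \<omega>"] e eE B0
        by (intro mult_left_mono) auto
      finally show ?thesis unfolding ins .
    qed
  qed
  from this[of "pair_edges V0 - N" V0] fin V0
  have "norm (conn_sum \<omega> (pair_edges V0) V0) \<le> (\<Prod>v\<in>V0. \<beta> v) * ?\<tau> (pair_edges V0) V0"
    by (simp add: N_def Un_absorb1)
  moreover have "conn_sum \<omega> (pair_edges V0) V0 = conn_sum \<omega> UNIV V0" by (simp add: conn_sum_def)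
  moreover have "?\<tau> (pair_edges V0) V0 = ?\<tau> UNIV V0"
    unfolding tree_sum_def by (intro sum.cong) (auto dest: is_tree_edges)
  ultimately show ?thesis by simp
qed

section \<open>Integrals of tree sums\<close>

text \<open>An edge is a set, so its endpoints are passed to \<open>f\<close> in increasing order;
  for symmetric \<open>f\<close> the order is immaterial.\<close>

definition edge_val :: "('a \<Rightarrow> 'a \<Rightarrow> 'b) \<Rightarrow> (nat \<Rightarrow> 'a) \<Rightarrow> nat set \<Rightarrow> 'b" where
  "edge_val f x e = f (x (Min e)) (x (Max e))"

lemma edge_val_doubleton:
  assumes "\<And>x y. f x y = f y x"
  shows "edge_val f x {i, j} = f (x i) (x j)"
  by (simp add: edge_val_def max_def min_def assms[of "x i" "x j"])

lemma Min_Max_pair_edges: "e \<in> pair_edges V \<Longrightarrow> Min e \<in> V \<and> Max e \<in> (V :: nat set)"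
  by (auto simp: pair_edges_def min_def max_def)

lemma edge_val_cong:
  assumes "\<And>i. i \<in> V \<Longrightarrow> x i = y i" "e \<in> pair_edges V"
  shows "edge_val f x e = edge_val f y e"
  using assms Min_Max_pair_edges[of e V] by (simp add: edge_val_def)

lemma edge_val_measurable:
  assumes "(\<lambda>p. f (fst p) (snd p)) \<in> borel_measurable (M \<Otimes>\<^sub>M M)" "e \<in> pair_edges V"
  shows "(\<lambda>x. edge_val f x e) \<in> borel_measurable (PiM V (\<lambda>_. M))"
proof -
  have *: "Min e \<in> V" "Max e \<in> V" using Min_Max_pair_edges[OF assms(2)] by auto
  have "(\<lambda>x. (x (Min e), x (Max e))) \<in> PiM V (\<lambda>_. M) \<rightarrow>\<^sub>M M \<Otimes>\<^sub>M M"
    using * by measurable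
  from measurable_compose[OF this assms(1)] show ?thesis by (simp add: edge_val_def)
qed

lemma sum_Pow_by_card:
  fixes f :: "nat \<Rightarrow> 'b :: semiring_1"
  assumes "finite A"
  shows "(\<Sum>S\<in>Pow A. f (card S)) = (\<Sum>k\<le>card A. of_nat (card A choose k) * f k)"
proof -
  have "(\<Sum>S\<in>Pow A. f (card S)) = (\<Sum>k\<le>card A. \<Sum>S | S \<in> Pow A \<and> card S = k. f (card S))"
    by (rule sum.group[symmetric]) (use assms in \<open>auto intro: card_mono\<close>)
  also have "\<dots> = (\<Sum>k\<le>card A. of_nat (card A choose k) * f k)"
  proof (intro sum.cong refl)
    fix k
    have "(\<Sum>S | S \<in> Pow A \<and> card S = k. f (card S)) = of_nat (card {S. S \<subseteq> A \<and> card S = k}) * f k"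
      by (simp add: Pow_def)
    thus "(\<Sum>S | S \<in> Pow A \<and> card S = k. f (card S)) = of_nat (card A choose k) * f k"
      by (simp add: n_subsets[OF assms])
  qed
  finally show ?thesis .
qed

lemma sum_rooted_subsets_by_card:
  fixes f :: "nat \<Rightarrow> 'b :: semiring_1"
  assumes "finite V" "v \<in> V"
  shows "(\<Sum>S | S \<subseteq> V \<and> v \<in> S. f (card S)) = (\<Sum>k<card V. of_nat ((card V - 1) choose k) * f (Suc k))"
proof -
  have "(\<Sum>S | S \<subseteq> V \<and> v \<in> S. f (card S)) = (\<Sum>S\<in>Pow (V - {v}). f (Suc (card S)))"
  proof (rule sum.reindex_bij_witness[of _ "insert v" "\<lambda>S. S - {v}"], goal_cases)
    case (5 S)
    hence "finite S" "v \<in> S" using assms finite_subset by auto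
    then show ?case by (simp only: card_Suc_Diff1)
  qed (use assms in auto)
  also have "\<dots> = (\<Sum>k\<le>card (V - {v}). of_nat (card (V - {v}) choose k) * f (Suc k))"
    by (rule sum_Pow_by_card) (use assms in auto)
  also have "{..card (V - {v})} = {..<card V}"
    using assms card_Suc_Diff1[of V v] by auto
  finally show ?thesis using assms by simp
qed

text \<open>The recursion is the coefficient form of \<open>F' \<le> S' F\<close> for the
  polynomials \<open>F\<close> with coefficients \<open>t n\<close> and \<open>S\<close> with
  coefficients \<open>s m\<close> in degree \<open>m + 1\<close>. Hence \<open>F * exp (- S)\<close>
  is nonincreasing on \<open>[0, 1]\<close>. Working with truncations avoids all questions of
  convergence.\<close>

lemma exp_recursion_bound:
  fixes s t :: "nat \<Rightarrow> real"
  assumes s: "\<And>n. 0 \<le> s n" and t: "\<And>n. 0 \<le> t n" and t0: "t 0 \<le> 1"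
    and rec: "\<And>n. n < N \<Longrightarrow> of_nat (Suc n) * t (Suc n) \<le> (\<Sum>m\<le>n. of_nat (Suc m) * s m * t (n - m))"
  shows "(\<Sum>n\<le>N. t n) \<le> exp (\<Sum>m<N. s m)"
proof -
  define F where "F u = (\<Sum>n\<le>N. t n * u ^ n)" for u
  define S where "S u = (\<Sum>m<N. s m * u ^ Suc m)" for u
  define F' where "F' u = (\<Sum>n<N. of_nat (Suc n) * t (Suc n) * u ^ n)" for u
  define S' where "S' u = (\<Sum>m<N. of_nat (Suc m) * s m * u ^ m)" for u
  have d: "((\<lambda>u. c * u ^ Suc m) has_real_derivative of_nat (Suc m) * c * u ^ m) (at u)" for c u :: real and m
    using DERIV_cmult[OF DERIV_pow[of "Suc m" u], of c] by (simp add: mult_ac)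
  have dS: "(S has_real_derivative S' u) (at u)" for u
    unfolding S_def S'_def by (intro DERIV_sum d)
  have dF: "(F has_real_derivative F' u) (at u)" for u
  proof -
    have "F u = t 0 + (\<Sum>n<N. t (Suc n) * u ^ Suc n)" for u
      unfolding F_def by (subst sum.atMost_shift) simp
    hence "F = (\<lambda>u. t 0 + (\<Sum>n<N. t (Suc n) * u ^ Suc n))" by auto
    thus ?thesis unfolding F'_def using DERIV_add[OF DERIV_const DERIV_sum[OF d]] by simp
  qed
  have le: "F' u \<le> S' u * F u" if u: "0 \<le> u" for u
  proof -
    let ?g = "\<lambda>m l. of_nat (Suc m) * s m * u ^ m * (t l * u ^ l)"
    have "F' u \<le> (\<Sum>n<N. (\<Sum>m\<le>n. of_nat (Suc m) * s m * t (n - m)) * u ^ n)"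
      unfolding F'_def by (intro sum_mono mult_right_mono rec) (use u in auto)
    also have "\<dots> = (\<Sum>n<N. \<Sum>m\<le>n. ?g m (n - m))"
      unfolding sum_distrib_right
    proof (intro sum.cong refl)
      fix n m :: nat assume "m \<in> {..n}"
      hence "u ^ n = u ^ m * u ^ (n - m)" by (simp add: power_add[symmetric])
      thus "of_nat (Suc m) * s m * t (n - m) * u ^ n = ?g m (n - m)" by simp
    qed
    also have "\<dots> = (\<Sum>(n, m)\<in>Sigma {..<N} (\<lambda>n. {..n}). ?g m (n - m))"
      by (rule sum.Sigma) auto
    also have "\<dots> = (\<Sum>(m, l)\<in>(\<lambda>(n, m). (m, n - m)) ` Sigma {..<N} (\<lambda>n. {..n}). ?g m l)"
      by (subst sum.reindex) (auto simp: inj_on_def split_def)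
    \<comment> \<open>The triangle of indices is enlarged to a rectangle, where the double sum
      factorises; all terms are nonnegative.\<close>
    also have "\<dots> \<le> (\<Sum>(m, l)\<in>{..<N} \<times> {..N}. ?g m l)"
      by (rule sum_mono2) (use s t u in auto)
    also have "\<dots> = S' u * F u"
      unfolding S'_def F_def sum_product sum.cartesian_product ..
    finally show ?thesis .
  qed
  have "F 1 * exp (- S 1) \<le> F 0 * exp (- S 0)"
  proof (rule DERIV_nonpos_imp_nonincreasing[of 0 1 "\<lambda>u. F u * exp (- S u)"])
    fix u :: real assume "0 \<le> u" "u \<le> 1"
    have "((\<lambda>u. F u * exp (- S u)) has_real_derivative (F' u - S' u * F u) * exp (- S u)) (at u)"
      by (auto intro!: derivative_eq_intros dF dS simp: algebra_simps)
    moreover have "(F' u - S' u * F u) * exp (- S u) \<le> 0"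
      using le[OF \<open>0 \<le> u\<close>] by (simp add: mult_nonpos_nonneg)
    ultimately show "\<exists>y. ((\<lambda>u. F u * exp (- S u)) has_real_derivative y) (at u) \<and> y \<le> 0" by blast
  qed simp
  moreover have "F 0 = t 0" "S 0 = 0"
    unfolding F_def S_def by (subst sum.atMost_shift) auto
  moreover have "F 1 = (\<Sum>n\<le>N. t n)" "S 1 = (\<Sum>m<N. s m)" by (simp_all add: F_def S_def)
  ultimately have "(\<Sum>n\<le>N. t n) \<le> t 0 * exp (\<Sum>m<N. s m)" by (simp add: exp_minus field_simps)
  also have "\<dots> \<le> 1 * exp (\<Sum>m<N. s m)" by (rule mult_right_mono[OF t0]) simp
  finally show ?thesis by simp
qed

lemma (in product_sigma_finite) nn_integral_PiM_split:
  assumes fin: "finite I" "finite J" and IJ: "I \<inter> J = {}"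
    and f [measurable]: "f \<in> borel_measurable (PiM I M)" and g [measurable]: "g \<in> borel_measurable (PiM J M)"
  shows "(\<integral>\<^sup>+ x. f (restrict x I) * g (restrict x J) \<partial>PiM (I \<union> J) M) = (\<integral>\<^sup>+ x. f x \<partial>PiM I M) * (\<integral>\<^sup>+ x. g x \<partial>PiM J M)"
proof -
  have m: "(\<lambda>x. f (restrict x I) * g (restrict x J)) \<in> borel_measurable (PiM (I \<union> J) M)"
    by (intro borel_measurable_times_ennreal measurable_compose[OF measurable_restrict_subset f]
        measurable_compose[OF measurable_restrict_subset g]) auto
  have "(\<integral>\<^sup>+ x. f (restrict x I) * g (restrict x J) \<partial>PiM (I \<union> J) M) = (\<integral>\<^sup>+ x. \<integral>\<^sup>+ y. f x * g y \<partial>PiM J M \<partial>PiM I M)"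
    unfolding product_nn_integral_fold[OF IJ fin m]
    using IJ by (intro nn_integral_cong) (auto simp: restrict_merge space_PiM)
  also have "\<dots> = (\<integral>\<^sup>+ x. f x \<partial>PiM I M) * (\<integral>\<^sup>+ x. g x \<partial>PiM J M)"
    by (simp add: nn_integral_cmult nn_integral_multc)
  finally show ?thesis .
qed

locale tree_kernel = finite_measure M for M :: "'a measure" +
  fixes w :: "'a \<Rightarrow> 'a \<Rightarrow> real" and \<beta> :: "'a \<Rightarrow> real"
  assumes w_meas [measurable]: "(\<lambda>p. w (fst p) (snd p)) \<in> borel_measurable (M \<Otimes>\<^sub>M M)"
    and w_nonneg: "\<And>x y. 0 \<le> w x y" and w_sym: "\<And>x y. w x y = w y x"
    and \<beta>_meas [measurable]: "\<beta> \<in> borel_measurable M" and \<beta>_nonneg: "\<And>x. 0 \<le> \<beta> x"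
begin

sublocale prodM: product_sigma_finite "\<lambda>_. M"
  by (rule product_sigma_finite.intro) unfold_locales

definition tsum :: "(nat \<Rightarrow> 'a) \<Rightarrow> nat set \<Rightarrow> real" where
  "tsum x V = tree_sum (edge_val w x) UNIV V"

lemma tsum_nonneg [simp]: "0 \<le> tsum x V"
  unfolding tsum_def by (rule tree_sum_nonneg) (simp add: edge_val_def w_nonneg)

lemma tsum_cong: "(\<And>i. i \<in> V \<Longrightarrow> x i = y i) \<Longrightarrow> tsum x V = tsum y V"
  unfolding tsum_def by (intro tree_sum_cong edge_val_cong) auto

lemma tsum_measurable [measurable]: "(\<lambda>x. tsum x V) \<in> borel_measurable (PiM V (\<lambda>_. M))"
  unfolding tsum_def tree_sum_def
  by (intro borel_measurable_sum borel_measurable_prod edge_val_measurable w_meas)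
     (use is_tree_edges in auto)

text \<open>\<open>tree_coeff n x\<close> dominates \<open>1/n!\<close> times the integral over \<open>n\<close> further points of the
  sum over trees rooted at \<open>x\<close>. The recursion says that the generating function of
  \<open>tree_coeff\<close> is the exponential of that of the branches at the root.\<close>

function tree_coeff :: "nat \<Rightarrow> 'a \<Rightarrow> ennreal" where
  "tree_coeff 0 x = 1"
| "tree_coeff (Suc n) x = (\<Sum>m\<le>n. of_nat (Suc m) * (\<integral>\<^sup>+ y. ennreal (w x y * \<beta> y) * tree_coeff m y \<partial>M)
     * tree_coeff (n - m) x) / of_nat (Suc n)"
  by pat_completeness auto
termination by (relation "Wellfounded.measure fst") auto

definition branch :: "nat \<Rightarrow> 'a \<Rightarrow> ennreal" where
  "branch m x = (\<integral>\<^sup>+ y. ennreal (w x y * \<beta> y) * tree_coeff m y \<partial>M)"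

lemma tree_coeff_Suc:
  "of_nat (Suc n) * tree_coeff (Suc n) x = (\<Sum>m\<le>n. of_nat (Suc m) * branch m x * tree_coeff (n - m) x)"
proof -
  have "of_nat (Suc n) * (X / of_nat (Suc n)) = X" for X :: ennreal
    by (metis ennreal_times_divide mult_divide_eq_ennreal of_nat_eq_0_iff of_nat_neq_0
        ennreal_of_nat_neq_top mult.commute nat.distinct(1))
  thus ?thesis unfolding branch_def tree_coeff.simps by blast
qed

declare tree_coeff.simps(2) [simp del]

lemma tree_coeff_measurable [measurable]: "tree_coeff n \<in> borel_measurable M"
proof (induction n rule: less_induct)
  case (less n)
  show ?case
  proof (cases n)
    case (Suc k)
    have [measurable]: "tree_coeff m \<in> borel_measurable M" if "m \<le> k" for m using less that Suc by auto
    have "(\<lambda>x. \<integral>\<^sup>+ y. ennreal (w x y * \<beta> y) * tree_coeff m y \<partial>M) \<in> borel_measurable M" if "m \<le> k" for m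
    proof -
      have [measurable]: "tree_coeff m \<in> borel_measurable M" using less that Suc by auto
      have [measurable]: "(\<lambda>(x, y). w x y) \<in> borel_measurable (M \<Otimes>\<^sub>M M)"
        using w_meas by (simp add: split_def)
      show ?thesis by measurable
    qed
    hence "(\<lambda>x. tree_coeff (Suc k) x) \<in> borel_measurable M"
      unfolding tree_coeff.simps
      by (intro borel_measurable_divide_ennreal borel_measurable_sum borel_measurable_times_ennreal)
         (use less Suc in auto)
    thus ?thesis by (simp add: Suc)
  qed (simp add: fun_eq_iff[of "tree_coeff 0"])
qed

text \<open>The root, pinned at \<open>x\<close>, carries no factor \<open>\<beta>\<close>; that
  factor comes with the edge above it when the root is itself integrated over.\<close>

definition rooted_integral :: "nat set \<Rightarrow> nat \<Rightarrow> 'a \<Rightarrow> ennreal" where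
  "rooted_integral V r x = (\<integral>\<^sup>+ y. ennreal ((\<Prod>i\<in>V. \<beta> (y i)) * tsum (y(r := x)) (insert r V)) \<partial>PiM V (\<lambda>_. M))"

text \<open>Induction on the number of points, for all roots at once, because the branch split off
  has a root of its own. With \<open>k + 1\<close> points there are \<open>k choose m\<close>
  branches of \<open>m + 1\<close> points through a marked \<open>v\<close>, each with
  \<open>m + 1\<close> possible attachment vertices; branch and remainder factorise by
  Fubini.\<close>

lemma rooted_integral_le:
  assumes "finite V" "r \<notin> V" "x \<in> space M"
  shows "rooted_integral V r x \<le> ennreal (fact (card V)) * tree_coeff (card V) x"
  using assms
proof (induction "card V" arbitrary: V r x rule: less_induct)
  case less
  show ?case
  proof (cases "V = {}")
    case True
    have "(\<integral>\<^sup>+ y. ennreal (tsum (y(r := x)) {r}) \<partial>PiM {} (\<lambda>_. M)) = 1"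
      by (subst prodM.nn_integral_empty) (auto simp: tsum_def)
    thus ?thesis by (simp add: rooted_integral_def True)
  next
    case False
    then obtain v where v: "v \<in> V" by auto
    obtain k where k: "card V = Suc k" using False less.prems by (cases "card V") auto
    let ?P = "PiM V (\<lambda>_. M)"
    \<comment> \<open>\<open>f S j\<close> is the branch with its edge to the root,
      \<open>g (V - S)\<close> the rest of the tree, still attached to the root.\<close>
    define f where "f S j y = ennreal ((\<Prod>i\<in>S. \<beta> (y i)) * w x (y j) * tsum y S)" for S j y
    define g where "g S y = ennreal ((\<Prod>i\<in>S. \<beta> (y i)) * tsum (y(r := x)) (insert r S))" for S y
    have upd: "(\<lambda>y. y(r := x)) \<in> PiM S (\<lambda>_. M) \<rightarrow>\<^sub>M PiM (insert r S) (\<lambda>_. M)" for S :: "nat set"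
      by (rule measurable_fun_upd[where J=S]) (use less.prems in auto)
    have g_meas: "g S \<in> borel_measurable (PiM S (\<lambda>_. M))" for S
    proof -
      have [measurable]: "(\<lambda>y. tsum (y(r := x)) (insert r S)) \<in> borel_measurable (PiM S (\<lambda>_. M))"
        using measurable_compose[OF upd tsum_measurable] .
      show ?thesis unfolding g_def by measurable
    qed
    have wx [measurable]: "w x \<in> borel_measurable M"
    proof -
      have "(\<lambda>y. (x, y)) \<in> M \<rightarrow>\<^sub>M M \<Otimes>\<^sub>M M" using less.prems by simp
      from measurable_compose[OF this w_meas] show ?thesis by simp
    qed
    have f_meas: "f S j \<in> borel_measurable (PiM S (\<lambda>_. M))" if "j \<in> S" for S j
    proof -
      have [measurable]: "(\<lambda>y. y j) \<in> PiM S (\<lambda>_. M) \<rightarrow>\<^sub>M M" using that by measurable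
      show ?thesis unfolding f_def by measurable
    qed
    have pt: "ennreal ((\<Prod>i\<in>V. \<beta> (y i)) * tsum (y(r := x)) (insert r V))
        \<le> (\<Sum>S | S \<subseteq> V \<and> v \<in> S. \<Sum>j\<in>S. f S j (restrict y S) * g (V - S) (restrict y (V - S)))" for y
    proof -
      let ?y = "y(r := x)" and ?B = "\<Prod>i\<in>V. \<beta> (y i)"
      have B0: "0 \<le> ?B" by (intro prod_nonneg) (use \<beta>_nonneg in auto)
      have "?B * tsum ?y (insert r V) \<le> ?B * (\<Sum>S | S \<subseteq> V \<and> v \<in> S. \<Sum>j\<in>S.
          edge_val w ?y {r, j} * tsum ?y S * tsum ?y (insert r (V - S)))"
        unfolding tsum_def
        by (intro mult_left_mono tree_sum_root_le B0) (use less.prems v w_nonneg in \<open>auto simp: edge_val_def\<close>)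
      also have "\<dots> = (\<Sum>S | S \<subseteq> V \<and> v \<in> S. \<Sum>j\<in>S.
          ((\<Prod>i\<in>S. \<beta> (y i)) * w x (y j) * tsum y S) * ((\<Prod>i\<in>V - S. \<beta> (y i)) * tsum ?y (insert r (V - S))))"
        unfolding sum_distrib_left
      proof (intro sum.cong refl)
        fix S j assume S: "S \<in> {S. S \<subseteq> V \<and> v \<in> S}" "j \<in> S"
        have "edge_val w ?y {r, j} = w x (y j)"
          using S less.prems by (subst edge_val_doubleton[OF w_sym]) auto
        moreover have "tsum ?y S = tsum y S" by (rule tsum_cong) (use S less.prems in auto)
        moreover have "?B = (\<Prod>i\<in>V - S. \<beta> (y i)) * (\<Prod>i\<in>S. \<beta> (y i))"
          by (rule prod.subset_diff) (use S less.prems in auto)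
        ultimately show "?B * (edge_val w ?y {r, j} * tsum ?y S * tsum ?y (insert r (V - S)))
          = ((\<Prod>i\<in>S. \<beta> (y i)) * w x (y j) * tsum y S) * ((\<Prod>i\<in>V - S. \<beta> (y i)) * tsum ?y (insert r (V - S)))"
          by simp
      qed
      finally have "ennreal (?B * tsum ?y (insert r V)) \<le> ennreal (\<Sum>S | S \<subseteq> V \<and> v \<in> S. \<Sum>j\<in>S.
          ((\<Prod>i\<in>S. \<beta> (y i)) * w x (y j) * tsum y S) * ((\<Prod>i\<in>V - S. \<beta> (y i)) * tsum ?y (insert r (V - S))))"
        by (rule ennreal_leI)
      also have "\<dots> = (\<Sum>S | S \<subseteq> V \<and> v \<in> S. \<Sum>j\<in>S. f S j y * g (V - S) y)"
        unfolding f_def g_def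
        by (subst sum_ennreal[symmetric], force intro!: sum_nonneg mult_nonneg_nonneg prod_nonneg \<beta>_nonneg w_nonneg,
            intro sum.cong refl, subst sum_ennreal[symmetric],
            force intro!: sum_nonneg mult_nonneg_nonneg prod_nonneg \<beta>_nonneg w_nonneg,
            intro sum.cong refl ennreal_mult mult_nonneg_nonneg prod_nonneg \<beta>_nonneg w_nonneg tsum_nonneg)
      also have "\<dots> = (\<Sum>S | S \<subseteq> V \<and> v \<in> S. \<Sum>j\<in>S. f S j (restrict y S) * g (V - S) (restrict y (V - S)))"
      proof (intro sum.cong refl arg_cong2[where f="(*)"])
        fix S j assume S: "S \<in> {S. S \<subseteq> V \<and> v \<in> S}" "j \<in> S"
        show "f S j y = f S j (restrict y S)"
          using S unfolding f_def by (intro arg_cong[where f=ennreal] arg_cong2[where f="(*)"] prod.cong tsum_cong) auto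
        show "g (V - S) y = g (V - S) (restrict y (V - S))"
          unfolding g_def by (intro arg_cong[where f=ennreal] arg_cong2[where f="(*)"] prod.cong tsum_cong) auto
      qed
      finally show ?thesis .
    qed
    \<comment> \<open>The attachment vertex \<open>j\<close> is the outermost variable, so the other
      points of the branch form a rooted integral at \<open>j\<close>.\<close>
    have fle: "(\<integral>\<^sup>+ y. f S j y \<partial>PiM S (\<lambda>_. M)) \<le> ennreal (fact (card S - 1)) * branch (card S - 1) x"
      if S: "S \<subseteq> V" "j \<in> S" for S j
    proof -
      let ?S = "S - {j}"
      have fin: "finite ?S" using S less.prems finite_subset by auto
      have SS: "insert j ?S = S" using S by auto
      have cS: "card ?S = card S - 1" using S by simp
      have "card S \<le> card V" using S less.prems by (intro card_mono) auto
      moreover have "card S > 0" using S fin card_gt_0_iff by fastforce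
      ultimately have cl: "card ?S < card V" by (simp add: cS)
      have "(\<integral>\<^sup>+ y. f S j y \<partial>PiM S (\<lambda>_. M)) = (\<integral>\<^sup>+ u. \<integral>\<^sup>+ y. f S j (y(j := u)) \<partial>PiM ?S (\<lambda>_. M) \<partial>M)"
        by (rule prodM.product_nn_integral_insert_rev[OF fin, of j "f S j", unfolded SS])
           (use f_meas[OF S(2)] in auto)
      also have "\<dots> = (\<integral>\<^sup>+ u. ennreal (w x u * \<beta> u) * rooted_integral ?S j u \<partial>M)"
      proof (rule nn_integral_cong)
        fix u assume u: "u \<in> space M"
        have upd': "(\<lambda>y. y(j := u)) \<in> PiM ?S (\<lambda>_. M) \<rightarrow>\<^sub>M PiM S (\<lambda>_. M)"
          by (rule measurable_fun_upd[where J="?S"]) (use S u in auto)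
        have [measurable]: "(\<lambda>y. tsum (y(j := u)) S) \<in> borel_measurable (PiM ?S (\<lambda>_. M))"
          using measurable_compose[OF upd' tsum_measurable] .
        have "f S j (y(j := u)) = ennreal (w x u * \<beta> u) * ennreal ((\<Prod>i\<in>?S. \<beta> (y i)) * tsum (y(j := u)) S)" for y
        proof -
          have "(\<Prod>i\<in>S. \<beta> ((y(j := u)) i)) = \<beta> u * (\<Prod>i\<in>?S. \<beta> ((y(j := u)) i))"
            using S fin by (subst prod.remove[of S j]) auto
          also have "(\<Prod>i\<in>?S. \<beta> ((y(j := u)) i)) = (\<Prod>i\<in>?S. \<beta> (y i))"
            by (rule prod.cong) auto
          finally show ?thesis unfolding f_def
            by (subst ennreal_mult[symmetric])
               (auto intro!: mult_nonneg_nonneg prod_nonneg \<beta>_nonneg w_nonneg simp: mult_ac)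
        qed
        thus "(\<integral>\<^sup>+ y. f S j (y(j := u)) \<partial>PiM ?S (\<lambda>_. M)) = ennreal (w x u * \<beta> u) * rooted_integral ?S j u"
          unfolding rooted_integral_def SS by (simp add: nn_integral_cmult)
      qed
      also have "\<dots> \<le> (\<integral>\<^sup>+ u. ennreal (w x u * \<beta> u) * (ennreal (fact (card ?S)) * tree_coeff (card ?S) u) \<partial>M)"
        by (intro nn_integral_mono mult_left_mono less.hyps cl fin) auto
      also have "\<dots> = ennreal (fact (card ?S)) * branch (card ?S) x"
        unfolding branch_def by (subst nn_integral_cmult[symmetric]) (auto simp: mult_ac)
      finally show ?thesis by (simp add: cS)
    qed
    have gle: "(\<integral>\<^sup>+ y. g (V - S) y \<partial>PiM (V - S) (\<lambda>_. M)) \<le> ennreal (fact (card V - card S)) * tree_coeff (card V - card S) x"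
      if S: "S \<subseteq> V" "v \<in> S" for S
    proof -
      have c: "card (V - S) = card V - card S"
        by (rule card_Diff_subset) (use S less.prems finite_subset in auto)
      have "card (V - S) < card V" by (rule psubset_card_mono) (use S v less.prems in auto)
      from less.hyps[OF this, of r x] less.prems show ?thesis
        by (simp add: c rooted_integral_def g_def)
    qed
    define h where "h n = of_nat n * (ennreal (fact (n - 1)) * branch (n - 1) x) *
        (ennreal (fact (card V - n)) * tree_coeff (card V - n) x)" for n
    have "rooted_integral V r x \<le> (\<integral>\<^sup>+ y. (\<Sum>S | S \<subseteq> V \<and> v \<in> S. \<Sum>j\<in>S. f S j (restrict y S) * g (V - S) (restrict y (V - S))) \<partial>?P)"
      unfolding rooted_integral_def by (intro nn_integral_mono pt)
    also have "\<dots> = (\<Sum>S | S \<subseteq> V \<and> v \<in> S. \<Sum>j\<in>S. \<integral>\<^sup>+ y. f S j (restrict y S) * g (V - S) (restrict y (V - S)) \<partial>?P)"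
    proof -
      have m: "(\<lambda>y. f S j (restrict y S) * g (V - S) (restrict y (V - S))) \<in> borel_measurable ?P"
        if "S \<subseteq> V" "j \<in> S" for S j
        by (intro borel_measurable_times_ennreal measurable_compose[OF measurable_restrict_subset f_meas]
           measurable_compose[OF measurable_restrict_subset g_meas]) (use that in auto)
      show ?thesis
        by (subst nn_integral_sum, force intro!: borel_measurable_sum m, intro sum.cong refl,
            subst nn_integral_sum) (auto intro: m)
    qed
    also have "\<dots> = (\<Sum>S | S \<subseteq> V \<and> v \<in> S. \<Sum>j\<in>S. (\<integral>\<^sup>+ y. f S j y \<partial>PiM S (\<lambda>_. M)) * (\<integral>\<^sup>+ y. g (V - S) y \<partial>PiM (V - S) (\<lambda>_. M)))"
    proof (intro sum.cong refl)
      fix S j assume S: "S \<in> {S. S \<subseteq> V \<and> v \<in> S}" "j \<in> S"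
      hence SV: "S \<union> (V - S) = V" by auto
      show "(\<integral>\<^sup>+ y. f S j (restrict y S) * g (V - S) (restrict y (V - S)) \<partial>?P)
         = (\<integral>\<^sup>+ y. f S j y \<partial>PiM S (\<lambda>_. M)) * (\<integral>\<^sup>+ y. g (V - S) y \<partial>PiM (V - S) (\<lambda>_. M))"
        using prodM.nn_integral_PiM_split[of S "V - S" "f S j" "g (V - S)"] S less.prems f_meas g_meas
        unfolding SV by (auto dest: finite_subset)
    qed
    also have "\<dots> \<le> (\<Sum>S | S \<subseteq> V \<and> v \<in> S. \<Sum>j\<in>S. (ennreal (fact (card S - 1)) * branch (card S - 1) x) *
        (ennreal (fact (card V - card S)) * tree_coeff (card V - card S) x))"
      by (intro sum_mono mult_mono fle gle) auto
    also have "\<dots> = (\<Sum>S | S \<subseteq> V \<and> v \<in> S. h (card S))"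
      by (simp add: h_def mult.assoc)
    also have "\<dots> = (\<Sum>m<card V. of_nat ((card V - 1) choose m) * h (Suc m))"
      by (rule sum_rooted_subsets_by_card) (use less.prems v in auto)
    also have "\<dots> = (\<Sum>m\<le>k. ennreal (fact k) * (of_nat (Suc m) * branch m x * tree_coeff (k - m) x))"
    proof (intro sum.cong)
      fix m assume "m \<in> {..k}"
      \<comment> \<open>The factorials of the branch and of the remainder absorb the binomial
        coefficient, so that \<open>tree_coeff\<close> needs no combinatorial factor except
        \<open>Suc m\<close>.\<close>
      hence "(of_nat (k choose m) :: ennreal) * ennreal (fact m) * ennreal (fact (k - m)) = ennreal (fact k)"
        using binomial_fact_lemma[of m k]
        by (metis (no_types, lifting) atMost_iff ennreal_of_nat_eq_real_of_nat mult.assoc mult.commute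
            of_nat_fact of_nat_mult)
      moreover have "c * (n * (p * b) * (q * t)) = (c * p * q) * (n * b * t)" for c n p b q t :: ennreal
        by (simp add: mult_ac)
      ultimately show "of_nat ((card V - 1) choose m) * h (Suc m) = ennreal (fact k) * (of_nat (Suc m) * branch m x * tree_coeff (k - m) x)"
        unfolding h_def k by simp
    qed (use k in auto)
    also have "\<dots> = ennreal (fact k) * (of_nat (Suc k) * tree_coeff (Suc k) x)"
      unfolding tree_coeff_Suc by (simp add: sum_distrib_left)
    also have "\<dots> = ennreal (fact (card V)) * tree_coeff (card V) x"
      unfolding k fact_Suc
      by (simp add: ennreal_mult mult_ac ennreal_of_nat_eq_real_of_nat del: of_nat_Suc)
    finally show ?thesis .
  qed
qed

text \<open>A bootstrap in \<open>N\<close>: if the partial sums up to \<open>N\<close> are bounded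
  by \<open>exp a\<close>, the branches up to \<open>N\<close> sum to at most \<open>a x\<close> by
  the integral condition, and exponentiating them bounds the partial sums up to \<open>N + 1\<close>
  by \<open>exp (a x)\<close>.\<close>

lemma sum_tree_coeff_le:
  fixes a :: "'a \<Rightarrow> real"
  assumes a: "\<And>x. 0 \<le> a x" and [measurable]: "a \<in> borel_measurable M"
    and int: "AE x in M. (\<integral>\<^sup>+ y. ennreal (w x y * \<beta> y * exp (a y)) \<partial>M) \<le> ennreal (a x)"
  shows "AE x in M. (\<Sum>n\<le>N. tree_coeff n x) \<le> ennreal (exp (a x))"
proof (induction N)
  case 0
  have "ennreal 1 \<le> ennreal (exp (a x))" for x by (rule ennreal_leI) (use a in simp)
  then show ?case by simp
next
  case (Suc N)
  have "AE x in M. x \<in> space M" by simp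
  with int show ?case
  proof eventually_elim
    case (elim x)
    have wx [measurable]: "w x \<in> borel_measurable M"
    proof -
      have "(\<lambda>y. (x, y)) \<in> M \<rightarrow>\<^sub>M M \<Otimes>\<^sub>M M" using elim by simp
      from measurable_compose[OF this w_meas] show ?thesis by simp
    qed
    have "(\<Sum>m\<le>N. branch m x) = (\<integral>\<^sup>+ y. ennreal (w x y * \<beta> y) * (\<Sum>m\<le>N. tree_coeff m y) \<partial>M)"
      unfolding branch_def sum_distrib_left by (subst nn_integral_sum) auto
    \<comment> \<open>The induction hypothesis holds for almost all points only, which suffices
      under the integral.\<close>
    also have "\<dots> \<le> (\<integral>\<^sup>+ y. ennreal (w x y * \<beta> y * exp (a y)) \<partial>M)"
    proof (rule nn_integral_mono_AE)
      show "AE y in M. ennreal (w x y * \<beta> y) * (\<Sum>m\<le>N. tree_coeff m y) \<le> ennreal (w x y * \<beta> y * exp (a y))"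
        using Suc by eventually_elim
          (auto simp: ennreal_mult w_nonneg \<beta>_nonneg intro!: mult_left_mono)
    qed
    also have "\<dots> \<le> ennreal (a x)" using elim by simp
    finally have br: "(\<Sum>m\<le>N. branch m x) \<le> ennreal (a x)" .
    have br_fin: "branch m x < \<infinity>" if "m \<le> N" for m
    proof -
      have "branch m x \<le> (\<Sum>m\<le>N. branch m x)" using that by (intro member_le_sum) auto
      also note br
      also have "ennreal (a x) < \<infinity>" by simp
      finally show ?thesis .
    qed
    have t_fin: "tree_coeff n x < \<infinity>" if "n \<le> Suc N" for n
      using that
    proof (induction n rule: less_induct)
      case (less n)
      show ?case
      proof (cases n)
        case (Suc k)
        have "(\<Sum>m\<le>k. of_nat (Suc m) * branch m x * tree_coeff (k - m) x) < \<infinity>"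
          using less br_fin Suc by (auto simp: ennreal_mult_less_top of_nat_less_top simp del: of_nat_Suc)
        hence "of_nat (Suc k) * tree_coeff (Suc k) x < \<infinity>" unfolding tree_coeff_Suc .
        thus ?thesis unfolding Suc
          by (auto simp: ennreal_mult_less_top simp del: of_nat_Suc)
      qed simp
    qed
    \<comment> \<open>The cut at \<open>N\<close> is where finiteness of the branches is known at
      this stage; the recursion up to \<open>Suc N\<close> refers to no later branch.\<close>
    define s where "s m = (if m \<le> N then enn2real (branch m x) else 0)" for m
    define t where "t n = enn2real (tree_coeff n x)" for n
    have s0: "0 \<le> s m" and t0: "0 \<le> t m" for m by (simp_all add: s_def t_def)
    have se: "ennreal (s m) = branch m x" if "m \<le> N" for m
      using br_fin[OF that] that by (simp add: s_def)
    have te: "ennreal (t n) = tree_coeff n x" if "n \<le> Suc N" for n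
      using t_fin[OF that] by (simp add: t_def)
    have "(\<Sum>n\<le>Suc N. t n) \<le> exp (\<Sum>m<Suc N. s m)"
    proof (rule exp_recursion_bound)
      fix n assume n: "n < Suc N"
      have "ennreal (of_nat (Suc n) * t (Suc n)) = of_nat (Suc n) * tree_coeff (Suc n) x"
        using te[of "Suc n"] n by (simp add: ennreal_mult ennreal_of_nat_eq_real_of_nat t_def del: of_nat_Suc)
      also have "\<dots> = (\<Sum>m\<le>n. ennreal (of_nat (Suc m) * s m * t (n - m)))"
        unfolding tree_coeff_Suc
        using n by (intro sum.cong refl)
          (simp add: se[symmetric] te[symmetric] ennreal_mult s0 t0 ennreal_of_nat_eq_real_of_nat del: of_nat_Suc)
      also have "\<dots> = ennreal (\<Sum>m\<le>n. of_nat (Suc m) * s m * t (n - m))"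
        by (rule sum_ennreal) (simp add: s_def t_def)
      finally show "of_nat (Suc n) * t (Suc n) \<le> (\<Sum>m\<le>n. of_nat (Suc m) * s m * t (n - m))"
        by (subst (asm) ennreal_inj) (auto intro!: sum_nonneg simp: s_def t_def)
    qed (auto simp: s_def t_def)
    also have "(\<Sum>m<Suc N. s m) \<le> a x"
    proof -
      have "ennreal (\<Sum>m\<le>N. s m) = (\<Sum>m\<le>N. branch m x)"
        by (subst sum_ennreal[symmetric]) (auto simp: se s0)
      hence "ennreal (\<Sum>m\<le>N. s m) \<le> ennreal (a x)" using br by simp
      thus ?thesis using a[of x] by (simp add: lessThan_Suc_atMost)
    qed
    finally have "(\<Sum>n\<le>Suc N. t n) \<le> exp (a x)" by simp
    hence "ennreal (\<Sum>n\<le>Suc N. t n) \<le> ennreal (exp (a x))" by (rule ennreal_leI)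
    also have "ennreal (\<Sum>n\<le>Suc N. t n) = (\<Sum>n\<le>Suc N. ennreal (t n))"
      by (rule sum_ennreal[symmetric]) (simp add: t_def)
    also have "\<dots> = (\<Sum>n\<le>Suc N. tree_coeff n x)"
      by (rule sum.cong) (auto simp: te)
    finally show ?case .
  qed
qed

end

section \<open>Graphs on list positions\<close>

lemma adj_rtrancl_image:
  assumes "(i, j) \<in> (adj G)\<^sup>*"
  shows "(g i, g j) \<in> (adj (image g ` G))\<^sup>*"
  using assms
proof (induction rule: rtrancl_induct)
  case (step y z)
  have "{g y, g z} = g ` {y, z}" by simp
  hence "(g y, g z) \<in> adj (image g ` G)" using step(2) by blast
  with step.IH show ?case by (rule rtrancl_into_rtrancl)
qed simp

lemma conn_on_image: "conn_on V G \<Longrightarrow> conn_on (g ` V) (image g ` G)"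
  unfolding conn_on_def by (auto intro!: adj_rtrancl_image[of _ _ G g])

lemma pair_edges_image: "inj_on g V \<Longrightarrow> image g ` pair_edges V = pair_edges (g ` V)"
proof (intro equalityI subsetI)
  fix e assume inj: "inj_on g V" and "e \<in> image g ` pair_edges V"
  then obtain i j where ij: "i \<in> V" "j \<in> V" "i \<noteq> j" "e = {g i, g j}" by (auto simp: pair_edges_def)
  hence "g i \<noteq> g j" using inj_on_eq_iff[OF inj] by simp
  thus "e \<in> pair_edges (g ` V)" unfolding ij(4) doubleton_in_pair_edges using ij by simp
next
  fix e assume "e \<in> pair_edges (g ` V)"
  then obtain i j where ij: "i \<in> V" "j \<in> V" "g i \<noteq> g j" "e = g ` {i, j}" by (auto simp: pair_edges_def)
  hence "{i, j} \<in> pair_edges V" by auto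
  thus "e \<in> image g ` pair_edges V" unfolding ij(4) by (rule imageI)
qed

lemma inj_on_image_pair_edges:
  assumes "inj_on g V"
  shows "inj_on (image g) (pair_edges V)"
  by (rule inj_on_subset[OF inj_on_image_Pow[OF assms] pair_edges_subset_Pow])

lemma image_inv_into_pair_edge:
  assumes "inj_on g V" "e \<in> pair_edges V"
  shows "inv_into V g ` (g ` e) = e"
  using assms pair_edges_subset_Pow[of V] by (simp add: inv_into_image_cancel subset_iff)

text \<open>The Ursell function uses graphs on list positions, the estimates use graphs on the
  labels of the variables; relabelling along an injection connects the two.\<close>

lemma conn_sum_image:
  assumes inj: "inj_on g V"
  shows "conn_sum \<omega> UNIV (g ` V) = conn_sum (\<lambda>e. \<omega> (g ` e)) UNIV V"
  unfolding conn_sum_def Int_UNIV_left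
proof (rule sum.reindex_bij_witness[of _ "\<lambda>G. image g ` G" "\<lambda>G. image (inv_into V g) ` G"])
  let ?g = "inv_into V g"
  have inj': "inj_on ?g (g ` V)" by (rule inj_on_inv_into) simp
  have VV: "?g ` (g ` V) = V" using inj by (simp add: inv_into_image_cancel)
  fix G assume "G \<in> {G. G \<subseteq> pair_edges (g ` V) \<and> conn_on (g ` V) G}"
  hence G: "G \<subseteq> pair_edges (g ` V)" "conn_on (g ` V) G" by auto
  have id: "g ` (?g ` e) = e" if "e \<in> pair_edges (g ` V)" for e
  proof -
    have "e \<subseteq> g ` V" using that pair_edges_subset_Pow by blast
    thus ?thesis by (rule image_inv_into_cancel[OF refl])
  qed
  show 1: "image g ` (image ?g ` G) = G"
  proof -
    have "image g ` image ?g ` G = (\<lambda>e. g ` (?g ` e)) ` G" by (simp only: image_image)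
    also have "\<dots> = (\<lambda>e. e) ` G" by (rule image_cong) (use id G(1) in auto)
    finally show ?thesis by simp
  qed
  show "image ?g ` G \<in> {G. G \<subseteq> pair_edges V \<and> conn_on V G}"
    using conn_on_image[OF G(2), of ?g] image_mono[OF G(1), of "image ?g"]
    unfolding pair_edges_image[OF inj'] VV by simp
  have inj2: "inj_on (image ?g) G"
    by (rule inj_on_subset[OF inj_on_image_pair_edges[OF inj'] G(1)])
  show "(\<Prod>e\<in>image ?g ` G. \<omega> (g ` e)) = prod \<omega> G"
    unfolding prod.reindex[OF inj2] o_def by (rule prod.cong) (use id G(1) in auto)
next
  let ?g = "inv_into V g"
  fix G assume "G \<in> {G. G \<subseteq> pair_edges V \<and> conn_on V G}"
  hence G: "G \<subseteq> pair_edges V" "conn_on V G" by auto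
  have "image ?g ` image g ` G = (\<lambda>e. ?g ` (g ` e)) ` G" by (simp only: image_image)
  also have "\<dots> = (\<lambda>e. e) ` G"
    by (rule image_cong) (use image_inv_into_pair_edge[OF inj] G(1) in auto)
  finally show "image ?g ` (image g ` G) = G" by simp
  show "image g ` G \<in> {G. G \<subseteq> pair_edges (g ` V) \<and> conn_on (g ` V) G}"
    using conn_on_image[OF G(2), of g] image_mono[OF G(1), of "image g"]
    unfolding pair_edges_image[OF inj] by simp
qed

lemma bij_betw_ordered_pairs:
  "bij_betw (\<lambda>(i, j). {i, j}) {(i, j). i < j \<and> j < n} (pair_edges {..<n :: nat})"
proof (rule bij_betwI')
  fix e assume "e \<in> pair_edges {..<n}"
  then obtain i j where ij: "i < n" "j < n" "i \<noteq> j" "e = {i, j}" by (auto simp: pair_edges_def)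
  show "\<exists>p\<in>{(i, j). i < j \<and> j < n}. e = (\<lambda>(i, j). {i, j}) p"
  proof (cases "i < j")
    case True
    then show ?thesis using ij by (intro bexI[of _ "(i, j)"]) auto
  next
    case False
    then show ?thesis using ij by (intro bexI[of _ "(j, i)"]) auto
  qed
qed (auto simp: doubleton_eq_iff)

lemma edges_on_eq_pair_edges: "edges_on n = pair_edges {..<n}"
proof -
  have "edges_on n = (\<lambda>(i, j). {i, j}) ` {(i, j). i < j \<and> j < n}"
    unfolding edges_on_def by force
  thus ?thesis using bij_betw_imp_surj_on[OF bij_betw_ordered_pairs[of n]] by simp
qed

lemma set_conv_nth_image: "set vs = (!) vs ` {..<length vs}"
  by (auto simp: set_conv_nth)

context
  fixes z :: "'a \<Rightarrow> 'a \<Rightarrow> complex" and x :: "nat \<Rightarrow> 'a" and vs :: "nat list"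
  assumes z_sym: "\<And>x y. z x y = z y x" and vs: "distinct vs"
begin

lemma inj_on_nth_distinct: "inj_on ((!) vs) {..<length vs}"
  using vs by (auto simp: inj_on_def nth_eq_iff_index_eq)

lemma prod_pairs_map:
  assumes "G \<subseteq> pair_edges {..<length vs}"
  shows "(\<Prod>(i, j) | i < j \<and> j < length vs \<and> {i, j} \<in> G. f (z (x (vs ! i)) (x (vs ! j))))
    = (\<Prod>e\<in>G. f (edge_val z x ((!) vs ` e)))"
proof -
  let ?A = "{(i, j). i < j \<and> j < length vs \<and> {i, j} \<in> G}"
  have "bij_betw (\<lambda>(i, j). {i, j}) ?A G"
  proof -
    have "?A \<subseteq> {(i, j). i < j \<and> j < length vs}" by auto
    moreover have "(\<lambda>(i, j). {i, j}) ` ?A = G"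
    proof (intro equalityI subsetI)
      fix e assume e: "e \<in> G"
      hence "e \<in> (\<lambda>(i, j). {i, j}) ` {(i, j). i < j \<and> j < length vs}"
        using bij_betw_imp_surj_on[OF bij_betw_ordered_pairs[of "length vs"]] assms by blast
      then obtain i j where "i < j" "j < length vs" "e = {i, j}" by auto
      thus "e \<in> (\<lambda>(i, j). {i, j}) ` ?A" using e by (intro image_eqI[of _ _ "(i, j)"]) auto
    qed auto
    ultimately show ?thesis by (rule bij_betw_subset[OF bij_betw_ordered_pairs])
  qed
  from prod.reindex_bij_betw[OF this, of "\<lambda>e. f (edge_val z x ((!) vs ` e))"]
  show ?thesis by (simp add: edge_val_doubleton[OF z_sym] split_def)
qed

lemma pairprod_map: "pairprod z (map x vs) = graph_prod (edge_val z x) UNIV (set vs)"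
proof -
  have "pairprod z (map x vs) = (\<Prod>(i, j) | i < j \<and> j < length vs. 1 + z (x (vs ! i)) (x (vs ! j)))"
    unfolding pairprod_def by (rule prod.cong) auto
  also have "{(i, j). i < j \<and> j < length vs} = {(i, j). i < j \<and> j < length vs \<and> {i, j} \<in> pair_edges {..<length vs}}"
    by auto
  also have "(\<Prod>(i, j)\<in>\<dots>. 1 + z (x (vs ! i)) (x (vs ! j))) = (\<Prod>e\<in>pair_edges {..<length vs}. 1 + edge_val z x ((!) vs ` e))"
    by (rule prod_pairs_map) simp
  also have "\<dots> = (\<Prod>e\<in>image ((!) vs) ` pair_edges {..<length vs}. 1 + edge_val z x e)"
    by (simp add: prod.reindex[OF inj_on_image_pair_edges[OF inj_on_nth_distinct]])
  finally show ?thesis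
    unfolding pair_edges_image[OF inj_on_nth_distinct] graph_prod_def set_conv_nth_image[of vs] by simp
qed

lemma ursell_map:
  assumes "vs \<noteq> []"
  shows "ursell z (map x vs) = conn_sum (edge_val z x) UNIV (set vs) / fact (length vs)"
proof (cases "length vs = 1")
  case True
  then obtain v where "vs = [v]" by (auto simp: length_Suc_conv)
  moreover have "{G. G \<subseteq> pair_edges {v} \<and> conn_on {v} G} = {{}}" for v :: nat
    by (auto simp: conn_on_def)
  ultimately show ?thesis by (simp add: ursell_def conn_sum_def)
next
  case False
  let ?n = "length vs"
  have cg: "connected_graphs ?n = {G. G \<subseteq> pair_edges {..<?n} \<and> conn_on {..<?n} G}"
    by (auto simp: connected_graphs_def edges_on_eq_pair_edges graph_connected_def conn_on_def)
  have "ursell z (map x vs) = (\<Sum>G\<in>connected_graphs ?n.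
      \<Prod>(i, j) | i < j \<and> j < ?n \<and> {i, j} \<in> G. z (x (vs ! i)) (x (vs ! j))) / fact ?n"
    using False unfolding ursell_def by (auto intro!: sum.cong prod.cong)
  also have "\<dots> = (\<Sum>G\<in>connected_graphs ?n. \<Prod>e\<in>G. edge_val z x ((!) vs ` e)) / fact ?n"
    using prod_pairs_map[where f="\<lambda>u. u"] cg by (intro arg_cong2[where f="(/)"] sum.cong) auto
  also have "\<dots> = conn_sum (edge_val z x) UNIV ((!) vs ` {..<?n}) / fact ?n"
    unfolding conn_sum_image[OF inj_on_nth_distinct] by (simp add: conn_sum_def cg)
  finally show ?thesis by (simp add: set_conv_nth_image[symmetric])
qed

end

section \<open>A crude bound on connected sums for a fixed number of points\<close>

lemma conn_sum_root:
  assumes "finite V" "r \<in> V"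
  shows "conn_sum \<omega> E V = graph_prod \<omega> E V - (\<Sum>S | S \<subset> V \<and> r \<in> S. conn_sum \<omega> E S * graph_prod \<omega> E (V - S))"
proof -
  have "finite {S. S \<subseteq> V \<and> r \<in> S}" using assms by auto
  moreover have "{S. S \<subset> V \<and> r \<in> S} = {S. S \<subseteq> V \<and> r \<in> S} - {V}" by auto
  ultimately show ?thesis
    using assms graph_prod_root[OF assms, of \<omega> E]
      sum.remove[of "{S. S \<subseteq> V \<and> r \<in> S}" V "\<lambda>S. conn_sum \<omega> E S * graph_prod \<omega> E (V - S)"]
    by (simp add: graph_prod_def[of \<omega> E "{}"])
qed

text \<open>All subsets are included because the root decomposition uses stability on complements of
  components, at every level of its recursion.\<close>

definition stable :: "('v set \<Rightarrow> complex) \<Rightarrow> ('v \<Rightarrow> real) \<Rightarrow> 'v set \<Rightarrow> bool" where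
  "stable \<omega> \<beta> V \<longleftrightarrow> (\<forall>S\<subseteq>V. norm (graph_prod \<omega> UNIV S) \<le> (\<Prod>v\<in>S. \<beta> v))"

text \<open>The recursion solves the root decomposition for the connected sum, with
  \<open>2 ^ Suc n\<close> bounding the number of proper components. The growth in \<open>n\<close>
  is harmless: the bound serves for integrability with a fixed number of points.\<close>

primrec crude :: "nat \<Rightarrow> real" where
  "crude 0 = 1"
| "crude (Suc n) = 1 + 2 ^ Suc n * crude n"

lemma crude_ge_1: "1 \<le> crude n"
  by (induction n) (simp_all del: power_Suc)

lemma crude_mono: "m \<le> n \<Longrightarrow> crude m \<le> crude n"
proof (rule lift_Suc_mono_le[of crude])
  fix n
  have "1 * crude n \<le> 2 ^ Suc n * crude n"
    by (intro mult_right_mono one_le_power order_trans[OF _ crude_ge_1]) auto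
  thus "crude n \<le> crude (Suc n)" by simp
qed

lemma norm_conn_sum_crude:
  assumes "finite V" "V \<noteq> {}" "stable \<omega> \<beta> V" "\<And>v. 0 \<le> \<beta> v"
  shows "norm (conn_sum \<omega> UNIV V) \<le> crude (card V) * (\<Prod>v\<in>V. \<beta> v)"
  using assms(1-3)
proof (induction "card V" arbitrary: V rule: less_induct)
  case less
  obtain r where r: "r \<in> V" using less.prems by auto
  obtain n where n: "card V = Suc n" using less.prems by (cases "card V") auto
  let ?B = "\<lambda>S. \<Prod>v\<in>S. \<beta> v"
  have B0: "0 \<le> ?B S" for S by (intro prod_nonneg) (use assms(4) in auto)
  let ?Sr = "{S. S \<subset> V \<and> r \<in> S}"
  have st: "norm (graph_prod \<omega> UNIV S) \<le> ?B S" if "S \<subseteq> V" for S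
    using less.prems that by (auto simp: stable_def)
  have cr0: "0 \<le> crude k" for k using crude_ge_1[of k] by simp
  have "norm (\<Sum>S\<in>?Sr. conn_sum \<omega> UNIV S * graph_prod \<omega> UNIV (V - S)) \<le> (\<Sum>S\<in>?Sr. crude n * ?B V)"
  proof (rule sum_norm_le)
    fix S assume S: "S \<in> ?Sr"
    hence cS: "card S < card V" using less.prems by (auto intro: psubset_card_mono)
    have finS: "finite S" using S finite_subset[OF _ less.prems(1)] by auto
    have "norm (conn_sum \<omega> UNIV S * graph_prod \<omega> UNIV (V - S)) \<le> (crude (card S) * ?B S) * ?B (V - S)"
      unfolding norm_mult
      by (intro mult_mono less.hyps st cS finS mult_nonneg_nonneg cr0 B0)
         (use S less.prems in \<open>auto simp: stable_def\<close>)
    also have "\<dots> = crude (card S) * ?B V"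
      using prod.subset_diff[of S V \<beta>] S less.prems by (simp add: mult_ac psubset_imp_subset)
    also have "\<dots> \<le> crude n * ?B V"
      by (intro mult_right_mono B0 crude_mono) (use cS n in auto)
    finally show "norm (conn_sum \<omega> UNIV S * graph_prod \<omega> UNIV (V - S)) \<le> crude n * ?B V" .
  qed
  also have "\<dots> = real (card ?Sr) * (crude n * ?B V)" by simp
  also have "\<dots> \<le> 2 ^ card V * (crude n * ?B V)"
  proof (rule mult_right_mono)
    have "card ?Sr \<le> card (Pow V)" by (rule card_mono) (use less.prems in auto)
    thus "real (card ?Sr) \<le> 2 ^ card V" using less.prems by (simp add: card_Pow flip: of_nat_le_iff)
  qed (intro mult_nonneg_nonneg cr0 B0)
  finally have "norm (conn_sum \<omega> UNIV V) \<le> ?B V + 2 ^ card V * (crude n * ?B V)"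
    unfolding conn_sum_root[OF less.prems(1) r, of \<omega> UNIV]
    by (intro order_trans[OF norm_triangle_ineq4] add_mono st) auto
  also have "\<dots> = crude (card V) * ?B V" by (simp add: n algebra_simps)
  finally show ?case .
qed

section \<open>Iterated integrals and product measures\<close>

lemma (in product_sigma_finite) distr_insert:
  assumes fin: "finite I" and i: "i \<notin> I"
  shows "distr (M i \<Otimes>\<^sub>M PiM I M) (PiM (insert i I) M) (\<lambda>p. (snd p)(i := fst p)) = PiM (insert i I) M"
proof (rule PiM_eqI)
  interpret I: finite_product_sigma_finite M I by standard fact
  fix A assume A: "\<And>j. j \<in> insert i I \<Longrightarrow> A j \<in> sets (M j)"
  have m: "(\<lambda>p. (snd p)(i := fst p)) \<in> M i \<Otimes>\<^sub>M PiM I M \<rightarrow>\<^sub>M PiM (insert i I) M"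
    by (rule measurable_fun_upd[where J=I]) auto
  have *: "(\<lambda>p. (snd p)(i := fst p)) -` Pi\<^sub>E (insert i I) A \<inter> space (M i \<Otimes>\<^sub>M PiM I M) = A i \<times> Pi\<^sub>E I A"
    using A[THEN sets.sets_into_space] i
    by (auto simp: space_pair_measure space_PiM PiE_iff extensional_def split: if_splits)
  show "emeasure (distr (M i \<Otimes>\<^sub>M PiM I M) (PiM (insert i I) M) (\<lambda>p. (snd p)(i := fst p))) (Pi\<^sub>E (insert i I) A)
      = (\<Prod>j\<in>insert i I. emeasure (M j) (A j))"
    using A fin i by (subst emeasure_distr[OF m])
      (auto simp: * I.emeasure_pair_measure_Times I.measure_times intro!: sets_PiM_I_finite)
qed (use fin in simp_all)

text \<open>Separates two roots from the remaining points, so that Fubini can treat the pair of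
  roots as the outer variable.\<close>

lemma (in product_sigma_finite) distr_insert2:
  assumes fin: "finite I" and i: "i \<notin> I" and j: "j \<notin> I" "i \<noteq> j"
  shows "distr ((M i \<Otimes>\<^sub>M M j) \<Otimes>\<^sub>M PiM I M) (PiM (insert i (insert j I)) M)
    (\<lambda>p. (snd p)(j := snd (fst p), i := fst (fst p))) = PiM (insert i (insert j I)) M"
proof (rule PiM_eqI)
  interpret I: finite_product_sigma_finite M I by standard fact
  let ?f = "\<lambda>p. (snd p)(j := snd (fst p), i := fst (fst p))"
  fix A assume A: "\<And>k. k \<in> insert i (insert j I) \<Longrightarrow> A k \<in> sets (M k)"
  have m: "?f \<in> (M i \<Otimes>\<^sub>M M j) \<Otimes>\<^sub>M PiM I M \<rightarrow>\<^sub>M PiM (insert i (insert j I)) M"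
    by (rule measurable_fun_upd[where J="insert j I"], simp, rule measurable_fun_upd[where J=I]) auto
  have *: "?f -` Pi\<^sub>E (insert i (insert j I)) A \<inter> space ((M i \<Otimes>\<^sub>M M j) \<Otimes>\<^sub>M PiM I M) = (A i \<times> A j) \<times> Pi\<^sub>E I A"
  proof -
    have sub: "A k \<subseteq> space (M k)" if "k \<in> insert i (insert j I)" for k
      using A[OF that] by (rule sets.sets_into_space)
    have "y(j := b, i := a) \<in> Pi\<^sub>E (insert i (insert j I)) A \<longleftrightarrow> a \<in> A i \<and> b \<in> A j \<and> y \<in> Pi\<^sub>E I A"
      if "y \<in> Pi\<^sub>E I (\<lambda>i. space (M i))" for a b y
      using that i j by (auto simp: PiE_iff extensional_def split: if_splits)
    moreover have "Pi\<^sub>E I A \<subseteq> Pi\<^sub>E I (\<lambda>i. space (M i))" by (rule PiE_mono) (use sub in auto)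
    ultimately show ?thesis
      using sub[of i] sub[of j] by (auto simp: space_pair_measure space_PiM)
  qed
  show "emeasure (distr ((M i \<Otimes>\<^sub>M M j) \<Otimes>\<^sub>M PiM I M) (PiM (insert i (insert j I)) M) ?f) (Pi\<^sub>E (insert i (insert j I)) A)
      = (\<Prod>k\<in>insert i (insert j I). emeasure (M k) (A k))"
    using A fin i j by (subst emeasure_distr[OF m])
      (auto simp: * I.emeasure_pair_measure_Times M.emeasure_pair_measure_Times I.measure_times mult.assoc
        intro!: sets_PiM_I_finite)
qed (use fin in simp_all)

lemma (in product_sigma_finite) integral_PiM_split:
  fixes f g :: "('i \<Rightarrow> 'a) \<Rightarrow> complex"
  assumes fin: "finite I" "finite J" and IJ: "I \<inter> J = {}"
    and int: "integrable (PiM (I \<union> J) M) (\<lambda>x. f (restrict x I) * g (restrict x J))"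
  shows "(LINT x|PiM (I \<union> J) M. f (restrict x I) * g (restrict x J)) = (LINT x|PiM I M. f x) * (LINT x|PiM J M. g x)"
proof -
  have "(LINT x|PiM (I \<union> J) M. f (restrict x I) * g (restrict x J)) = (LINT x|PiM I M. LINT y|PiM J M. f x * g y)"
    unfolding product_integral_fold[OF IJ fin int]
    using IJ by (intro Bochner_Integration.integral_cong refl) (auto simp: restrict_merge space_PiM)
  thus ?thesis by simp
qed

text \<open>Up to rearranging coordinates, \<open>PiM V M\<close> is the product of
  \<open>PiM S M\<close> with the measure of the remaining points. Stability of a subset of the
  points is carried to all of them in this way.\<close>

lemma (in product_sigma_finite) AE_PiM_restrict:
  assumes fin: "finite V" and S: "S \<subseteq> V"
    and meas: "{x \<in> space (PiM S M). Q x} \<in> sets (PiM S M)" and ae: "AE x in PiM S M. Q x"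
  shows "AE x in PiM V M. Q (restrict x S)"
proof -
  let ?J = "V - S"
  have finS: "finite S" "finite ?J" using finite_subset[OF S fin] fin by auto
  have V: "S \<union> ?J = V" using S by auto
  have dis: "S \<inter> ?J = {}" by auto
  interpret I: finite_product_sigma_finite M S by standard fact
  interpret J: finite_product_sigma_finite M ?J by standard fact
  interpret P: pair_sigma_finite "PiM S M" "PiM ?J M" ..
  have mr: "(\<lambda>x. restrict x S) \<in> PiM V M \<rightarrow>\<^sub>M PiM S M" by (rule measurable_restrict_subset[OF S])
  have m2: "{x \<in> space (PiM V M). Q (restrict x S)} \<in> sets (PiM V M)"
  proof -
    have "{x \<in> space (PiM V M). Q (restrict x S)} = (\<lambda>x. restrict x S) -` {x \<in> space (PiM S M). Q x} \<inter> space (PiM V M)"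
      using measurable_space[OF mr] by auto
    thus ?thesis using measurable_sets[OF mr meas] by simp
  qed
  have mm: "merge S ?J \<in> PiM S M \<Otimes>\<^sub>M PiM ?J M \<rightarrow>\<^sub>M PiM V M"
    using measurable_merge[of S ?J M] unfolding V .
  have m3: "{p \<in> space (PiM S M \<Otimes>\<^sub>M PiM ?J M). Q (restrict (merge S ?J p) S)} \<in> sets (PiM S M \<Otimes>\<^sub>M PiM ?J M)"
  proof -
    have "{p \<in> space (PiM S M \<Otimes>\<^sub>M PiM ?J M). Q (restrict (merge S ?J p) S)}
        = merge S ?J -` {x \<in> space (PiM V M). Q (restrict x S)} \<inter> space (PiM S M \<Otimes>\<^sub>M PiM ?J M)"
      using measurable_space[OF mm] by auto
    thus ?thesis using measurable_sets[OF mm m2] by simp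
  qed
  have "AE p in PiM S M \<Otimes>\<^sub>M PiM ?J M. Q (restrict (merge S ?J p) S)"
  proof (rule P.AE_pair_measure[OF m3])
    have "AE x in PiM S M. x \<in> space (PiM S M)" by simp
    with ae show "AE x in PiM S M. AE y in PiM ?J M. Q (restrict (merge S ?J (x, y)) S)"
      by eventually_elim (simp add: restrict_merge space_PiM)
  qed
  hence "AE x in distr (PiM S M \<Otimes>\<^sub>M PiM ?J M) (PiM V M) (merge S ?J). Q (restrict x S)"
    by (subst AE_distr_iff[OF mm m2])
  thus ?thesis by (simp only: distr_merge[OF dis finS, unfolded V])
qed

text \<open>Stability is assumed for points numbered \<open>0, ..., n - 1\<close>; this carries it
  to points labelled by any list of distinct indices.\<close>

lemma distr_PiM_nth:
  assumes "sigma_finite_measure M" "distinct vs"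
  shows "distr (PiM (set vs) (\<lambda>_. M)) (PiM {..<length vs} (\<lambda>_. M)) (\<lambda>x. \<lambda>i\<in>{..<length vs}. x (vs ! i))
    = PiM {..<length vs} (\<lambda>_. M)"
proof -
  interpret product_sigma_finite "\<lambda>_. M" using assms(1) by (simp add: product_sigma_finite_def)
  interpret V: finite_product_sigma_finite "\<lambda>_. M" "set vs" by standard simp
  let ?f = "\<lambda>x. \<lambda>i\<in>{..<length vs}. x (vs ! i)"
  have inj: "inj_on ((!) vs) {..<length vs}" by (rule inj_on_nth[OF assms(2)]) simp
  have m: "?f \<in> PiM (set vs) (\<lambda>_. M) \<rightarrow>\<^sub>M PiM {..<length vs} (\<lambda>_. M)"
    by (rule measurable_restrict) (auto intro: measurable_component_singleton)
  show ?thesis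
  proof (rule PiM_eqI)
    fix A assume A: "\<And>i. i \<in> {..<length vs} \<Longrightarrow> A i \<in> sets M"
    let ?g = "inv_into {..<length vs} ((!) vs)"
    have g: "?g (vs ! i) = i" if "i < length vs" for i using inv_into_f_f[OF inj] that by simp
    have gs: "?g v < length vs" "vs ! ?g v = v" if "v \<in> set vs" for v
      using that inv_into_into[of v "(!) vs" "{..<length vs}"] f_inv_into_f[of v "(!) vs" "{..<length vs}"]
      unfolding set_conv_nth_image[symmetric] by auto
    have "?f -` Pi\<^sub>E {..<length vs} A \<inter> space (PiM (set vs) (\<lambda>_. M)) = (\<Pi>\<^sub>E v\<in>set vs. A (?g v))"
    proof (intro equalityI subsetI)
      fix x assume "x \<in> ?f -` Pi\<^sub>E {..<length vs} A \<inter> space (PiM (set vs) (\<lambda>_. M))"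
      hence x: "\<And>i. i < length vs \<Longrightarrow> x (vs ! i) \<in> A i" "x \<in> extensional (set vs)"
        by (auto simp: space_PiM PiE_iff)
      have "x v \<in> A (?g v)" if "v \<in> set vs" for v using x(1)[OF gs(1)[OF that]] gs(2)[OF that] by simp
      thus "x \<in> (\<Pi>\<^sub>E v\<in>set vs. A (?g v))" using x(2) by (auto simp: PiE_iff)
    next
      fix x assume "x \<in> (\<Pi>\<^sub>E v\<in>set vs. A (?g v))"
      hence x: "\<And>v. v \<in> set vs \<Longrightarrow> x v \<in> A (?g v)" "x \<in> extensional (set vs)"
        by (auto simp: PiE_iff)
      have "x v \<in> space M" if "v \<in> set vs" for v
        using x(1)[OF that] sets.sets_into_space[OF A[of "?g v"]] gs(1)[OF that] by auto
      moreover have "x (vs ! i) \<in> A i" if "i < length vs" for i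
        using x(1)[of "vs ! i"] g[OF that] that by simp
      ultimately show "x \<in> ?f -` Pi\<^sub>E {..<length vs} A \<inter> space (PiM (set vs) (\<lambda>_. M))"
        using x(2) by (auto simp: space_PiM PiE_iff)
    qed
    hence "emeasure (distr (PiM (set vs) (\<lambda>_. M)) (PiM {..<length vs} (\<lambda>_. M)) ?f) (Pi\<^sub>E {..<length vs} A)
        = emeasure (PiM (set vs) (\<lambda>_. M)) (\<Pi>\<^sub>E v\<in>set vs. A (?g v))"
      using A by (subst emeasure_distr[OF m]) (auto intro!: sets_PiM_I_finite)
    also have "\<dots> = (\<Prod>v\<in>set vs. emeasure M (A (?g v)))"
      by (rule V.measure_times) (use A gs in auto)
    also have "\<dots> = (\<Prod>i<length vs. emeasure M (A (?g (vs ! i))))"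
      unfolding set_conv_nth_image[of vs] by (subst prod.reindex[OF inj]) (simp add: set_conv_nth_image[symmetric])
    also have "\<dots> = (\<Prod>i<length vs. emeasure M (A i))"
      by (rule prod.cong) (use g in auto)
    finally show "emeasure (distr (PiM (set vs) (\<lambda>_. M)) (PiM {..<length vs} (\<lambda>_. M)) ?f) (Pi\<^sub>E {..<length vs} A)
        = (\<Prod>i<length vs. emeasure M (A i))" .
  qed simp_all
qed

text \<open>\<open>M\<close> need not be complete, so an inner iterated integral has to be measurable also on the null set
  where the integrand fails to be integrable; it is there because Bochner integrals are total.\<close>

lemma (in sigma_finite_measure) iint_measurable:
  assumes h [measurable]: "h \<in> borel_measurable M" and "distinct (us @ vs)"
    and "(\<lambda>x. F (map x (us @ vs))) \<in> borel_measurable (PiM (set (us @ vs)) (\<lambda>_. M))"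
  shows "(\<lambda>x. iint M h (length vs) (\<lambda>ys. F (map x us @ ys))) \<in> borel_measurable (PiM (set us) (\<lambda>_. M))"
  using assms(2,3)
proof (induction vs arbitrary: us)
  case Nil
  then show ?case by simp
next
  case (Cons v vs)
  let ?N = "PiM (set us) (\<lambda>_. M)" and ?N' = "PiM (set (us @ [v])) (\<lambda>_. M)"
  define G where "G x = iint M h (length vs) (\<lambda>ys. F (map x (us @ [v]) @ ys))" for x
  have G: "G \<in> borel_measurable ?N'"
    unfolding G_def by (rule Cons.IH) (use Cons.prems in auto)
  have u: "(\<lambda>p. (fst p)(v := snd p)) \<in> ?N \<Otimes>\<^sub>M M \<rightarrow>\<^sub>M ?N'"
    by (rule measurable_fun_upd[where J="set us"]) auto
  have [measurable]: "(\<lambda>(x, y). G (x(v := y))) \<in> borel_measurable (?N \<Otimes>\<^sub>M M)"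
    using measurable_compose[OF u G] by (simp add: split_def)
  have eq: "G (x(v := y)) = iint M h (length vs) (\<lambda>ys. F (map x us @ y # ys))" for x y
  proof -
    have "map (x(v := y)) us = map x us" using Cons.prems by (intro map_cong) auto
    thus ?thesis unfolding G_def map_append by (simp only:) simp
  qed
  have "(\<lambda>x. LINT y|M. h y * G (x(v := y))) \<in> borel_measurable ?N"
    by measurable
  thus ?case by (simp add: cint_def eq)
qed

text \<open>This is Fubini, with one complication: slices of an integrable function are integrable
  only for almost all \<open>y\<close>, so the inner integrals agree almost everywhere and both must
  be known to be measurable before the outer integrals can be compared.\<close>

lemma (in sigma_finite_measure) iint_eq_PiM:
  assumes h [measurable]: "h \<in> borel_measurable M" and "distinct vs"
    and "(\<lambda>x. F (map x vs)) \<in> borel_measurable (PiM (set vs) (\<lambda>_. M))"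
    and "integrable (PiM (set vs) (\<lambda>_. M)) (\<lambda>x. (\<Prod>i\<in>set vs. h (x i)) * F (map x vs))"
  shows "iint M h (length vs) F = (LINT x|PiM (set vs) (\<lambda>_. M). (\<Prod>i\<in>set vs. h (x i)) * F (map x vs))"
  using assms(2-)
proof (induction vs arbitrary: F)
  case Nil
  interpret product_sigma_finite "\<lambda>_. M" by (rule product_sigma_finite.intro) unfold_locales
  interpret E: finite_measure "PiM {} (\<lambda>_. M)" by (rule finite_measureI) (simp add: space_PiM)
  show ?case by (simp add: measure_def space_PiM)
next
  case (Cons v vs)
  interpret product_sigma_finite "\<lambda>_. M" by (rule product_sigma_finite.intro) unfold_locales
  interpret I: finite_product_sigma_finite "\<lambda>_. M" "set vs" by standard simp
  let ?N = "PiM (set vs) (\<lambda>_. M)" and ?V = "PiM (insert v (set vs)) (\<lambda>_. M)"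
  interpret P: pair_sigma_finite M ?N ..
  have v: "v \<notin> set vs" "distinct vs" using Cons.prems by auto
  define f where "f x = (\<Prod>i\<in>insert v (set vs). h (x i)) * F (map x (v # vs))" for x
  let ?u = "\<lambda>p. (snd p)(v := fst p)"
  have m: "?u \<in> M \<Otimes>\<^sub>M ?N \<rightarrow>\<^sub>M ?V"
    by (rule measurable_fun_upd[where J="set vs"]) auto
  have D: "distr (M \<Otimes>\<^sub>M ?N) ?V ?u = ?V" by (rule distr_insert) (use v in auto)
  have int: "integrable ?V f" using Cons.prems(3) unfolding f_def list.set .
  have int2: "integrable (M \<Otimes>\<^sub>M ?N) (\<lambda>p. f (?u p))"
    by (rule integrable_distr[OF m]) (simp add: D int)
  have fu: "f (x(v := y)) = h y * ((\<Prod>i\<in>set vs. h (x i)) * F (y # map x vs))" for x y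
  proof -
    have "map (x(v := y)) vs = map x vs" using v by (intro map_cong) auto
    moreover have "(\<Prod>i\<in>set vs. h ((x(v := y)) i)) = (\<Prod>i\<in>set vs. h (x i))"
      using v by (intro prod.cong) auto
    ultimately show ?thesis using v unfolding f_def by (simp add: mult.assoc)
  qed
  have "(LINT x|?V. f x) = (LINT p|(M \<Otimes>\<^sub>M ?N). f (?u p))"
    using integral_distr[OF m, of f] int by (simp add: D)
  also have "\<dots> = (LINT y|M. LINT x|?N. f (x(v := y)))"
    using P.integral_fst'[OF int2] by simp
  also have "\<dots> = (LINT y|M. h y * (LINT x|?N. (\<Prod>i\<in>set vs. h (x i)) * F (y # map x vs)))"
    by (simp add: fu)
  also have "\<dots> = (LINT y|M. h y * iint M h (length vs) (\<lambda>ys. F (y # ys)))"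
  proof -
    have "AE y in M. integrable ?N (\<lambda>x. f (x(v := y)))"
      using P.AE_integrable_fst'[OF int2] by simp
    with AE_space have ae: "AE y in M. h y * (LINT x|?N. (\<Prod>i\<in>set vs. h (x i)) * F (y # map x vs))
        = h y * iint M h (length vs) (\<lambda>ys. F (y # ys))"
    proof eventually_elim
      case (elim y)
      hence y: "y \<in> space M" by simp
      \<comment> \<open>At a zero of \<open>h\<close> both sides vanish; elsewhere division by
        \<open>h y\<close> yields integrability of the slice without that factor.\<close>
      show ?case
      proof (cases "h y = 0")
        case False
        hence int': "integrable ?N (\<lambda>x. (\<Prod>i\<in>set vs. h (x i)) * F (y # map x vs))"
          using elim integrable_mult_right[of "inverse (h y)" ?N "\<lambda>x. f (x(v := y))"]
          by (simp add: fu mult.assoc[symmetric])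
        have "(\<lambda>x. x(v := y)) \<in> ?N \<rightarrow>\<^sub>M ?V"
          by (rule measurable_fun_upd[where J="set vs"]) (use y in auto)
        from measurable_compose[OF this Cons.prems(2)[unfolded list.set]]
        have "(\<lambda>x. F (y # map (x(v := y)) vs)) \<in> borel_measurable ?N"
          by (simp only: list.map fun_upd_same)
        also have "(\<lambda>x. F (y # map (x(v := y)) vs)) = (\<lambda>x. F (y # map x vs))"
        proof
          fix x
          have "map (x(v := y)) vs = map x vs" using v by (intro map_cong) auto
          thus "F (y # map (x(v := y)) vs) = F (y # map x vs)" by (simp only:)
        qed
        finally have "(\<lambda>x. F (y # map x vs)) \<in> borel_measurable ?N" .
        from Cons.IH[OF v(2) this int'] show ?thesis by simp
      qed simp
    qed
    have "(\<lambda>y. LINT x|?N. f (x(v := y))) \<in> borel_measurable M"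
      using P.integrable_fst'[OF int2] by (auto dest: borel_measurable_integrable)
    hence m1: "(\<lambda>y. h y * (LINT x|?N. (\<Prod>i\<in>set vs. h (x i)) * F (y # map x vs))) \<in> borel_measurable M"
      by (simp add: fu)
    have "(\<lambda>x. iint M h (length vs) (\<lambda>ys. F (map x [v] @ ys))) \<in> borel_measurable (PiM (set [v]) (\<lambda>_. M))"
      by (rule iint_measurable) (use Cons.prems in auto)
    moreover have "(\<lambda>y. \<lambda>i\<in>{v}. y) \<in> M \<rightarrow>\<^sub>M PiM (set [v]) (\<lambda>_. M)" by simp
    ultimately have "(\<lambda>y. iint M h (length vs) (\<lambda>ys. F (map (\<lambda>i\<in>{v}. y) [v] @ ys))) \<in> borel_measurable M"
      by (rule measurable_compose[rotated])
    hence [measurable]: "(\<lambda>y. iint M h (length vs) (\<lambda>ys. F (y # ys))) \<in> borel_measurable M" by simp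
    show ?thesis
      by (rule integral_cong_AE[OF m1 _ ae]) measurable
  qed
  finally show ?case by (simp add: f_def cint_def)
qed

section \<open>Zero-free power series\<close>

text \<open>\<open>F = exp G\<close> with \<open>G' = g\<close> is bounded away from \<open>0\<close> on the open unit disc, hence
  on the closed one; being entire, \<open>F\<close> has no zeros on a slightly larger disc.\<close>

lemma fps_log_deriv_zero_free:
  fixes F g :: "complex fps"
  assumes F0: "fps_nth F 0 = 1" and rF: "fps_conv_radius F = \<infinity>"
    and ode: "fps_deriv F = g * F" and g: "summable (\<lambda>n. norm (fps_nth g n))"
  shows "\<exists>r>1. \<forall>z. norm z < r \<longrightarrow> eval_fps F z \<noteq> 0"
proof -
  define G where "G = fps_integral0 g"
  define K where "K = (\<Sum>n. norm (fps_nth g n))"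
  have rg: "fps_conv_radius g \<ge> 1"
    using conv_radius_geI[of "fps_nth g" 1] summable_norm_cancel[OF g]
    by (simp add: fps_conv_radius_def one_ereal_def)
  have Gnth: "fps_nth G 0 = 0" "fps_nth G (Suc n) = fps_nth g n / of_nat (Suc n)" for n
    by (simp_all add: G_def fps_integral_def divide_inverse mult.commute)
  \<comment> \<open>Integration divides coefficients by \<open>n + 1\<close>, so \<open>G\<close> is
    bounded on the disc by the absolute sum of the coefficients of \<open>g\<close>.\<close>
  have Gle: "norm (fps_nth G (Suc n)) \<le> norm (fps_nth g n)" for n
  proof -
    have "norm (fps_nth G (Suc n)) = norm (fps_nth g n) / (1 + real n)"
      unfolding Gnth norm_divide by (metis norm_of_nat of_nat_Suc add.commute)
    also have "\<dots> \<le> norm (fps_nth g n) / 1" by (rule divide_left_mono) auto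
    finally show ?thesis by simp
  qed
  have "summable (\<lambda>n. fps_nth G (Suc n))"
    by (rule summable_comparison_test[OF _ g]) (use Gle in blast)
  hence "summable (fps_nth G)" by (simp only: summable_Suc_iff)
  hence rG: "fps_conv_radius G \<ge> 1"
    using conv_radius_geI[of "fps_nth G" 1] by (simp add: fps_conv_radius_def one_ereal_def)
  have dG: "fps_deriv G = g" by (simp add: G_def fps_deriv_fps_integral)
  have lt: "ereal (norm z) < fps_conv_radius g" "ereal (norm z) < fps_conv_radius G" if "norm z < 1" for z :: complex
    using that rg rG by (auto intro: less_le_trans[of _ 1])
  have G_bound: "norm (eval_fps G z) \<le> K" if z: "norm z < 1" for z
  proof -
    have le: "norm (fps_nth G (Suc n) * z ^ Suc n) \<le> norm (fps_nth g n)" for n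
    proof -
      have "norm (fps_nth G (Suc n) * z ^ Suc n) = norm (fps_nth G (Suc n)) * norm z ^ Suc n"
        by (simp add: norm_mult norm_power)
      also have "\<dots> \<le> norm (fps_nth g n) * 1"
        by (rule mult_mono[OF Gle]) (use z in \<open>auto intro: power_le_one simp del: power_Suc\<close>)
      finally show ?thesis by simp
    qed
    have s: "summable (\<lambda>n. fps_nth G n * z ^ n)" by (rule summable_fps[OF lt(2)[OF z]])
    have "eval_fps G z = (\<Sum>n. fps_nth G (Suc n) * z ^ Suc n)"
      unfolding eval_fps_def using suminf_split_head[OF s] by (simp add: Gnth(1))
    also have "norm \<dots> \<le> K" unfolding K_def
      by (rule norm_suminf_le[OF le g])
    finally show ?thesis .
  qed
  \<comment> \<open>By the differential equation \<open>H\<close> has derivative zero, which proves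
    \<open>F = exp G\<close> without choosing a logarithm.\<close>
  define H where "H z = eval_fps F z * exp (- eval_fps G z)" for z
  have "(H has_field_derivative 0) (at z within ball 0 1)" if "z \<in> ball 0 1" for z
  proof -
    have z: "norm z < 1" using that by simp
    have 1: "eval_fps (fps_deriv F) z = eval_fps g z * eval_fps F z"
      unfolding ode by (rule eval_fps_mult) (use lt[OF z] rF in auto)
    show ?thesis unfolding H_def
      by (rule derivative_eq_intros has_field_derivative_eval_fps lt z refl | simp add: rF)+
         (simp add: 1 dG algebra_simps)
  qed
  from has_field_derivative_zero_constant[OF convex_ball this]
  obtain c where c: "\<And>z. z \<in> ball 0 1 \<Longrightarrow> H z = c" by blast
  have "c = 1" using c[of 0] by (simp add: H_def eval_fps_at_0 F0 Gnth)
  have low: "norm (eval_fps F z) \<ge> exp (- K)" if z: "z \<in> ball 0 1" for z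
  proof -
    have "eval_fps F z = exp (eval_fps G z)"
      using c[OF z] \<open>c = 1\<close> by (simp add: H_def exp_minus field_simps)
    hence "norm (eval_fps F z) = exp (Re (eval_fps G z))" by simp
    moreover have "- K \<le> Re (eval_fps G z)"
      using G_bound[of z] z abs_Re_le_cmod[of "eval_fps G z"] by auto
    ultimately show ?thesis by simp
  qed
  have cont: "continuous_on UNIV (eval_fps F)"
    by (rule continuous_on_subset[OF continuous_on_eval_fps]) (simp add: rF)
  have "closed {z. exp (- K) \<le> norm (eval_fps F z)}"
    by (intro closed_Collect_le continuous_intros continuous_on_norm cont)
  hence "closure (ball 0 1) \<subseteq> {z. exp (- K) \<le> norm (eval_fps F z)}"
    by (intro closure_minimal) (use low in auto)
  hence nz: "cball 0 1 \<subseteq> {z. eval_fps F z \<noteq> 0}"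
    by (auto simp: not_le)
  have "open {z. eval_fps F z \<noteq> 0}"
    by (intro open_Collect_neq cont continuous_intros)
  from compact_subset_open_imp_ball_epsilon_subset[OF compact_cball this nz]
  obtain e where e: "e > 0" "(\<Union>x\<in>cball 0 1. ball x e) \<subseteq> {z. eval_fps F z \<noteq> 0}" by blast
  have "eval_fps F z \<noteq> 0" if z: "norm z < 1 + e" for z
  proof (cases "norm z \<le> 1")
    case True
    then show ?thesis using nz by auto
  next
    case False
    \<comment> \<open>The radial projection to the unit circle lies at distance
      \<open>norm z - 1 < e\<close>.\<close>
    define x where "x = z / norm z"
    have "dist x z = norm (z * (1 / norm z - 1))" by (simp add: x_def dist_norm algebra_simps)
    also have "\<dots> = norm z * norm (complex_of_real (1 / norm z - 1))"
      by (simp add: norm_mult)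
    also have "\<dots> = norm z * \<bar>1 / norm z - 1\<bar>" by (simp only: norm_of_real)
    also have "\<dots> = norm z - 1" using False by (cases "z = 0") (simp_all add: abs_if field_simps)
    finally have "z \<in> ball x e" using z by simp
    moreover have "x \<in> cball 0 1" by (simp add: x_def norm_divide)
    ultimately show ?thesis using e(2) by blast
  qed
  thus ?thesis using e(1) by (intro exI[of _ "1 + e"]) auto
qed

text \<open>\<open>C\<close> is the quotient \<open>A / F\<close>, and its radius of convergence is
  controlled by the zeros of \<open>F\<close>; the coefficients of \<open>C\<close> are never
  estimated.\<close>

lemma fps_quotient_at_1:
  fixes F A C :: "complex fps"
  assumes F0: "fps_nth F 0 = 1" and rF: "fps_conv_radius F = \<infinity>" and rA: "fps_conv_radius A > 1"
    and nz: "\<And>z. norm z < r \<Longrightarrow> eval_fps F z \<noteq> 0" and r: "1 < r" and C: "C * F = A"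
  shows "fps_conv_radius C > 1" "eval_fps C 1 = eval_fps A 1 / eval_fps F 1"
proof -
  have "C = A * inverse F"
    unfolding C[symmetric] using inverse_mult_eq_1'[of F] F0 by (simp add: mult.assoc)
  have rI: "fps_conv_radius (inverse F) > 1"
  proof -
    have "1 < ereal r" using r by (simp add: one_ereal_def)
    also have "\<dots> \<le> fps_conv_radius (inverse F)"
      using fps_conv_radius_inverse[of "ereal r" F] nz rF by simp
    finally show ?thesis .
  qed
  show rC: "fps_conv_radius C > 1"
    unfolding \<open>C = A * inverse F\<close>
    by (rule less_le_trans[OF _ fps_conv_radius_mult]) (use rA rI in auto)
  have "eval_fps C 1 * eval_fps F 1 = eval_fps (C * F) 1"
    by (rule eval_fps_mult[symmetric]) (use rC rF in \<open>auto simp: one_ereal_def[symmetric]\<close>)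
  thus "eval_fps C 1 = eval_fps A 1 / eval_fps F 1"
    using nz[of 1] r C by (simp add: field_simps)
qed

section \<open>Correlation functions\<close>

text \<open>The points with index in \<open>W\<close> are held fixed at \<open>\<xi>\<close>, the others are integrated over.\<close>

definition overlay :: "nat set \<Rightarrow> (nat \<Rightarrow> 'a) \<Rightarrow> (nat \<Rightarrow> 'a) \<Rightarrow> nat \<Rightarrow> 'a" where
  "overlay W \<xi> y = (\<lambda>i. if i \<in> W then \<xi> i else y i)"

lemma map_overlay:
  assumes "set ws \<inter> set vs = {}"
  shows "map (overlay (set ws) \<xi> y) (ws @ vs) = map \<xi> ws @ map y vs"
  using assms by (auto simp: overlay_def)

text \<open>\<open>\<beta>\<close> stands for \<open>exp b\<close>. The convergence condition is
  kept out of the locale: the identities between power series rest on stability and on integrability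
  of \<open>\<beta>\<close>.\<close>

locale mayer = finite_measure M for M :: "'a measure" +
  fixes h :: "'a \<Rightarrow> complex" and z :: "'a \<Rightarrow> 'a \<Rightarrow> complex" and \<beta> :: "'a \<Rightarrow> real"
  assumes h_meas [measurable]: "h \<in> borel_measurable M" and h_norm: "\<And>x. x \<in> space M \<Longrightarrow> norm (h x) = 1"
    and z_meas: "(\<lambda>p. z (fst p) (snd p)) \<in> borel_measurable (M \<Otimes>\<^sub>M M)"
    and z_sym: "\<And>x y. z x y = z y x"
    and \<beta>_int: "integrable M \<beta>" and \<beta>_nonneg: "\<And>x. 0 \<le> \<beta> x"
    and stability: "\<And>n. AE x in PiM {..<n} (\<lambda>_. M). norm (pairprod z (map x [0..<n])) \<le> (\<Prod>i<n. \<beta> (x i))"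
begin

sublocale prodM: product_sigma_finite "\<lambda>_. M"
  by (rule product_sigma_finite.intro) unfold_locales

abbreviation "PM V \<equiv> PiM V (\<lambda>_. M)"

lemma \<beta>_meas [measurable]: "\<beta> \<in> borel_measurable M"
  using \<beta>_int by auto

section \<open>Weights of configurations and stability almost everywhere\<close>

definition part_wt :: "(nat \<Rightarrow> 'a) \<Rightarrow> nat set \<Rightarrow> complex" where
  "part_wt x V = graph_prod (edge_val z x) UNIV V"

definition cluster_wt :: "(nat \<Rightarrow> 'a) \<Rightarrow> nat set \<Rightarrow> complex" where
  "cluster_wt x V = conn_sum (edge_val z x) UNIV V"

definition stab :: "(nat \<Rightarrow> 'a) \<Rightarrow> nat set \<Rightarrow> bool" where
  "stab x V \<longleftrightarrow> stable (edge_val z x) (\<lambda>i. \<beta> (x i)) V"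

lemma part_wt_cong: "(\<And>i. i \<in> V \<Longrightarrow> x i = y i) \<Longrightarrow> part_wt x V = part_wt y V"
  unfolding part_wt_def by (intro graph_prod_cong edge_val_cong)

lemma cluster_wt_cong: "(\<And>i. i \<in> V \<Longrightarrow> x i = y i) \<Longrightarrow> cluster_wt x V = cluster_wt y V"
  unfolding cluster_wt_def by (intro conn_sum_cong edge_val_cong)

lemma part_wt_meas [measurable]: "(\<lambda>x. part_wt x V) \<in> borel_measurable (PM V)"
  unfolding part_wt_def graph_prod_def
  by (intro borel_measurable_prod borel_measurable_add borel_measurable_const edge_val_measurable z_meas) auto

lemma cluster_wt_meas [measurable]: "(\<lambda>x. cluster_wt x V) \<in> borel_measurable (PM V)"
  unfolding cluster_wt_def conn_sum_def
  by (intro borel_measurable_sum borel_measurable_prod edge_val_measurable z_meas) auto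

lemma prod_nth_set:
  assumes "distinct vs"
  shows "(\<Prod>i<length vs. f (vs ! i)) = (\<Prod>v\<in>set vs. f v)"
proof -
  have inj: "inj_on ((!) vs) {..<length vs}" by (rule inj_on_nth[OF assms]) simp
  have "(\<Prod>v\<in>set vs. f v) = (\<Prod>v\<in>(!) vs ` {..<length vs}. f v)" by (simp only: set_conv_nth_image[symmetric])
  also have "\<dots> = (\<Prod>i<length vs. f (vs ! i))" by (simp add: prod.reindex[OF inj])
  finally show ?thesis ..
qed

text \<open>The hypothesis concerns one product over all of \<open>n\<close> points. Each subset
  \<open>S\<close> is relabelled to \<open>{..<card S}\<close>, the result is transported from
  \<open>S\<close> to \<open>V\<close>, and finitely many null sets are discarded.\<close>

lemma AE_stab:
  assumes "finite V"
  shows "AE x in PM V. stab x V"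
proof -
  have "AE x in PM V. norm (part_wt x S) \<le> (\<Prod>v\<in>S. \<beta> (x v))" if S: "S \<subseteq> V" for S
  proof -
    define vs where "vs = sorted_list_of_set S"
    have finS: "finite S" using finite_subset[OF S assms] .
    have vs: "distinct vs" "set vs = S" using finS by (simp_all add: vs_def)
    let ?f = "\<lambda>x. \<lambda>i\<in>{..<length vs}. x (vs ! i)"
    have m: "?f \<in> PM (set vs) \<rightarrow>\<^sub>M PM {..<length vs}"
      by (rule measurable_restrict) (auto intro: measurable_component_singleton)
    have "AE x in distr (PM (set vs)) (PM {..<length vs}) ?f.
        norm (pairprod z (map x [0..<length vs])) \<le> (\<Prod>i<length vs. \<beta> (x i))"
      unfolding distr_PiM_nth[OF sigma_finite_measure_axioms vs(1)] by (rule stability)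
    from AE_distrD[OF m this]
    have "AE x in PM S. norm (pairprod z (map (?f x) [0..<length vs])) \<le> (\<Prod>i<length vs. \<beta> (?f x i))"
      unfolding vs(2) .
    hence ae: "AE x in PM S. norm (part_wt x S) \<le> (\<Prod>v\<in>S. \<beta> (x v))"
    proof eventually_elim
      case (elim x)
      have "map (?f x) [0..<length vs] = map x vs"
        by (rule nth_equalityI) auto
      moreover have "(\<Prod>i<length vs. \<beta> (?f x i)) = (\<Prod>i<length vs. \<beta> (x (vs ! i)))"
        by (rule prod.cong) auto
      ultimately show ?case
        using elim pairprod_map[of z vs x] vs prod_nth_set[OF vs(1), of "\<lambda>i. \<beta> (x i)"] z_sym
        by (simp add: part_wt_def)
    qed
    have [measurable]: "(\<lambda>x. \<Prod>v\<in>S. \<beta> (x v)) \<in> borel_measurable (PM S)" by measurable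
    have "{x \<in> space (PM S). norm (part_wt x S) \<le> (\<Prod>v\<in>S. \<beta> (x v))} \<in> sets (PM S)" by measurable
    from prodM.AE_PiM_restrict[OF assms S this ae]
    have "AE x in PM V. norm (part_wt (restrict x S) S) \<le> (\<Prod>v\<in>S. \<beta> (restrict x S v))" .
    thus ?thesis
    proof eventually_elim
      case (elim x)
      have "part_wt (restrict x S) S = part_wt x S" by (rule part_wt_cong) simp
      thus ?case using elim by simp
    qed
  qed
  hence "\<forall>S\<in>Pow V. AE x in PM V. norm (part_wt x S) \<le> (\<Prod>v\<in>S. \<beta> (x v))" by auto
  hence "AE x in PM V. \<forall>S\<in>Pow V. norm (part_wt x S) \<le> (\<Prod>v\<in>S. \<beta> (x v))"
    by (subst AE_ball_countable) (use assms in \<open>auto intro: countable_finite\<close>)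
  thus ?thesis by eventually_elim (auto simp: stab_def stable_def part_wt_def)
qed

text \<open>An almost-everywhere statement says nothing about fixed points. Good roots are stable
  together with almost every completion, for every finite set of further labels, so labels can be
  chosen freely later.\<close>

definition good_roots :: "nat set \<Rightarrow> (nat \<Rightarrow> 'a) \<Rightarrow> bool" where
  "good_roots W \<xi> \<longleftrightarrow> finite W \<and> (\<forall>i\<in>W. \<xi> i \<in> space M) \<and>
    (\<forall>V. finite V \<longrightarrow> W \<inter> V = {} \<longrightarrow> (AE y in PM V. stab (overlay W \<xi> y) (W \<union> V)))"

lemma good_roots_empty: "good_roots {} \<xi>"
proof -
  have "overlay {} \<xi> y = y" for y by (simp add: overlay_def)
  thus ?thesis using AE_stab by (simp add: good_roots_def)
qed

text \<open>For each label set, Fubini makes almost every root stable with almost every completion.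
  Label sets are enumerated through lists, a countable type, so the exceptional sets unite to a null
  set.\<close>

lemma AE_good_roots_single: "AE x in M. good_roots {r} (\<lambda>_. x)"
proof -
  have "AE x in M. r \<notin> set vs \<longrightarrow> (AE y in PM (set vs). stab (overlay {r} (\<lambda>_. x) y) ({r} \<union> set vs))" for vs
  proof (cases "r \<in> set vs")
    case False
    let ?N = "PM (set vs)"
    interpret I: finite_product_sigma_finite "\<lambda>_. M" "set vs" by standard simp
    interpret P: pair_sigma_finite M ?N ..
    let ?u = "\<lambda>p. (snd p)(r := fst p)"
    have m: "?u \<in> M \<Otimes>\<^sub>M ?N \<rightarrow>\<^sub>M PM (insert r (set vs))"
      by (rule measurable_fun_upd[where J="set vs"]) auto
    have "AE x in distr (M \<Otimes>\<^sub>M ?N) (PM (insert r (set vs))) ?u. stab x (insert r (set vs))"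
      unfolding prodM.distr_insert[OF finite_set False] by (rule AE_stab) simp
    from P.AE_pair[OF AE_distrD[OF m this]]
    have "AE x in M. AE y in ?N. stab (y(r := x)) (insert r (set vs))" by simp
    moreover have "overlay {r} (\<lambda>_. x) y = y(r := x)" for x :: 'a and y by (auto simp: overlay_def)
    ultimately show ?thesis by simp
  qed simp
  hence "AE x in M. \<forall>vs. r \<notin> set vs \<longrightarrow> (AE y in PM (set vs). stab (overlay {r} (\<lambda>_. x) y) ({r} \<union> set vs))"
    by (subst AE_all_countable) auto
  with AE_space show ?thesis
  proof eventually_elim
    case (elim x)
    have "AE y in PM V. stab (overlay {r} (\<lambda>_. x) y) ({r} \<union> V)" if "finite V" "{r} \<inter> V = {}" for V
    proof -
      obtain vs where "set vs = V" using finite_list[OF \<open>finite V\<close>] by blast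
      thus ?thesis using elim(2) that by blast
    qed
    thus ?case using elim by (simp add: good_roots_def)
  qed
qed

lemma AE_good_roots_pair:
  assumes "r \<noteq> s"
  shows "AE p in M \<Otimes>\<^sub>M M. good_roots {r, s} (\<lambda>i. if i = r then fst p else snd p)"
proof -
  let ?\<xi> = "\<lambda>p i. if i = r then fst p else snd p"
  interpret MM: pair_sigma_finite M M ..
  have "AE p in M \<Otimes>\<^sub>M M. {r, s} \<inter> set vs = {} \<longrightarrow> (AE y in PM (set vs). stab (overlay {r, s} (?\<xi> p) y) ({r, s} \<union> set vs))" for vs
  proof (cases "{r, s} \<inter> set vs = {}")
    case True
    let ?N = "PM (set vs)"
    interpret I: finite_product_sigma_finite "\<lambda>_. M" "set vs" by standard simp
    interpret P: pair_sigma_finite "M \<Otimes>\<^sub>M M" ?N ..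
    let ?u = "\<lambda>p. (snd p)(s := snd (fst p), r := fst (fst p))"
    have m: "?u \<in> (M \<Otimes>\<^sub>M M) \<Otimes>\<^sub>M ?N \<rightarrow>\<^sub>M PM (insert r (insert s (set vs)))"
      by (rule measurable_fun_upd[where J="insert s (set vs)"], simp, rule measurable_fun_upd[where J="set vs"]) auto
    have "AE x in distr ((M \<Otimes>\<^sub>M M) \<Otimes>\<^sub>M ?N) (PM (insert r (insert s (set vs)))) ?u. stab x (insert r (insert s (set vs)))"
      using True assms by (subst prodM.distr_insert2) (auto intro!: AE_stab)
    from P.AE_pair[OF AE_distrD[OF m this]]
    have "AE p in M \<Otimes>\<^sub>M M. AE y in ?N. stab (y(s := snd p, r := fst p)) (insert r (insert s (set vs)))" by simp
    moreover have "overlay {r, s} (?\<xi> p) y = y(s := snd p, r := fst p)" for p :: "'a \<times> 'a" and y using assms by (auto simp: overlay_def)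
    ultimately show ?thesis by simp
  qed auto
  hence "AE p in M \<Otimes>\<^sub>M M. \<forall>vs. {r, s} \<inter> set vs = {} \<longrightarrow> (AE y in PM (set vs). stab (overlay {r, s} (?\<xi> p) y) ({r, s} \<union> set vs))"
    by (subst AE_all_countable) auto
  with AE_space show ?thesis
  proof eventually_elim
    case (elim p)
    have "AE y in PM V. stab (overlay {r, s} (?\<xi> p) y) ({r, s} \<union> V)" if "finite V" "{r, s} \<inter> V = {}" for V
    proof -
      obtain vs where "set vs = V" using finite_list[OF \<open>finite V\<close>] by blast
      thus ?thesis using elim(2) that by blast
    qed
    moreover have "\<forall>i\<in>{r, s}. ?\<xi> p i \<in> space M" using elim(1) by (auto simp: space_pair_measure)
    ultimately show ?case by (simp add: good_roots_def)
  qed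
qed

section \<open>Integrals with fixed roots\<close>

lemma overlay_meas:
  assumes "good_roots W \<xi>" "U \<subseteq> W \<union> V"
  shows "(\<lambda>y. restrict (overlay W \<xi> y) U) \<in> PM V \<rightarrow>\<^sub>M PM U"
proof (rule measurable_restrict)
  fix i assume "i \<in> U"
  show "(\<lambda>y. overlay W \<xi> y i) \<in> PM V \<rightarrow>\<^sub>M M"
  proof (cases "i \<in> W")
    case True
    then show ?thesis using assms by (auto simp: overlay_def good_roots_def)
  next
    case False
    then show ?thesis using assms \<open>i \<in> U\<close> by (auto simp: overlay_def intro!: measurable_component_singleton)
  qed
qed

lemma part_wt_overlay_meas:
  assumes "good_roots W \<xi>" "U \<subseteq> W \<union> V"
  shows "(\<lambda>y. part_wt (overlay W \<xi> y) U) \<in> borel_measurable (PM V)"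
proof -
  have "part_wt (overlay W \<xi> y) U = part_wt (restrict (overlay W \<xi> y) U) U" for y by (rule part_wt_cong) simp
  thus ?thesis using measurable_compose[OF overlay_meas[OF assms] part_wt_meas] by simp
qed

lemma cluster_wt_overlay_meas:
  assumes "good_roots W \<xi>" "U \<subseteq> W \<union> V"
  shows "(\<lambda>y. cluster_wt (overlay W \<xi> y) U) \<in> borel_measurable (PM V)"
proof -
  have "cluster_wt (overlay W \<xi> y) U = cluster_wt (restrict (overlay W \<xi> y) U) U" for y by (rule cluster_wt_cong) simp
  thus ?thesis using measurable_compose[OF overlay_meas[OF assms] cluster_wt_meas] by simp
qed

lemma prod_overlay:
  assumes "finite W" "finite V" "W \<inter> V = {}"
  shows "(\<Prod>i\<in>W \<union> V. f (overlay W \<xi> y i)) = (\<Prod>i\<in>W. f (\<xi> i)) * (\<Prod>i\<in>V. f (y i))"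
proof -
  have "(\<Prod>i\<in>W. f (overlay W \<xi> y i)) = (\<Prod>i\<in>W. f (\<xi> i))" by (rule prod.cong) (auto simp: overlay_def)
  moreover have "(\<Prod>i\<in>V. f (overlay W \<xi> y i)) = (\<Prod>i\<in>V. f (y i))"
    by (rule prod.cong) (use assms in \<open>auto simp: overlay_def\<close>)
  ultimately show ?thesis using assms by (simp add: prod.union_disjoint)
qed

lemma prod_\<beta>_integrable:
  assumes "finite V"
  shows "integrable (PM V) (\<lambda>y. \<Prod>i\<in>V. \<beta> (y i))"
  by (rule prodM.product_integrable_prod[OF assms]) (rule \<beta>_int)

lemma norm_prod_h:
  assumes "y \<in> space (PM V)"
  shows "norm (\<Prod>i\<in>V. h (y i)) = 1"
  using assms by (auto simp: prod_norm[symmetric] space_PiM PiE_iff h_norm intro!: prod.neutral)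

lemma weighted_integrable:
  fixes K :: real
  assumes "finite V" and f [measurable]: "f \<in> borel_measurable (PM V)"
    and bound: "AE y in PM V. norm (f y) \<le> K * (\<Prod>i\<in>V. \<beta> (y i))"
  shows "integrable (PM V) (\<lambda>y. (\<Prod>i\<in>V. h (y i)) * f y)"
    and "norm (LINT y|PM V. (\<Prod>i\<in>V. h (y i)) * f y) \<le> K * (integral\<^sup>L M \<beta>) ^ card V"
proof -
  have int: "integrable (PM V) (\<lambda>y. K * (\<Prod>i\<in>V. \<beta> (y i)))"
    using prod_\<beta>_integrable[OF assms(1)] by (rule integrable_mult_right)
  have m: "(\<lambda>y. (\<Prod>i\<in>V. h (y i)) * f y) \<in> borel_measurable (PM V)" by measurable
  have ae: "AE y in PM V. norm ((\<Prod>i\<in>V. h (y i)) * f y) \<le> K * (\<Prod>i\<in>V. \<beta> (y i))"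
    using bound AE_space by eventually_elim (simp add: norm_mult norm_prod_h)
  show i: "integrable (PM V) (\<lambda>y. (\<Prod>i\<in>V. h (y i)) * f y)"
    by (rule Bochner_Integration.integrable_bound[OF int m]) (use ae in eventually_elim, auto)
  have "norm (LINT y|PM V. (\<Prod>i\<in>V. h (y i)) * f y) \<le> (LINT y|PM V. K * (\<Prod>i\<in>V. \<beta> (y i)))"
    by (rule order_trans[OF integral_norm_bound]) (rule integral_mono_AE[OF integrable_norm[OF i] int ae])
  also have "\<dots> = K * (\<Prod>i\<in>V. integral\<^sup>L M \<beta>)"
    using prodM.product_integral_prod[OF assms(1), of "\<lambda>_. \<beta>"] \<beta>_int by simp
  finally show "norm (LINT y|PM V. (\<Prod>i\<in>V. h (y i)) * f y) \<le> K * (integral\<^sup>L M \<beta>) ^ card V" by simp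
qed

definition part_int :: "nat set \<Rightarrow> (nat \<Rightarrow> 'a) \<Rightarrow> nat set \<Rightarrow> complex" where
  "part_int W \<xi> V = (LINT y|PM V. (\<Prod>i\<in>V. h (y i)) * part_wt (overlay W \<xi> y) (W \<union> V))"

definition cluster_int :: "nat set \<Rightarrow> (nat \<Rightarrow> 'a) \<Rightarrow> nat set \<Rightarrow> complex" where
  "cluster_int W \<xi> V = (LINT y|PM V. (\<Prod>i\<in>V. h (y i)) * cluster_wt (overlay W \<xi> y) (W \<union> V))"

context
  fixes W V :: "nat set" and \<xi> :: "nat \<Rightarrow> 'a"
  assumes good: "good_roots W \<xi>" and finV: "finite V" and WV: "W \<inter> V = {}"
begin

lemma finW: "finite W" using good by (simp add: good_roots_def)

lemma AE_stab_overlay: "AE y in PM V. stab (overlay W \<xi> y) (W \<union> V)"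
  using good finV WV by (simp add: good_roots_def)

lemma part_wt_bound: "AE y in PM V. norm (part_wt (overlay W \<xi> y) (W \<union> V)) \<le> (\<Prod>i\<in>W. \<beta> (\<xi> i)) * (\<Prod>i\<in>V. \<beta> (y i))"
  using AE_stab_overlay
proof eventually_elim
  case (elim y)
  have "norm (part_wt (overlay W \<xi> y) (W \<union> V)) \<le> (\<Prod>i\<in>W \<union> V. \<beta> (overlay W \<xi> y i))"
    using elim by (simp add: stab_def stable_def part_wt_def)
  thus ?case using prod_overlay[OF finW finV WV, of \<beta>] by simp
qed

lemma cluster_wt_bound:
  assumes "W \<union> V \<noteq> {}"
  shows "AE y in PM V. norm (cluster_wt (overlay W \<xi> y) (W \<union> V))
    \<le> (crude (card (W \<union> V)) * (\<Prod>i\<in>W. \<beta> (\<xi> i))) * (\<Prod>i\<in>V. \<beta> (y i))"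
  using AE_stab_overlay
proof eventually_elim
  case (elim y)
  have "norm (cluster_wt (overlay W \<xi> y) (W \<union> V)) \<le> crude (card (W \<union> V)) * (\<Prod>i\<in>W \<union> V. \<beta> (overlay W \<xi> y i))"
    unfolding cluster_wt_def
    by (rule norm_conn_sum_crude) (use elim finW finV assms \<beta>_nonneg in \<open>auto simp: stab_def\<close>)
  thus ?case using prod_overlay[OF finW finV WV, of \<beta>] by (simp add: mult.assoc)
qed

lemma part_int_integrable: "integrable (PM V) (\<lambda>y. (\<Prod>i\<in>V. h (y i)) * part_wt (overlay W \<xi> y) (W \<union> V))"
  and norm_part_int_le: "norm (part_int W \<xi> V) \<le> (\<Prod>i\<in>W. \<beta> (\<xi> i)) * (integral\<^sup>L M \<beta>) ^ card V"
  unfolding part_int_def by (rule weighted_integrable[OF finV part_wt_overlay_meas[OF good] part_wt_bound], simp)+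

lemma cluster_int_integrable:
  assumes "W \<union> V \<noteq> {}"
  shows "integrable (PM V) (\<lambda>y. (\<Prod>i\<in>V. h (y i)) * cluster_wt (overlay W \<xi> y) (W \<union> V))"
  by (rule weighted_integrable(1)[OF finV cluster_wt_overlay_meas[OF good] cluster_wt_bound[OF assms]]) simp

text \<open>The root decomposition holds pointwise and is integrated term by term. The cluster on
  \<open>U\<close> depends only on the points in \<open>U\<close> and the remaining weight only on
  those outside, so each term factorises; the crude bound makes the terms integrable.\<close>

lemma part_int_root:
  assumes r: "r \<in> W \<union> V"
  shows "part_int W \<xi> V = (\<Sum>U | U \<subseteq> W \<union> V \<and> r \<in> U. cluster_int (W \<inter> U) \<xi> (V \<inter> U) * part_int (W - U) \<xi> (V - U))"
proof -
  let ?o = "overlay W \<xi>" and ?Us = "{U. U \<subseteq> W \<union> V \<and> r \<in> U}"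
  define t where "t U y = (\<Prod>i\<in>V. h (y i)) * (cluster_wt (?o y) U * part_wt (?o y) ((W \<union> V) - U))" for U y
  have finWV: "finite (W \<union> V)" using finW finV by simp
  have int: "integrable (PM V) (t U)" if U: "U \<in> ?Us" for U
    unfolding t_def
  proof (rule weighted_integrable(1)[OF finV])
    show "(\<lambda>y. cluster_wt (?o y) U * part_wt (?o y) (W \<union> V - U)) \<in> borel_measurable (PM V)"
      using U by (intro borel_measurable_times cluster_wt_overlay_meas part_wt_overlay_meas good) auto
    show "AE y in PM V. norm (cluster_wt (?o y) U * part_wt (?o y) (W \<union> V - U)) \<le> (crude (card U) * (\<Prod>i\<in>W. \<beta> (\<xi> i))) * (\<Prod>i\<in>V. \<beta> (y i))"
      using AE_stab_overlay
    proof eventually_elim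
      case (elim y)
      let ?B = "\<lambda>S. \<Prod>i\<in>S. \<beta> (?o y i)"
      have B0: "0 \<le> ?B S" for S by (intro prod_nonneg) (simp add: \<beta>_nonneg)
      have finU: "finite U" using U finite_subset[OF _ finWV] by simp
      have "norm (cluster_wt (?o y) U) \<le> crude (card U) * ?B U"
        unfolding cluster_wt_def
        by (rule norm_conn_sum_crude) (use elim U finU \<beta>_nonneg in \<open>auto simp: stab_def stable_def\<close>)
      moreover have "norm (part_wt (?o y) (W \<union> V - U)) \<le> ?B (W \<union> V - U)"
        using elim by (auto simp: stab_def stable_def part_wt_def)
      ultimately have "norm (cluster_wt (?o y) U * part_wt (?o y) (W \<union> V - U)) \<le> (crude (card U) * ?B U) * ?B (W \<union> V - U)"
        unfolding norm_mult by (intro mult_mono) (auto intro!: mult_nonneg_nonneg B0 order_trans[OF zero_le_one crude_ge_1])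
      also have "\<dots> = crude (card U) * ?B (W \<union> V)"
        using prod.subset_diff[of U "W \<union> V" "\<lambda>i. \<beta> (?o y i)"] U finWV by (simp add: mult_ac)
      finally show ?case using prod_overlay[OF finW finV WV, of \<beta>] by (simp add: mult.assoc)
    qed
  qed
  have "part_int W \<xi> V = (LINT y|PM V. (\<Sum>U\<in>?Us. t U y))"
    unfolding part_int_def t_def sum_distrib_left[symmetric]
    using graph_prod_root[OF finWV r] by (simp add: part_wt_def cluster_wt_def)
  also have "\<dots> = (\<Sum>U\<in>?Us. LINT y|PM V. t U y)"
    by (rule Bochner_Integration.integral_sum) (rule int)
  also have "\<dots> = (\<Sum>U\<in>?Us. cluster_int (W \<inter> U) \<xi> (V \<inter> U) * part_int (W - U) \<xi> (V - U))"
  proof (rule sum.cong[OF refl])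
    fix U assume U: "U \<in> ?Us"
    define f where "f y = (\<Prod>i\<in>V \<inter> U. h (y i)) * cluster_wt (overlay (W \<inter> U) \<xi> y) (W \<inter> U \<union> V \<inter> U)" for y
    define g where "g y = (\<Prod>i\<in>V - U. h (y i)) * part_wt (overlay (W - U) \<xi> y) (W - U \<union> (V - U))" for y
    have t: "t U y = f (restrict y (V \<inter> U)) * g (restrict y (V - U))" for y
    proof -
      have "(\<Prod>i\<in>V. h (y i)) = (\<Prod>i\<in>V \<inter> U. h (y i)) * (\<Prod>i\<in>V - U. h (y i))"
        using prod.Int_Diff[OF finV] .
      moreover have "(\<Prod>i\<in>V \<inter> U. h (restrict y (V \<inter> U) i)) = (\<Prod>i\<in>V \<inter> U. h (y i))"
        "(\<Prod>i\<in>V - U. h (restrict y (V - U) i)) = (\<Prod>i\<in>V - U. h (y i))"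
        by (auto intro!: prod.cong)
      moreover have "cluster_wt (overlay (W \<inter> U) \<xi> (restrict y (V \<inter> U))) (W \<inter> U \<union> V \<inter> U) = cluster_wt (?o y) U"
      proof -
        have "W \<inter> U \<union> V \<inter> U = U" using U by auto
        moreover have "cluster_wt (overlay (W \<inter> U) \<xi> (restrict y (V \<inter> U))) U = cluster_wt (?o y) U"
          by (rule cluster_wt_cong) (use U in \<open>auto simp: overlay_def\<close>)
        ultimately show ?thesis by simp
      qed
      moreover have "part_wt (overlay (W - U) \<xi> (restrict y (V - U))) (W - U \<union> (V - U)) = part_wt (?o y) (W \<union> V - U)"
      proof -
        have "W - U \<union> (V - U) = W \<union> V - U" by auto
        moreover have "part_wt (overlay (W - U) \<xi> (restrict y (V - U))) (W \<union> V - U) = part_wt (?o y) (W \<union> V - U)"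
          by (rule part_wt_cong) (auto simp: overlay_def)
        ultimately show ?thesis by simp
      qed
      ultimately show ?thesis by (simp add: t_def f_def g_def mult_ac)
    qed
    have V: "V \<inter> U \<union> (V - U) = V" by auto
    have "(LINT y|PM V. t U y) = (LINT y|PM (V \<inter> U). f y) * (LINT y|PM (V - U). g y)"
      unfolding t
      by (rule prodM.integral_PiM_split[of "V \<inter> U" "V - U" f g, unfolded V])
         (use finV int[OF U] in \<open>auto simp: t[symmetric]\<close>)
    thus "(LINT y|PM V. t U y) = cluster_int (W \<inter> U) \<xi> (V \<inter> U) * part_int (W - U) \<xi> (V - U)"
      by (simp add: cluster_int_def part_int_def f_def g_def)
  qed
  finally show ?thesis .
qed

end

lemma iint_pairprod:
  assumes "good_roots (set ws) \<xi>" "distinct ws" "finite V" "set ws \<inter> V = {}"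
  shows "iint M h (card V) (\<lambda>ys. pairprod z (map \<xi> ws @ ys)) = part_int (set ws) \<xi> V"
proof -
  define vs where "vs = sorted_list_of_set V"
  have vs: "distinct vs" "set vs = V" "length vs = card V" using assms by (simp_all add: vs_def)
  have eq: "pairprod z (map \<xi> ws @ map y vs) = part_wt (overlay (set ws) \<xi> y) (set ws \<union> set vs)" for y
    using pairprod_map[of z "ws @ vs" "overlay (set ws) \<xi> y"] map_overlay[of ws vs \<xi> y] assms vs z_sym
    by (simp add: part_wt_def del: map_append map_eq_conv)
  show ?thesis
    using iint_eq_PiM[OF h_meas vs(1), of "\<lambda>ys. pairprod z (map \<xi> ws @ ys)"]
      part_wt_overlay_meas[OF assms(1), of "set ws \<union> V" V] part_int_integrable[OF assms(1,3,4)]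
    unfolding eq part_int_def by (simp add: vs)
qed

lemma iint_ursell:
  assumes "good_roots (set ws) \<xi>" "distinct ws" "finite V" "set ws \<inter> V = {}" "set ws \<union> V \<noteq> {}"
  shows "fact (length ws + card V) * iint M h (card V) (\<lambda>ys. ursell z (map \<xi> ws @ ys)) = cluster_int (set ws) \<xi> V"
proof -
  define vs where "vs = sorted_list_of_set V"
  have vs: "distinct vs" "set vs = V" "length vs = card V" using assms by (simp_all add: vs_def)
  let ?c = "1 / fact (length ws + card V) :: complex"
  have eq: "ursell z (map \<xi> ws @ map y vs) = ?c * cluster_wt (overlay (set ws) \<xi> y) (set ws \<union> set vs)" for y
  proof -
    have "distinct (ws @ vs)" "ws @ vs \<noteq> []" using assms vs by auto
    from ursell_map[where z=z and x="overlay (set ws) \<xi> y", OF z_sym this] show ?thesis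
      using map_overlay[of ws vs \<xi> y] assms vs by (simp add: cluster_wt_def del: map_append map_eq_conv)
  qed
  have int: "integrable (PM V) (\<lambda>x. (\<Prod>i\<in>V. h (x i)) * (?c * cluster_wt (overlay (set ws) \<xi> x) (set ws \<union> V)))"
    using integrable_mult_right[OF cluster_int_integrable[OF assms(1,3,4,5)], of ?c] by (simp only: mult_ac)
  have m: "(\<lambda>y. ?c * cluster_wt (overlay (set ws) \<xi> y) (set ws \<union> V)) \<in> borel_measurable (PM V)"
    by (intro borel_measurable_times borel_measurable_const cluster_wt_overlay_meas assms(1)) simp
  have "iint M h (card V) (\<lambda>ys. ursell z (map \<xi> ws @ ys))
      = (LINT x|PM V. (\<Prod>i\<in>V. h (x i)) * (?c * cluster_wt (overlay (set ws) \<xi> x) (set ws \<union> V)))"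
    using iint_eq_PiM[OF h_meas vs(1), of "\<lambda>ys. ursell z (map \<xi> ws @ ys)"] int m
    unfolding eq by (simp add: vs)
  also have "\<dots> = (LINT x|PM V. ?c * ((\<Prod>i\<in>V. h (x i)) * cluster_wt (overlay (set ws) \<xi> x) (set ws \<union> V)))"
    by (simp only: mult_ac)
  also have "\<dots> = ?c * cluster_int (set ws) \<xi> V" unfolding cluster_int_def by (rule integral_mult_right_zero)
  finally show ?thesis by simp
qed

end

section \<open>Generating functions in the activity \<open>t\<close> and their identities\<close>

lemma fps_conv_radius_infinity:
  fixes f :: "nat \<Rightarrow> complex"
  assumes "\<And>n. norm (f n) \<le> A * B ^ n / fact n"
  shows "fps_conv_radius (Abs_fps f) = \<infinity>"
  unfolding fps_conv_radius_def
proof (rule conv_radius_inftyI'')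
  fix x :: complex
  have "summable (\<lambda>n. A * (inverse (fact n) * (B * norm x) ^ n))"
    by (intro summable_mult summable_exp)
  thus "summable (\<lambda>n. fps_nth (Abs_fps f) n * x ^ n)"
  proof (rule summable_comparison_test')
    fix n :: nat
    have "norm (f n * x ^ n) \<le> A * B ^ n / fact n * norm x ^ n"
      unfolding norm_mult norm_power by (intro mult_right_mono assms) simp
    thus "norm (fps_nth (Abs_fps f) n * x ^ n) \<le> A * (inverse (fact n) * (B * norm x) ^ n)"
      by (simp add: field_simps power_mult_distrib)
  qed
qed

text \<open>Binomially many choices of the points in a cluster become a Cauchy product after
  division by factorials.\<close>

lemma binomial_convolution:
  fixes A B :: "nat \<Rightarrow> complex"
  shows "(\<Sum>k<Suc n. of_nat (n choose k) * (A k * B (n - k))) / fact n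
    = (\<Sum>k=0..n. A k / fact k * (B (n - k) / fact (n - k)))"
  unfolding sum_divide_distrib
proof (rule sum.cong)
  fix k assume "k \<in> {0..n}"
  hence "(of_nat (n choose k) :: complex) = fact n / (fact k * fact (n - k))"
    by (simp add: binomial_fact)
  thus "of_nat (n choose k) * (A k * B (n - k)) / fact n = A k / fact k * (B (n - k) / fact (n - k))"
    by (simp add: field_simps)
qed auto

text \<open>The exceptional set of \<open>Q\<close> need not be measurable, so it is enclosed in a
  measurable null set before passing to the product.\<close>

lemma (in sigma_finite_measure) AE_pair_component:
  assumes "AE x in M. Q x"
  shows "AE p in M \<Otimes>\<^sub>M M. Q (fst p)" and "AE p in M \<Otimes>\<^sub>M M. Q (snd p)"
proof -
  interpret pair_sigma_finite M M ..
  obtain N where N: "N \<in> null_sets M" "{x \<in> space M. \<not> Q x} \<subseteq> N"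
    using assms by (auto simp: eventually_ae_filter)
  have [measurable]: "N \<in> sets M" using N by auto
  have aeN: "AE x in M. x \<notin> N" by (rule AE_not_in[OF N(1)])
  have "AE p in M \<Otimes>\<^sub>M M. fst p \<notin> N"
  proof (rule AE_pair_measure)
    show "AE x in M. AE y in M. fst (x, y) \<notin> N" using aeN by eventually_elim simp
  qed measurable
  with AE_space show "AE p in M \<Otimes>\<^sub>M M. Q (fst p)"
    by eventually_elim (use N(2) in \<open>auto simp: space_pair_measure\<close>)
  have "AE p in M \<Otimes>\<^sub>M M. snd p \<notin> N"
  proof (rule AE_pair_measure)
    show "AE x in M. AE y in M. snd (x, y) \<notin> N" using aeN by simp
  qed measurable
  with AE_space show "AE p in M \<Otimes>\<^sub>M M. Q (snd p)"
    by eventually_elim (use N(2) in \<open>auto simp: space_pair_measure\<close>)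
qed

context mayer
begin

definition part_fps :: "nat list \<Rightarrow> (nat \<Rightarrow> 'a) \<Rightarrow> complex fps" where
  "part_fps ws \<xi> = Abs_fps (\<lambda>n. iint M h n (\<lambda>ys. pairprod z (map \<xi> ws @ ys)) / fact n)"

text \<open>The quotient of factorials gives the factors \<open>k + 1\<close> and
  \<open>(k + 2) (k + 1)\<close> of \<open>hatZ1\<close> and \<open>hatZ2\<close>. Without roots it
  is \<open>1\<close>, and the series is \<open>log Z\<close> except for its constant
  coefficient.\<close>

definition cluster_fps :: "nat list \<Rightarrow> (nat \<Rightarrow> 'a) \<Rightarrow> complex fps" where
  "cluster_fps ws \<xi> = Abs_fps (\<lambda>n. fact (length ws + n) * iint M h n (\<lambda>ys. ursell z (map \<xi> ws @ ys)) / fact n)"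

lemma part_fps_nth:
  assumes "good_roots (set ws) \<xi>" "distinct ws" "finite V" "set ws \<inter> V = {}"
  shows "part_int (set ws) \<xi> V = fact (card V) * fps_nth (part_fps ws \<xi>) (card V)"
  using iint_pairprod[OF assms] by (simp add: part_fps_def)

lemma cluster_fps_nth:
  assumes "good_roots (set ws) \<xi>" "distinct ws" "finite V" "set ws \<inter> V = {}" "set ws \<union> V \<noteq> {}"
  shows "cluster_int (set ws) \<xi> V = fact (card V) * fps_nth (cluster_fps ws \<xi>) (card V)"
  using iint_ursell[OF assms] by (simp add: cluster_fps_def)

lemma part_fps_Nil: "part_fps [] \<xi> = part_fps [] \<xi>'" by (simp add: part_fps_def)

lemma part_fps_conv_radius:
  assumes "good_roots (set ws) \<xi>" "distinct ws"
  shows "fps_conv_radius (part_fps ws \<xi>) = \<infinity>"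
  unfolding part_fps_def
proof (rule fps_conv_radius_infinity)
  fix n
  \<comment> \<open>Fresh labels, above those of all roots.\<close>
  define V where "V = {Suc (Max (insert 0 (set ws)))..<Suc (Max (insert 0 (set ws))) + n}"
  have V: "finite V" "card V = n" by (simp_all add: V_def)
  have "set ws \<inter> V = {}"
  proof -
    have "i \<le> Max (insert 0 (set ws))" if "i \<in> set ws" for i by (rule Max_ge) (use that in auto)
    thus ?thesis by (fastforce simp: V_def)
  qed
  note * = assms V(1) this
  show "norm (iint M h n (\<lambda>ys. pairprod z (map \<xi> ws @ ys)) / fact n)
      \<le> (\<Prod>i\<in>set ws. \<beta> (\<xi> i)) * (integral\<^sup>L M \<beta>) ^ n / fact n"
    using norm_part_int_le[OF *(1,3,4)] iint_pairprod[OF *]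
    by (auto simp: V norm_divide intro!: divide_right_mono)
qed

lemma part_fps_Nil_0: "fps_nth (part_fps [] \<xi>) 0 = 1"
  by (simp add: part_fps_def pairprod_def)

text \<open>Differentiation marks one of the points, here the one labelled \<open>0\<close>, and the
  configuration is sorted by its cluster. The factor on the right is the derivative of
  \<open>log Z\<close>.\<close>

lemma part_fps_deriv: "fps_deriv (part_fps [] \<xi>) = Abs_fps (\<lambda>n. of_nat (Suc n) * fps_nth (cluster_fps [] \<xi>) (Suc n)) * part_fps [] \<xi>"
proof (rule fps_ext)
  fix n
  let ?V = "{..<Suc n}" and ?p = "fps_nth (part_fps [] \<xi>)" and ?c = "fps_nth (cluster_fps [] \<xi>)"
  note good = good_roots_empty[of \<xi>]
  define f where "f m = fact m * ?c m * (fact (Suc n - m) * ?p (Suc n - m))" for m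
  have "fact (Suc n) * ?p (Suc n) = part_int {} \<xi> ?V"
    using part_fps_nth[of "[]" \<xi> ?V] good by simp
  also have "\<dots> = (\<Sum>U | U \<subseteq> ?V \<and> 0 \<in> U. cluster_int {} \<xi> U * part_int {} \<xi> (?V - U))"
    using part_int_root[OF good, of ?V 0] by (simp add: Int_absorb1)
  also have "\<dots> = (\<Sum>U | U \<subseteq> ?V \<and> 0 \<in> U. f (card U))"
  proof (rule sum.cong[OF refl])
    fix U assume U: "U \<in> {U. U \<subseteq> ?V \<and> 0 \<in> U}"
    hence fin: "finite U" using finite_subset[of U ?V] by auto
    have "card (?V - U) = Suc n - card U" using U fin by (simp add: card_Diff_subset)
    thus "cluster_int {} \<xi> U * part_int {} \<xi> (?V - U) = f (card U)"
      using cluster_fps_nth[of "[]" \<xi> U] part_fps_nth[of "[]" \<xi> "?V - U"] good fin U by (auto simp: f_def)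
  qed
  also have "\<dots> = (\<Sum>k<Suc n. of_nat (n choose k) * f (Suc k))"
    using sum_rooted_subsets_by_card[of ?V 0 f] by simp
  also have "\<dots> = (\<Sum>k<Suc n. of_nat (n choose k) * (fact (Suc k) * ?c (Suc k) * (fact (n - k) * ?p (n - k))))"
    by (simp add: f_def)
  finally have "fact (Suc n) * ?p (Suc n) = (\<Sum>k<Suc n. of_nat (n choose k) * (fact (Suc k) * ?c (Suc k) * (fact (n - k) * ?p (n - k))))" .
  moreover have "of_nat (Suc n) * x = y / fact n" if "fact (Suc n) * x = y" for x y :: complex
    using that by (auto simp: field_simps)
  ultimately have "of_nat (Suc n) * ?p (Suc n)
      = (\<Sum>k<Suc n. of_nat (n choose k) * (fact (Suc k) * ?c (Suc k) * (fact (n - k) * ?p (n - k)))) / fact n"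
    by blast
  also have "\<dots> = (\<Sum>k=0..n. fact (Suc k) * ?c (Suc k) / fact k * (fact (n - k) * ?p (n - k) / fact (n - k)))"
    by (rule binomial_convolution[where A="\<lambda>k. fact (Suc k) * ?c (Suc k)" and B="\<lambda>k. fact k * ?p k"])
  also have "\<dots> = (\<Sum>k=0..n. of_nat (Suc k) * ?c (Suc k) * ?p (n - k))"
    by (intro sum.cong refl) (simp add: field_simps)
  finally show "fps_nth (fps_deriv (part_fps [] \<xi>)) n
      = fps_nth (Abs_fps (\<lambda>n. of_nat (Suc n) * fps_nth (cluster_fps [] \<xi>) (Suc n)) * part_fps [] \<xi>) n"
    by (simp add: fps_mult_nth)
qed

text \<open>Sorting by the cluster of the fixed point leaves an ordinary partition function, without
  roots, for the points outside it.\<close>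

lemma cluster_fps_single:
  assumes good: "good_roots {r} \<xi>"
  shows "cluster_fps [r] \<xi> * part_fps [] \<xi> = part_fps [r] \<xi>"
proof (rule fps_ext)
  fix n
  let ?V = "{Suc r..<Suc r + n}" and ?p = "fps_nth (part_fps [] \<xi>)" and ?c = "fps_nth (cluster_fps [r] \<xi>)"
  have cardV: "card (insert r ?V) = Suc n" by simp
  define f where "f m = fact (m - 1) * ?c (m - 1) * (fact (Suc n - m) * ?p (Suc n - m))" for m
  have "fact n * fps_nth (part_fps [r] \<xi>) n = part_int {r} \<xi> ?V"
    using part_fps_nth[of "[r]" \<xi> ?V] good by simp
  also have "\<dots> = (\<Sum>U | U \<subseteq> insert r ?V \<and> r \<in> U. cluster_int ({r} \<inter> U) \<xi> (?V \<inter> U) * part_int ({r} - U) \<xi> (?V - U))"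
    using part_int_root[OF good, of ?V r] by simp
  also have "\<dots> = (\<Sum>U | U \<subseteq> insert r ?V \<and> r \<in> U. f (card U))"
  proof (rule sum.cong[OF refl])
    fix U assume U: "U \<in> {U. U \<subseteq> insert r ?V \<and> r \<in> U}"
    have UV: "U = insert r (?V \<inter> U)" using U by auto
    have cU: "card U = Suc (card (?V \<inter> U))" by (subst UV) simp
    have "card (?V - U) = n - card (?V \<inter> U)" by (simp add: card_Diff_subset_Int Int_commute)
    moreover have "{r} \<inter> U = {r}" "{r} - U = {}" using U by auto
    ultimately show "cluster_int ({r} \<inter> U) \<xi> (?V \<inter> U) * part_int ({r} - U) \<xi> (?V - U) = f (card U)"
      using cluster_fps_nth[of "[r]" \<xi> "?V \<inter> U"] part_fps_nth[of "[]" \<xi> "?V - U"] good good_roots_empty cU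
      by (simp add: f_def)
  qed
  also have "\<dots> = (\<Sum>k<Suc n. of_nat (n choose k) * f (Suc k))"
    using sum_rooted_subsets_by_card[of "insert r ?V" r f] cardV by simp
  also have "\<dots> = (\<Sum>k<Suc n. of_nat (n choose k) * (fact k * ?c k * (fact (n - k) * ?p (n - k))))"
    by (simp add: f_def)
  finally have "fact n * fps_nth (part_fps [r] \<xi>) n = (\<Sum>k<Suc n. of_nat (n choose k) * (fact k * ?c k * (fact (n - k) * ?p (n - k))))" .
  moreover have "x = y / fact n" if "fact n * x = y" for x y :: complex
    using that by auto
  ultimately have "fps_nth (part_fps [r] \<xi>) n
      = (\<Sum>k<Suc n. of_nat (n choose k) * (fact k * ?c k * (fact (n - k) * ?p (n - k)))) / fact n"
    by blast
  also have "\<dots> = (\<Sum>k=0..n. fact k * ?c k / fact k * (fact (n - k) * ?p (n - k) / fact (n - k)))"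
    by (rule binomial_convolution[where A="\<lambda>k. fact k * ?c k" and B="\<lambda>k. fact k * ?p k"])
  finally show "fps_nth (cluster_fps [r] \<xi> * part_fps [] \<xi>) n = fps_nth (part_fps [r] \<xi>) n"
    by (simp add: fps_mult_nth)
qed

text \<open>Either the cluster of \<open>r\<close> contains \<open>s\<close>, and no root is left
  outside, or it does not, and \<open>s\<close> is the root of the remaining partition
  function.\<close>

lemma cluster_fps_pair:
  assumes rs: "r < s" and good: "good_roots {r, s} \<xi>" and good_r: "good_roots {r} \<xi>" and good_s: "good_roots {s} \<xi>"
  shows "cluster_fps [r, s] \<xi> * part_fps [] \<xi> + cluster_fps [r] \<xi> * part_fps [s] \<xi> = part_fps [r, s] \<xi>"
proof (rule fps_ext)
  fix n
  define V where "V = {Suc s..<Suc s + n}"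
  have V: "finite V" "card V = n" by (simp_all add: V_def)
  let ?p = "fps_nth (part_fps [] \<xi>)" and ?q = "fps_nth (part_fps [s] \<xi>)"
    and ?c = "fps_nth (cluster_fps [r] \<xi>)" and ?d = "fps_nth (cluster_fps [r, s] \<xi>)"
  let ?W = "insert r V"
  have rV: "r \<notin> V" "s \<notin> V" "r \<noteq> s" using rs by (auto simp: V_def)
  have cardV: "card ?W = Suc n" using rV V by simp
  \<comment> \<open>Here \<open>m\<close> counts the points of the cluster without \<open>s\<close>
    but including \<open>r\<close>, so \<open>m - 1\<close> of them are integrated over, whether or
    not \<open>s\<close> belongs to the cluster.\<close>
  define f where "f m = fact (m - 1) * ?d (m - 1) * (fact (Suc n - m) * ?p (Suc n - m))
    + fact (m - 1) * ?c (m - 1) * (fact (Suc n - m) * ?q (Suc n - m))" for m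
  define t where "t U = cluster_int ({r, s} \<inter> U) \<xi> (V \<inter> U) * part_int ({r, s} - U) \<xi> (V - U)" for U
  let ?Us = "{U. U \<subseteq> ?W \<and> r \<in> U}"
  have finUs: "finite ?Us" using V by auto
  have "fact n * fps_nth (part_fps [r, s] \<xi>) n = part_int {r, s} \<xi> V"
    using part_fps_nth[of "[r, s]" \<xi> V] good rV V by simp
  also have "\<dots> = (\<Sum>U | U \<subseteq> {r, s} \<union> V \<and> r \<in> U. t U)"
    unfolding t_def by (rule part_int_root[OF good]) (use rV V in auto)
  also have "{U. U \<subseteq> {r, s} \<union> V \<and> r \<in> U} = ?Us \<union> insert s ` ?Us"
  proof (intro equalityI subsetI)
    fix U assume U: "U \<in> {U. U \<subseteq> {r, s} \<union> V \<and> r \<in> U}"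
    show "U \<in> ?Us \<union> insert s ` ?Us"
    proof (cases "s \<in> U")
      case True
      hence "U = insert s (U - {s})" by auto
      moreover have "U - {s} \<in> ?Us" using U rV by auto
      ultimately show ?thesis by blast
    next
      case False
      thus ?thesis using U by auto
    qed
  qed auto
  also have "(\<Sum>U\<in>?Us \<union> insert s ` ?Us. t U) = (\<Sum>U\<in>?Us. t U) + (\<Sum>U\<in>insert s ` ?Us. t U)"
    by (rule sum.union_disjoint) (use finUs rV in auto)
  also have "(\<Sum>U\<in>insert s ` ?Us. t U) = (\<Sum>U\<in>?Us. t (insert s U))"
  proof (subst sum.reindex)
    show "inj_on (insert s) ?Us"
    proof (rule inj_onI)
      fix U U' assume "U \<in> ?Us" "U' \<in> ?Us" "insert s U = insert s U'"
      moreover from this have "s \<notin> U" "s \<notin> U'" using rV by auto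
      ultimately show "U = U'" by (simp add: insert_ident)
    qed
  qed simp
  also have "(\<Sum>U\<in>?Us. t U) + (\<Sum>U\<in>?Us. t (insert s U)) = (\<Sum>U\<in>?Us. f (card U))"
    unfolding sum.distrib[symmetric]
  proof (rule sum.cong[OF refl])
    fix U assume U: "U \<in> ?Us"
    have sU: "s \<notin> U" using U rV by auto
    have UV: "U = insert r (V \<inter> U)" using U by auto
    have cU: "card U = Suc (card (V \<inter> U))" by (subst UV, rule card_insert_disjoint) (use rV V in auto)
    have cD: "card (V - U) = n - card (V \<inter> U)" using V by (simp add: card_Diff_subset_Int Int_commute)
    have "{r, s} \<inter> U = {r}" "{r, s} - U = {s}" using U sU by auto
    hence 1: "t U = fact (card U - 1) * ?c (card U - 1) * (fact (Suc n - card U) * ?q (Suc n - card U))"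
      using cluster_fps_nth[of "[r]" \<xi> "V \<inter> U"] part_fps_nth[of "[s]" \<xi> "V - U"] good_r good_s cU cD rV V
      by (simp add: t_def)
    have "{r, s} \<inter> insert s U = {r, s}" "{r, s} - insert s U = {}" "V \<inter> insert s U = V \<inter> U"
      "V - insert s U = V - U" using U rV by auto
    hence 2: "t (insert s U) = fact (card U - 1) * ?d (card U - 1) * (fact (Suc n - card U) * ?p (Suc n - card U))"
      using cluster_fps_nth[of "[r, s]" \<xi> "V \<inter> U"] part_fps_nth[of "[]" \<xi> "V - U"] good good_roots_empty cU cD rV V
      by (simp add: t_def)
    show "t U + t (insert s U) = f (card U)" unfolding 1 2 f_def by simp
  qed
  also have "\<dots> = (\<Sum>k<Suc n. of_nat (n choose k) * f (Suc k))"
    using sum_rooted_subsets_by_card[of ?W r f] cardV V by simp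
  also have "\<dots> = (\<Sum>k<Suc n. of_nat (n choose k) * (fact k * ?d k * (fact (n - k) * ?p (n - k))))
      + (\<Sum>k<Suc n. of_nat (n choose k) * (fact k * ?c k * (fact (n - k) * ?q (n - k))))"
    by (simp add: f_def distrib_left sum.distrib)
  finally have "fact n * fps_nth (part_fps [r, s] \<xi>) n
      = (\<Sum>k<Suc n. of_nat (n choose k) * (fact k * ?d k * (fact (n - k) * ?p (n - k))))
      + (\<Sum>k<Suc n. of_nat (n choose k) * (fact k * ?c k * (fact (n - k) * ?q (n - k))))" .
  moreover have "x = y / fact n + y' / fact n" if "fact n * x = y + y'" for x y y' :: complex
    unfolding add_divide_distrib[symmetric] that[symmetric] by simp
  ultimately have "fps_nth (part_fps [r, s] \<xi>) n
      = (\<Sum>k<Suc n. of_nat (n choose k) * (fact k * ?d k * (fact (n - k) * ?p (n - k)))) / fact n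
      + (\<Sum>k<Suc n. of_nat (n choose k) * (fact k * ?c k * (fact (n - k) * ?q (n - k)))) / fact n"
    by blast
  also have "\<dots> = (\<Sum>k=0..n. fact k * ?d k / fact k * (fact (n - k) * ?p (n - k) / fact (n - k)))
      + (\<Sum>k=0..n. fact k * ?c k / fact k * (fact (n - k) * ?q (n - k) / fact (n - k)))"
    using binomial_convolution[of n "\<lambda>k. fact k * ?d k" "\<lambda>k. fact k * ?p k"]
      binomial_convolution[of n "\<lambda>k. fact k * ?c k" "\<lambda>k. fact k * ?q k"] by (simp only:)
  finally show "fps_nth (cluster_fps [r, s] \<xi> * part_fps [] \<xi> + cluster_fps [r] \<xi> * part_fps [s] \<xi>) n = fps_nth (part_fps [r, s] \<xi>) n"
    by (simp add: fps_mult_nth)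
qed

section \<open>Convergence at \<open>t = 1\<close> and the correlation identities\<close>

definition red_kernel :: "'a \<Rightarrow> 'a \<Rightarrow> real" where
  "red_kernel x y = norm (z x y) / max 1 (norm (1 + z x y))"

sublocale tree_kernel M red_kernel \<beta>
proof
  show "(\<lambda>p. red_kernel (fst p) (snd p)) \<in> borel_measurable (M \<Otimes>\<^sub>M M)"
    unfolding red_kernel_def using z_meas by measurable
qed (auto simp: red_kernel_def z_sym[of _ _] \<beta>_nonneg)

lemma norm_cluster_wt_le:
  assumes "stab x V" "finite V" "V \<noteq> {}"
  shows "norm (cluster_wt x V) \<le> (\<Prod>i\<in>V. \<beta> (x i)) * tsum x V"
proof -
  have "red_weight (edge_val z x) = edge_val red_kernel x"
    by (auto simp: red_weight_def edge_val_def red_kernel_def)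
  moreover have "(\<Prod>e\<in>pair_edges S. norm (1 + edge_val z x e)) \<le> (\<Prod>v\<in>S. \<beta> (x v))" if "S \<subseteq> V" for S
    using assms(1) that by (simp add: stab_def stable_def graph_prod_def prod_norm)
  ultimately show ?thesis
    using norm_conn_sum_le_tree_sum[of V "\<lambda>i. \<beta> (x i)" "edge_val z x"] assms \<beta>_nonneg
    by (simp add: cluster_wt_def tsum_def)
qed

text \<open>The weight \<open>n + 1\<close> of the derivative series matches the choice of a root:
  the cluster integral over \<open>n + 1\<close> points is \<open>n!\<close> times the left-hand
  side, and the rooted tree bound for \<open>n\<close> points has the same
  \<open>n!\<close>.\<close>

lemma norm_cluster_fps_le:
  "ennreal (norm (of_nat (Suc n) * fps_nth (cluster_fps [] \<xi>) (Suc n))) \<le> (\<integral>\<^sup>+ x. ennreal (\<beta> x) * tree_coeff n x \<partial>M)"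
proof -
  \<comment> \<open>The label \<open>n\<close> is the root of the trees; its variable becomes the
    outermost one and brings its own factor \<open>\<beta>\<close>.\<close>
  let ?V = "insert n {..<n}"
  have V: "finite ?V" "card ?V = Suc n" "?V \<noteq> {}" by auto
  have ov: "overlay {} \<xi> y = y" for y by (simp add: overlay_def)
  have cluster_int: "cluster_int {} \<xi> ?V = (LINT y|PM ?V. (\<Prod>i\<in>?V. h (y i)) * cluster_wt y ?V)"
    by (simp add: cluster_int_def ov)
  have int: "integrable (PM ?V) (\<lambda>y. (\<Prod>i\<in>?V. h (y i)) * cluster_wt y ?V)"
    using cluster_int_integrable[OF good_roots_empty, of ?V \<xi>] by (simp add: ov)
  let ?F = "\<lambda>y. ennreal ((\<Prod>i\<in>?V. \<beta> (y i)) * tsum y ?V)"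
  have F [measurable]: "?F \<in> borel_measurable (PM ?V)" by measurable
  have "ennreal (norm (cluster_int {} \<xi> ?V)) \<le> (\<integral>\<^sup>+ y. ennreal (norm ((\<Prod>i\<in>?V. h (y i)) * cluster_wt y ?V)) \<partial>PM ?V)"
    unfolding cluster_int by (rule integral_norm_bound_ennreal[OF int])
  also have "\<dots> \<le> (\<integral>\<^sup>+ y. ?F y \<partial>PM ?V)"
  proof (rule nn_integral_mono_AE)
    show "AE y in PM ?V. ennreal (norm ((\<Prod>i\<in>?V. h (y i)) * cluster_wt y ?V)) \<le> ?F y"
      using AE_stab[OF V(1)] AE_space
      by eventually_elim (auto simp: norm_mult norm_prod_h simp del: prod.insert intro!: ennreal_leI norm_cluster_wt_le)
  qed
  also have "\<dots> = (\<integral>\<^sup>+ x. \<integral>\<^sup>+ y. ?F (y(n := x)) \<partial>PM {..<n} \<partial>M)"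
    by (rule prodM.product_nn_integral_insert_rev[OF _ _ F]) auto
  also have "\<dots> = (\<integral>\<^sup>+ x. ennreal (\<beta> x) * rooted_integral {..<n} n x \<partial>M)"
  proof (rule nn_integral_cong)
    fix x assume x: "x \<in> space M"
    have upd: "(\<lambda>y. y(n := x)) \<in> PM {..<n} \<rightarrow>\<^sub>M PM ?V"
      by (rule measurable_fun_upd[where J="{..<n}"]) (use x in auto)
    have [measurable]: "(\<lambda>y. tsum (y(n := x)) ?V) \<in> borel_measurable (PM {..<n})"
      using measurable_compose[OF upd tsum_measurable] .
    have "?F (y(n := x)) = ennreal (\<beta> x) * ennreal ((\<Prod>i<n. \<beta> (y i)) * tsum (y(n := x)) ?V)" for y
    proof -
      have "(\<Prod>i\<in>?V. \<beta> ((y(n := x)) i)) = \<beta> x * (\<Prod>i<n. \<beta> (y i))"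
        by (subst prod.insert) (auto intro!: prod.cong)
      thus ?thesis
        by (subst ennreal_mult[symmetric])
           (auto intro!: mult_nonneg_nonneg prod_nonneg \<beta>_nonneg simp: mult.assoc simp del: prod.insert)
    qed
    thus "(\<integral>\<^sup>+ y. ?F (y(n := x)) \<partial>PM {..<n}) = ennreal (\<beta> x) * rooted_integral {..<n} n x"
      unfolding rooted_integral_def by (simp add: nn_integral_cmult del: prod.insert)
  qed
  also have "\<dots> \<le> (\<integral>\<^sup>+ x. ennreal (\<beta> x) * (ennreal (fact n) * tree_coeff n x) \<partial>M)"
    using rooted_integral_le[of "{..<n}" n] by (intro nn_integral_mono mult_left_mono) auto
  also have "\<dots> = ennreal (fact n) * (\<integral>\<^sup>+ x. ennreal (\<beta> x) * tree_coeff n x \<partial>M)"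
    by (subst nn_integral_cmult[symmetric]) (auto simp: mult_ac)
  finally have le: "ennreal (norm (cluster_int {} \<xi> ?V)) \<le> ennreal (fact n) * (\<integral>\<^sup>+ x. ennreal (\<beta> x) * tree_coeff n x \<partial>M)" .
  have "cluster_int {} \<xi> ?V = fact (Suc n) * fps_nth (cluster_fps [] \<xi>) (Suc n)"
    using cluster_fps_nth[of "[]" \<xi> ?V] good_roots_empty V by simp
  hence "norm (cluster_int {} \<xi> ?V) = fact n * norm (of_nat (Suc n) * fps_nth (cluster_fps [] \<xi>) (Suc n))"
    by (simp add: norm_mult del: of_nat_Suc)
  hence "ennreal (fact n) * ennreal (norm (of_nat (Suc n) * fps_nth (cluster_fps [] \<xi>) (Suc n)))
      \<le> ennreal (fact n) * (\<integral>\<^sup>+ x. ennreal (\<beta> x) * tree_coeff n x \<partial>M)"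
    using le by (simp add: ennreal_mult[symmetric])
  thus ?thesis by (subst (asm) ennreal_mult_le_mult_iff) auto
qed

text \<open>Exceptional null sets enter the conclusions only through the choice of good roots; at
  good roots the identities hold exactly.\<close>

lemma correlation_identities:
  fixes a :: "'a \<Rightarrow> real"
  assumes a: "\<And>x. 0 \<le> a x" and a_meas [measurable]: "a \<in> borel_measurable M"
    and int: "AE x in M. (\<integral>\<^sup>+ y. ennreal (red_kernel x y * \<beta> y * exp (a y)) \<partial>M) \<le> ennreal (a x)"
    and fin: "(\<integral>\<^sup>+ y. ennreal (\<beta> y * exp (a y)) \<partial>M) < \<infinity>"
  shows "AE x in M. partZ1 M h z x / partZ M h z = hatZ1 M h z x"
    and "AE p in M \<Otimes>\<^sub>M M. partZ2 M h z (fst p) (snd p) / partZ M h z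
      = hatZ1 M h z (fst p) * hatZ1 M h z (snd p) + hatZ2 M h z (fst p) (snd p)"
proof -
  \<comment> \<open>Without roots the values of \<open>\<xi>\<close> are never read, so any choice
    gives the same series.\<close>
  define \<xi>0 where "\<xi>0 = (\<lambda>_ :: nat. undefined :: 'a)"
  define F where "F = part_fps [] \<xi>0"
  define G where "G = Abs_fps (\<lambda>n. of_nat (Suc n) * fps_nth (cluster_fps [] \<xi>0) (Suc n))"
  have F: "part_fps [] \<xi> = F" for \<xi> unfolding F_def by (rule part_fps_Nil)
  have F0: "fps_nth F 0 = 1" unfolding F_def by (rule part_fps_Nil_0)
  have rF: "fps_conv_radius F = \<infinity>"
    unfolding F_def by (rule part_fps_conv_radius) (simp_all add: good_roots_empty)
  have ode: "fps_deriv F = G * F" unfolding F_def G_def by (rule part_fps_deriv)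
  \<comment> \<open>The one place where the integral condition and the finiteness assumption are
    used.\<close>
  have G: "summable (\<lambda>n. norm (fps_nth G n))"
  proof (rule bounded_imp_summable)
    fix N
    have "ennreal (\<Sum>n\<le>N. norm (fps_nth G n)) = (\<Sum>n\<le>N. ennreal (norm (fps_nth G n)))"
      by (rule sum_ennreal[symmetric]) simp
    also have "\<dots> \<le> (\<Sum>n\<le>N. \<integral>\<^sup>+ x. ennreal (\<beta> x) * tree_coeff n x \<partial>M)"
      unfolding G_def by (intro sum_mono) (use norm_cluster_fps_le in simp)
    also have "\<dots> = (\<integral>\<^sup>+ x. ennreal (\<beta> x) * (\<Sum>n\<le>N. tree_coeff n x) \<partial>M)"
      unfolding sum_distrib_left by (rule nn_integral_sum[symmetric]) measurable
    also have "\<dots> \<le> (\<integral>\<^sup>+ x. ennreal (\<beta> x * exp (a x)) \<partial>M)"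
    proof (rule nn_integral_mono_AE)
      show "AE x in M. ennreal (\<beta> x) * (\<Sum>n\<le>N. tree_coeff n x) \<le> ennreal (\<beta> x * exp (a x))"
        using sum_tree_coeff_le[OF a a_meas int, of N]
        by eventually_elim (auto simp: ennreal_mult \<beta>_nonneg intro!: mult_left_mono)
    qed
    finally have le: "ennreal (\<Sum>n\<le>N. norm (fps_nth G n)) \<le> (\<integral>\<^sup>+ x. ennreal (\<beta> x * exp (a x)) \<partial>M)" .
    show "(\<Sum>n\<le>N. norm (fps_nth G n)) \<le> enn2real (\<integral>\<^sup>+ x. ennreal (\<beta> x * exp (a x)) \<partial>M)"
      using enn2real_mono[OF le] fin by (simp add: sum_nonneg)
  qed simp
  from fps_log_deriv_zero_free[OF F0 rF ode G]
  obtain r where r: "1 < r" "\<And>z. norm z < r \<Longrightarrow> eval_fps F z \<noteq> 0" by blast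
  have Z: "partZ M h z = eval_fps F 1"
    by (simp add: partZ_def eval_fps_def F_def part_fps_def)
  have single: "fps_conv_radius (cluster_fps [s] \<xi>) > 1 \<and> eval_fps (cluster_fps [s] \<xi>) 1 = hatZ1 M h z (\<xi> s)
      \<and> partZ1 M h z (\<xi> s) / partZ M h z = hatZ1 M h z (\<xi> s)" if good: "good_roots {s} \<xi>" for s \<xi>
  proof -
    have rP: "fps_conv_radius (part_fps [s] \<xi>) > 1" using part_fps_conv_radius[of "[s]" \<xi>] good by simp
    have *: "cluster_fps [s] \<xi> * F = part_fps [s] \<xi>" using cluster_fps_single[OF good] by (simp add: F)
    note q = fps_quotient_at_1[OF F0 rF rP r(2,1) *]
    have "eval_fps (part_fps [s] \<xi>) 1 = partZ1 M h z (\<xi> s)"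
      by (simp add: partZ1_def eval_fps_def part_fps_def)
    moreover have "eval_fps (cluster_fps [s] \<xi>) 1 = hatZ1 M h z (\<xi> s)"
    proof -
      have "fact (Suc k) * x / fact k = of_nat (k + 1) * x" for k and x :: complex by simp
      thus ?thesis unfolding hatZ1_def eval_fps_def cluster_fps_def by (simp del: of_nat_add fact_Suc)
    qed
    ultimately show ?thesis using q Z by simp
  qed
  show "AE x in M. partZ1 M h z x / partZ M h z = hatZ1 M h z x"
    using AE_good_roots_single[of 0] by eventually_elim (use single in blast)
  let ?\<xi> = "\<lambda>p i. if i = (0::nat) then fst p else snd p :: 'a"
  have "AE p in M \<Otimes>\<^sub>M M. good_roots {0, 1} (?\<xi> p)" by (rule AE_good_roots_pair) simp
  moreover have "AE p in M \<Otimes>\<^sub>M M. good_roots {0} (\<lambda>_. fst p)"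
    by (rule AE_pair_component(1)[OF AE_good_roots_single])
  moreover have "AE p in M \<Otimes>\<^sub>M M. good_roots {1} (\<lambda>_. snd p)"
    by (rule AE_pair_component(2)[OF AE_good_roots_single])
  ultimately show "AE p in M \<Otimes>\<^sub>M M. partZ2 M h z (fst p) (snd p) / partZ M h z
      = hatZ1 M h z (fst p) * hatZ1 M h z (snd p) + hatZ2 M h z (fst p) (snd p)"
  proof eventually_elim
    case (elim p)
    define \<xi> where "\<xi> = ?\<xi> p"
    have \<xi>: "\<xi> 0 = fst p" "\<xi> (Suc 0) = snd p" by (simp_all add: \<xi>_def)
    \<comment> \<open>Goodness of a single root depends only on the value at its label, so the
      constant assignments may be replaced by \<open>\<xi>\<close>.\<close>
    have good_cong: "good_roots {i} \<xi>" if "good_roots {i} \<xi>'" "\<xi>' i = \<xi> i" for i and \<xi>' :: "nat \<Rightarrow> 'a"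
    proof -
      have "overlay {i} \<xi>' y = overlay {i} \<xi> y" for y using that(2) by (auto simp: overlay_def)
      thus ?thesis using that by (simp add: good_roots_def)
    qed
    have good: "good_roots {0, 1} \<xi>" using elim(1) by (simp add: \<xi>_def)
    have good0: "good_roots {0} \<xi>" by (rule good_cong[OF elim(2)]) (simp add: \<xi>)
    have good1: "good_roots {1} \<xi>" by (rule good_cong[OF elim(3)]) (simp add: \<xi>)
    let ?A = "cluster_fps [0] \<xi>" and ?B = "cluster_fps [1] \<xi>" and ?D = "cluster_fps [0, 1] \<xi>"
    have AB: "fps_conv_radius ?A > 1" "fps_conv_radius ?B > 1"
      "eval_fps ?A 1 = hatZ1 M h z (fst p)" "eval_fps ?B 1 = hatZ1 M h z (snd p)"
      using single[OF good0] single[OF good1] by (simp_all add: \<xi>)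
    have "?D * F + ?A * (?B * F) = part_fps [0, 1] \<xi>"
      using cluster_fps_pair[OF zero_less_one good good0 good1] cluster_fps_single[OF good1] by (simp add: F)
    \<comment> \<open>Writing the series rooted at the second point as \<open>?B * F\<close>
      exhibits \<open>?D + ?A * ?B\<close> as a quotient by \<open>F\<close>, with entire
      numerator.\<close>
    hence *: "(?D + ?A * ?B) * F = part_fps [0, 1] \<xi>" by (simp add: algebra_simps)
    have rP: "fps_conv_radius (part_fps [0, 1] \<xi>) > 1" using part_fps_conv_radius[of "[0, 1]" \<xi>] good by simp
    note q = fps_quotient_at_1[OF F0 rF rP r(2,1) *]
    have rAB: "fps_conv_radius (?A * ?B) > 1"
      by (rule less_le_trans[OF _ fps_conv_radius_mult]) (use AB in simp)
    \<comment> \<open>Convergence of the two-point cluster series is obtained by subtracting the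
      product of the one-point series, not from a bound on its terms.\<close>
    have rD: "fps_conv_radius ?D > 1"
    proof -
      have "1 < min (fps_conv_radius (?D + ?A * ?B)) (fps_conv_radius (?A * ?B))" using q(1) rAB by simp
      also have "\<dots> \<le> fps_conv_radius ((?D + ?A * ?B) - ?A * ?B)" by (rule fps_conv_radius_diff)
      finally show ?thesis by simp
    qed
    have "eval_fps (?A * ?B) 1 = eval_fps ?A 1 * eval_fps ?B 1"
      by (rule eval_fps_mult) (use AB in \<open>simp_all add: one_ereal_def[symmetric]\<close>)
    moreover have "eval_fps (?D + ?A * ?B) 1 = eval_fps ?D 1 + eval_fps (?A * ?B) 1"
      by (rule eval_fps_add) (use rD rAB in \<open>simp_all add: one_ereal_def[symmetric]\<close>)
    moreover have "eval_fps ?D 1 = hatZ2 M h z (fst p) (snd p)"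
    proof -
      have "fact (2 + k) / fact k = (of_nat ((k + 2) * (k + 1)) :: complex)" for k
        by (simp add: field_simps)
      hence "fact (2 + k) * x / fact k = of_nat ((k + 2) * (k + 1)) * x" for k and x :: complex
        by (metis times_divide_eq_left)
      thus ?thesis unfolding hatZ2_def eval_fps_def cluster_fps_def by (simp add: \<xi> del: of_nat_mult of_nat_add fact_Suc)
    qed
    moreover have "eval_fps (part_fps [0, 1] \<xi>) 1 = partZ2 M h z (fst p) (snd p)"
      by (simp add: partZ2_def eval_fps_def part_fps_def \<xi>)
    ultimately show ?case using q(2) AB Z by (simp add: add.commute)
  qed
qed

end

section \<open>The reduced edge weight in terms of the interaction, and the conclusion\<close>

lemma norm_exp_minus_one_le:
  fixes w :: complex
  shows "norm (exp w - 1) \<le> max 1 (norm (exp w)) * norm w"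
proof -
  have "norm (exp w - exp 0) \<le> max 1 (norm (exp w)) * norm (w - 0)"
  proof (rule field_differentiable_bound[of "closed_segment 0 w" exp exp])
    fix v assume "v \<in> closed_segment 0 w"
    then obtain t where t: "0 \<le> t" "t \<le> 1" "v = t *\<^sub>R w" by (auto simp: in_segment)
    show "(exp has_field_derivative exp v) (at v within closed_segment 0 w)"
      by (rule DERIV_exp[THEN has_field_derivative_at_within])
    \<comment> \<open>On the segment from \<open>0\<close> to \<open>w\<close> the modulus of
      \<open>exp\<close> is largest at an endpoint, so it is at most
      \<open>max 1 (norm (exp w))\<close>.\<close>
    have "t * Re w \<le> max 0 (Re w)"
    proof (cases "0 \<le> Re w")
      case True
      then show ?thesis using t mult_left_le_one_le[of "Re w" t] by simp
    next
      case False
      then show ?thesis using t by (simp add: mult_nonneg_nonpos)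
    qed
    hence "exp (Re v) \<le> exp (max 0 (Re w))" using t by simp
    also have "\<dots> = max 1 (exp (Re w))" by (auto simp: max_def)
    finally show "norm (exp v) \<le> max 1 (norm (exp w))" by simp
  qed (auto simp: convex_closed_segment)
  thus ?thesis by simp
qed

text \<open>The denominator compensates the growth of \<open>exp (- u)\<close> where the real part
  of \<open>u\<close> is negative. At an infinite \<open>u\<close> both sides equal
  \<open>1\<close>.\<close>

lemma zeta_reduced_le_ubar:
  "norm (zeta ur ui x y) / max 1 (norm (1 + zeta ur ui x y)) \<le> norm (ubar ur ui x y)"
proof (cases "ur x y = \<infinity>")
  case False
  let ?u = "Complex (real_of_ereal (ur x y)) (ui x y)"
  have "norm (exp (- ?u) - 1) \<le> max 1 (norm (exp (- ?u))) * norm (- ?u)"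
    by (rule norm_exp_minus_one_le)
  thus ?thesis using False
    by (simp add: zeta_def ubar_def pos_divide_le_eq mult.commute del: norm_exp_eq_Re)
qed (simp add: zeta_def ubar_def)

lemma zeta_measurable:
  assumes [measurable]: "(\<lambda>p. ur (fst p) (snd p)) \<in> borel_measurable N"
    "(\<lambda>p. ui (fst p) (snd p)) \<in> borel_measurable N"
  shows "(\<lambda>p. zeta ur ui (fst p) (snd p)) \<in> borel_measurable N"
  unfolding zeta_def Complex_eq by measurable

theorem mainTheorem2:
  fixes M :: "'a measure" and h :: "'a \<Rightarrow> complex"
    and ur :: "'a \<Rightarrow> 'a \<Rightarrow> ereal" and ui :: "'a \<Rightarrow> 'a \<Rightarrow> real"
    and a b :: "'a \<Rightarrow> real"
  assumes mu: "cplx_meas M h"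
    and ur_meas: "(\<lambda>p. ur (fst p) (snd p)) \<in> borel_measurable (M \<Otimes>\<^sub>M M)"
    and ui_meas: "(\<lambda>p. ui (fst p) (snd p)) \<in> borel_measurable (M \<Otimes>\<^sub>M M)"
    and ur_sym: "\<And>x y. ur x y = ur y x" and ui_sym: "\<And>x y. ui x y = ui y x"
    and ur_ninf: "\<And>x y. ur x y \<noteq> - \<infinity>"
    and a_meas: "a \<in> borel_measurable M" and b_meas: "b \<in> borel_measurable M"
    and a_nn: "\<And>x. a x \<ge> 0" and b_nn: "\<And>x. b x \<ge> 0"
    and A1: "\<And>n::nat. AE x in PiM {..<n} (\<lambda>_. M).
               (\<Prod>(i, j) \<in> {(i, j). i < j \<and> j < n}. norm (1 + zeta ur ui (x i) (x j)))
                 \<le> (\<Prod>i<n. exp (b (x i)))"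
    and A2: "(AE x in M. (\<integral>\<^sup>+ y. ennreal (norm (zeta ur ui x y) * exp (a y + 2 * b y)) \<partial>M)
                 \<le> ennreal (a x))
           \<or> (AE x in M. (\<integral>\<^sup>+ y. ennreal (norm (ubar ur ui x y) * exp (a y + b y)) \<partial>M)
                 \<le> ennreal (a x))"
    and fin: "(\<integral>\<^sup>+ y. ennreal (exp (a y + 2 * b y)) \<partial>M) < \<infinity>"
  shows "(AE x1 in M. partZ1 M h (zeta ur ui) x1 / partZ M h (zeta ur ui)
            = hatZ1 M h (zeta ur ui) x1)
       \<and> (AE p in M \<Otimes>\<^sub>M M.
            partZ2 M h (zeta ur ui) (fst p) (snd p) / partZ M h (zeta ur ui)
            = hatZ1 M h (zeta ur ui) (fst p) * hatZ1 M h (zeta ur ui) (snd p)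
              + hatZ2 M h (zeta ur ui) (fst p) (snd p))"
proof -
  let ?z = "zeta ur ui" and ?\<beta> = "\<lambda>x. exp (b x)"
  interpret finite_measure M
    using mu by (intro finite_measureI) (auto simp: cplx_meas_def)
  note [measurable] = a_meas b_meas
  \<comment> \<open>The tree bound costs one factor \<open>exp b\<close> per point;
    \<open>b \<ge> 0\<close> reduces this to the given integral, and \<open>a \<ge> 0\<close> makes
    \<open>?\<beta>\<close> itself integrable.\<close>
  have le: "?\<beta> y * exp (a y) \<le> exp (a y + 2 * b y)" "?\<beta> y \<le> exp (a y + 2 * b y)" for y
    using a_nn[of y] b_nn[of y] by (simp_all add: exp_add[symmetric])
  have \<beta>_int: "integrable M ?\<beta>"
  proof (rule integrableI_bounded)
    have "(\<integral>\<^sup>+ y. ennreal (norm (?\<beta> y)) \<partial>M) \<le> (\<integral>\<^sup>+ y. ennreal (exp (a y + 2 * b y)) \<partial>M)"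
      by (intro nn_integral_mono ennreal_leI) (use le in simp)
    thus "(\<integral>\<^sup>+ y. ennreal (norm (?\<beta> y)) \<partial>M) < \<infinity>" using fin by (rule le_less_trans)
  qed simp
  have stability: "AE x in PiM {..<n} (\<lambda>_. M). norm (pairprod ?z (map x [0..<n])) \<le> (\<Prod>i<n. ?\<beta> (x i))" for n
    using A1[of n]
  proof eventually_elim
    case (elim x)
    have "norm (pairprod ?z (map x [0..<n])) = (\<Prod>(i, j) \<in> {(i, j). i < j \<and> j < n}. norm (1 + ?z (x i) (x j)))"
      unfolding pairprod_def prod_norm[symmetric] by (rule prod.cong) auto
    thus ?case using elim by simp
  qed
  interpret mayer M h ?z ?\<beta>
  proof
    show "(\<lambda>p. ?z (fst p) (snd p)) \<in> borel_measurable (M \<Otimes>\<^sub>M M)"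
      by (rule zeta_measurable[OF ur_meas ui_meas])
    show "?z x y = ?z y x" for x y by (simp add: zeta_def ur_sym[of x y] ui_sym[of x y])
  qed (use mu \<beta>_int stability in \<open>auto simp: cplx_meas_def\<close>)
  \<comment> \<open>Here a factor \<open>exp (b y)\<close> and the denominator of the reduced weight
    are given away; in \<open>k2\<close> the exponentials match exactly and the denominator is what
    makes the estimate work.\<close>
  have k1: "red_kernel x y * ?\<beta> y * exp (a y) \<le> norm (?z x y) * exp (a y + 2 * b y)" for x y
  proof -
    have "red_kernel x y \<le> norm (?z x y) / 1" unfolding red_kernel_def by (rule divide_left_mono) auto
    hence "red_kernel x y * (?\<beta> y * exp (a y)) \<le> norm (?z x y) * exp (a y + 2 * b y)"
      using le(1)[of y] by (intro mult_mono) auto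
    thus ?thesis by (simp add: mult.assoc)
  qed
  have k2: "red_kernel x y * ?\<beta> y * exp (a y) \<le> norm (ubar ur ui x y) * exp (a y + b y)" for x y
  proof -
    have "red_kernel x y * (?\<beta> y * exp (a y)) \<le> norm (ubar ur ui x y) * (?\<beta> y * exp (a y))"
      unfolding red_kernel_def by (intro mult_right_mono zeta_reduced_le_ubar) auto
    thus ?thesis by (simp add: exp_add mult_ac)
  qed
  have int: "AE x in M. (\<integral>\<^sup>+ y. ennreal (red_kernel x y * ?\<beta> y * exp (a y)) \<partial>M) \<le> ennreal (a x)"
    using A2
  proof
    assume "AE x in M. (\<integral>\<^sup>+ y. ennreal (norm (?z x y) * exp (a y + 2 * b y)) \<partial>M) \<le> ennreal (a x)"
    thus ?thesis
      by eventually_elim (rule order_trans[OF nn_integral_mono[OF ennreal_leI[OF k1]]])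
  next
    assume "AE x in M. (\<integral>\<^sup>+ y. ennreal (norm (ubar ur ui x y) * exp (a y + b y)) \<partial>M) \<le> ennreal (a x)"
    thus ?thesis
      by eventually_elim (rule order_trans[OF nn_integral_mono[OF ennreal_leI[OF k2]]])
  qed
  have "(\<integral>\<^sup>+ y. ennreal (?\<beta> y * exp (a y)) \<partial>M) \<le> (\<integral>\<^sup>+ y. ennreal (exp (a y + 2 * b y)) \<partial>M)"
    by (intro nn_integral_mono ennreal_leI le)
  hence "(\<integral>\<^sup>+ y. ennreal (?\<beta> y * exp (a y)) \<partial>M) < \<infinity>" using fin by (rule le_less_trans)
  from correlation_identities[OF a_nn a_meas int this] show ?thesis by blast
qed

end
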